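(* Let $k$ be a field of characteristic $p>0$ and let $m\ge 1$. For all $(\ell,r_1,r_2)\in\Omega_m$, the map $\hslash$ induces a bijection $$({}^{\ell}\mathfrak{H}^{r_1}_{r_2})^E/\sim\;\;\cong\;\;{}^{\ell}\mathbb{X}^{r_1}_{r_2}\,/\,{}^{\ell}G^{r_1}_{r_2},$$ where $\sim$ is the equivalence of polynomial matrices ($A(T)\sim B(T)$ iff $P^{-1}A(T)P=B(T)$ for some $P\in GL(m+2,k)$) and the right-hand side is the set of orbits of the right action $\star$ of ${}^{\ell}G^{r_1}_{r_2}$ on ${}^{\ell}\mathbb{X}^{r_1}_{r_2}$.
   Context: $k[T]$ is the polynomial ring in one variable. $A(T)\in\mathrm{Mat}(n,k[T])$ is exponential if $A(0)=I_n$ and $A(T)A(T')=A(T+T')$ ($T,T'$ indeterminates). For a set $S$ of polynomial matrices, $S^E$ is the set of exponential matrices in $S$. $\mathfrak{P}$ is the set of $p$-polynomials, i.e. polynomials $\sum_{i\ge0}c_iT^{p^i}$ with $c_i\in k$. $\Omega_m:=\{(\ell,r_1,r_2)\in\mathbb{Z}^3\mid 1\le \ell\le m,\ 1\le r_1\le \ell,\ 0\le r_2\le m-\ell\}$. For row vectors $\boldsymbol{a}_1\in k[T]^{r_1}$, $\boldsymbol{a}_2\in k[T]^{\ell-r_1}$, $\boldsymbol{\alpha}_1\in k[T]^{r_1}$, $\boldsymbol{\alpha}_2\in k[T]^{r_2}$ and $\varphi\in k[T]$, let $$h(\boldsymbol{a}_1,\boldsymbol{a}_2,\boldsymbol{\alpha}_1,\boldsymbol{\alpha}_2,\varphi)=\begin{pmatrix}1&\boldsymbol{a}_1&\boldsymbol{a}_2&\boldsymbol{0}&\boldsymbol{0}&\varphi\\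 \boldsymbol 0&I_{r_1}&O&O&O&{}^t\boldsymbol{\alpha}_1\\ \boldsymbol 0&O&I_{\ell-r_1}&O&O&\boldsymbol{0}\\ \boldsymbol 0&O&O&I_{r_2}&O&{}^t\boldsymbol{\alpha}_2\\ \boldsymbol 0&O&O&O&I_{m-\ell-r_2}&\boldsymbol{0}\\ 0&\boldsymbol 0&\boldsymbol 0&\boldsymbol 0&\boldsymbol 0&1\end{pmatrix}\in\mathrm{Mat}(m+2,k[T]).$$ ${}^{\ell}\mathfrak{H}^{r_1}_{r_2}$ is the set of all such matrices for which the $\ell$ entries of $(\boldsymbol{a}_1,\boldsymbol{a}_2)$ are linearly independent over $k$ and the $r_1+r_2$ entries of $(\boldsymbol{\alpha}_1,\boldsymbol{\alpha}_2)$ are linearly independent over $k$. $GL\mathrm{ss}(n,k)$: the set of symmetric matrices in $GL(n,k)$ if $p\ge3$; the set of symmetric matrices in $GL(n,k)$ with all diagonal entries zero if $p=2$. ${}^{\ell}\mathbb{X}^{r_1}_{r_2}$ is the set of tuples $(S,\boldsymbol{a}_1,\boldsymbol{a}_2,\boldsymbol{\alpha}_2,\alpha)$ with $S\in GL\mathrm{ss}(r_1,k)$, $\boldsymbol{a}_1\in\mathfrak{P}^{r_1}$, $\boldsymbol{a}_2\in\mathfrak{P}^{\ell-r_1}$, $\boldsymbol{\alpha}_2\in\mathfrak{P}^{r_2}$, $\alpha\in\mathfrak{P}$, such that the entries of $(\boldsymbol{a}_1,\boldsymbol{a}_2)$ are linearly independent over $k$ and the entries of $(\boldsymbol{a}_1,\boldsymbol{\alpha}_2)$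 are linearly independent over $k$. $\hslash:{}^{\ell}\mathbb{X}^{r_1}_{r_2}\to({}^{\ell}\mathfrak{H}^{r_1}_{r_2})^E$ is defined by $\hslash(S,\boldsymbol{a}_1,\boldsymbol{a}_2,\boldsymbol{\alpha}_2,\alpha):=h(\boldsymbol{a}_1,\boldsymbol{a}_2,\boldsymbol{a}_1S,\boldsymbol{\alpha}_2,\varphi)$, where, with $\boldsymbol{a}_1=(a_1,\dots,a_{r_1})$ and $S=(s_{i,j})$, $\varphi=\alpha+\sum_{1\le i<j\le r_1}s_{i,j}a_ia_j$ if $p=2$ and $\varphi=\alpha+\frac12\boldsymbol{a}_1S\,{}^t\boldsymbol{a}_1$ if $p\ge3$. ${}^{\ell}G^{r_1}_{r_2}$ is the group of all regular matrices $$g=\begin{pmatrix}g_{1,1}&O&O&O&O\\O&g_{2,2}&g_{2,3}&g_{2,4}&g_{2,5}\\O&O&g_{3,3}&O&g_{3,5}\\O&O&O&g_{4,4}&g_{4,5}\\O&O&O&O&g_{5,5}\end{pmatrix}\in GL(\ell+r_1+r_2+1,k)$$ with diagonal blocks of sizes $r_1,r_1,\ell-r_1,r_2,1$ and with $g_{1,1}\cdot{}^tg_{2,2}=g_{5,5}I_{r_1}$. For $\Sigma=(\sigma_{i,j})\in\mathrm{Mat}(n,k)$, $\Sigma_+$ is its strictly upper triangular part (entries $\sigma_{i,j}$ for $i<j$, and $0$ otherwise). For $\boldsymbol{a}\in k[T]^n$, $Q,\Sigma\in\mathrm{Mat}(n,k)$: $\Delta_{\boldsymbol{a},Q,\Sigma_+}:=\mathrm{Tr}(\mathrm{diag}(\boldsymbol{a})\,Q\,\Sigma_+\,{}^tQ\,\mathrm{diag}(\boldsymbol{a}))$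 if $p=2$, and $:=0$ if $p\ge3$. The right action $\star$ of ${}^{\ell}G^{r_1}_{r_2}$ on ${}^{\ell}\mathbb{X}^{r_1}_{r_2}$: $(S,\boldsymbol{a}_1,\boldsymbol{a}_2,\boldsymbol{\alpha}_2,\alpha)\star g:=(S',\boldsymbol{b}_1,\boldsymbol{b}_2,\boldsymbol{\beta}_2,\beta)$, where $S'=g_{2,2}^{-1}Sg_{1,1}$, $\boldsymbol{b}_1=\boldsymbol{a}_1g_{2,2}$, $\boldsymbol{b}_2=\boldsymbol{a}_1g_{2,3}+\boldsymbol{a}_2g_{3,3}$, $\boldsymbol{\beta}_2=\boldsymbol{a}_1g_{2,4}+\boldsymbol{\alpha}_2g_{4,4}$, $\beta=\boldsymbol{a}_1g_{2,5}+\boldsymbol{a}_2g_{3,5}+\boldsymbol{\alpha}_2g_{4,5}+\alpha g_{5,5}-\Delta_{\boldsymbol{a}_1,\,g_{2,2},\,S'_+}$. *)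

theory Defs
  imports
    "Jordan_Normal_Form.Matrix"
    "HOL-Computational_Algebra.Computational_Algebra"
begin

text \<open>
  The field \<open>k\<close> is the type \<open>'k\<close>, and \<open>p\<close> is \<open>CHAR('k)\<close>. Row vectors of length \<open>r\<close> are
  elements of \<open>carrier_mat 1 r\<close>. In matrices and vectors the indices are zero-based.
\<close>

definition append_cols :: "'a::zero mat \<Rightarrow> 'a mat \<Rightarrow> 'a mat"  (infixr \<open>@\<^sub>c\<close> 66) where
  "A @\<^sub>c B = four_block_mat A B (0\<^sub>m 0 (dim_col A)) (0\<^sub>m 0 (dim_col B))"

definition GL :: "nat \<Rightarrow> 'k::field mat set" where
  "GL n = Units (ring_mat TYPE('k) n ())"

definition mat_inv :: "nat \<Rightarrow> 'k::field mat \<Rightarrow> 'k mat" where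
  "mat_inv n P = inv\<^bsub>ring_mat TYPE('k) n ()\<^esub> P"

abbreviation cmat :: "'k::field mat \<Rightarrow> 'k poly mat" where
  "cmat \<equiv> map_mat (\<lambda>c. [:c:])"

definition mat_trace :: "'a::comm_monoid_add mat \<Rightarrow> 'a" where
  "mat_trace A = sum_list (diag_mat A)"

definition strict_upper :: "'a::zero mat \<Rightarrow> 'a mat" where
  "strict_upper A = mat (dim_row A) (dim_col A) (\<lambda>(i,j). if i < j then A $$ (i,j) else 0)"

definition row_lin_indep :: "'k::field poly mat \<Rightarrow> bool" where
  "row_lin_indep v \<longleftrightarrow>
     (\<forall>c :: nat \<Rightarrow> 'k. (\<Sum>i<dim_col v. smult (c i) (v $$ (0,i))) = 0 \<longrightarrow> (\<forall>i<dim_col v. c i = 0))"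


text \<open>
  The ring \<open>k[T,T']\<close> is \<open>'k poly poly\<close>, with \<open>T'\<close> the outer variable and \<open>T\<close> the constant
  polynomial \<open>[:[:0, 1:]:]\<close>. The three functions are the substitutions sending \<open>f(T)\<close> to \<open>f(T)\<close>,
  \<open>f(T')\<close> and \<open>f(T + T')\<close>.
\<close>

definition in_T :: "'k::field poly \<Rightarrow> 'k poly poly" where
  "in_T f = [:f:]"

definition in_T' :: "'k::field poly \<Rightarrow> 'k poly poly" where
  "in_T' f = map_poly (\<lambda>c. [:c:]) f"

definition in_T_plus_T' :: "'k::field poly \<Rightarrow> 'k poly poly" where
  "in_T_plus_T' f = pcompose (map_poly (\<lambda>c. [:c:]) f) [:[:0, 1:], 1:]"

definition exponential :: "nat \<Rightarrow> 'k::field poly mat \<Rightarrow> bool" where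
  "exponential n A \<longleftrightarrow> A \<in> carrier_mat n n
     \<and> map_mat (\<lambda>f. poly f 0) A = 1\<^sub>m n
     \<and> map_mat in_T A * map_mat in_T' A = map_mat in_T_plus_T' A"

definition exp_part :: "nat \<Rightarrow> 'k::field poly mat set \<Rightarrow> 'k poly mat set" where
  "exp_part n \<S> = {A \<in> \<S>. exponential n A}"

definition pmat_equiv :: "nat \<Rightarrow> 'k::field poly mat \<Rightarrow> 'k poly mat \<Rightarrow> bool" where
  "pmat_equiv n A B \<longleftrightarrow> (\<exists>P \<in> GL n. cmat (mat_inv n P) * A * cmat P = B)"

definition pmat_equiv_rel :: "nat \<Rightarrow> 'k::field poly mat set \<Rightarrow> ('k poly mat \<times> 'k poly mat) set" where
  "pmat_equiv_rel n \<S> = {(A, B). A \<in> \<S> \<and> B \<in> \<S> \<and> pmat_equiv n A B}"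

definition p_polys :: "'k::field poly set" where
  "p_polys = {f. \<exists>(N::nat) (c :: nat \<Rightarrow> 'k). f = (\<Sum>i<N. monom (c i) (CHAR('k) ^ i))}"

definition p_poly_rows :: "nat \<Rightarrow> 'k::field poly mat set" where
  "p_poly_rows r = {v \<in> carrier_mat 1 r. \<forall>i<r. v $$ (0,i) \<in> p_polys}"


definition Omega :: "nat \<Rightarrow> (nat \<times> nat \<times> nat) set" where
  "Omega m = {(l, r1, r2). 1 \<le> l \<and> l \<le> m \<and> 1 \<le> r1 \<and> r1 \<le> l \<and> r2 \<le> m - l}"

definition h_mat :: "nat \<Rightarrow> nat \<Rightarrow> nat \<Rightarrow> nat \<Rightarrow> 'k::field poly mat \<Rightarrow> 'k poly mat
    \<Rightarrow> 'k poly mat \<Rightarrow> 'k poly mat \<Rightarrow> 'k poly \<Rightarrow> 'k poly mat" where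
  "h_mat m l r1 r2 a1 a2 \<alpha>1 \<alpha>2 \<phi> = (let s = l - r1; t = m - l - r2 in
     (1\<^sub>m 1    @\<^sub>c a1        @\<^sub>c a2       @\<^sub>c 0\<^sub>m 1 r2  @\<^sub>c 0\<^sub>m 1 t  @\<^sub>c mat 1 1 (\<lambda>_. \<phi>)) @\<^sub>r
     (0\<^sub>m r1 1 @\<^sub>c 1\<^sub>m r1     @\<^sub>c 0\<^sub>m r1 s @\<^sub>c 0\<^sub>m r1 r2 @\<^sub>c 0\<^sub>m r1 t @\<^sub>c transpose_mat \<alpha>1) @\<^sub>r
     (0\<^sub>m s 1  @\<^sub>c 0\<^sub>m s r1  @\<^sub>c 1\<^sub>m s    @\<^sub>c 0\<^sub>m s r2  @\<^sub>c 0\<^sub>m s t  @\<^sub>c 0\<^sub>m s 1) @\<^sub>r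
     (0\<^sub>m r2 1 @\<^sub>c 0\<^sub>m r2 r1 @\<^sub>c 0\<^sub>m r2 s @\<^sub>c 1\<^sub>m r2    @\<^sub>c 0\<^sub>m r2 t @\<^sub>c transpose_mat \<alpha>2) @\<^sub>r
     (0\<^sub>m t 1  @\<^sub>c 0\<^sub>m t r1  @\<^sub>c 0\<^sub>m t s  @\<^sub>c 0\<^sub>m t r2  @\<^sub>c 1\<^sub>m t    @\<^sub>c 0\<^sub>m t 1) @\<^sub>r
     (0\<^sub>m 1 1  @\<^sub>c 0\<^sub>m 1 r1  @\<^sub>c 0\<^sub>m 1 s  @\<^sub>c 0\<^sub>m 1 r2  @\<^sub>c 0\<^sub>m 1 t  @\<^sub>c 1\<^sub>m 1))"

definition H_set :: "nat \<Rightarrow> nat \<Rightarrow> nat \<Rightarrow> nat \<Rightarrow> 'k::field poly mat set" where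
  "H_set m l r1 r2 = {h_mat m l r1 r2 a1 a2 \<alpha>1 \<alpha>2 \<phi> | a1 a2 \<alpha>1 \<alpha>2 \<phi>.
     a1 \<in> carrier_mat 1 r1 \<and> a2 \<in> carrier_mat 1 (l - r1)
     \<and> \<alpha>1 \<in> carrier_mat 1 r1 \<and> \<alpha>2 \<in> carrier_mat 1 r2
     \<and> row_lin_indep (a1 @\<^sub>c a2) \<and> row_lin_indep (\<alpha>1 @\<^sub>c \<alpha>2)}"

definition GLss :: "nat \<Rightarrow> 'k::field mat set" where
  "GLss n = {S \<in> GL n. transpose_mat S = S \<and> (CHAR('k) = 2 \<longrightarrow> (\<forall>i<n. S $$ (i,i) = 0))}"

type_synonym 'k datum = "'k mat \<times> 'k poly mat \<times> 'k poly mat \<times> 'k poly mat \<times> 'k poly"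

definition X_set :: "nat \<Rightarrow> nat \<Rightarrow> nat \<Rightarrow> 'k::field datum set" where
  "X_set l r1 r2 = {(S, a1, a2, \<alpha>2, \<alpha>).
     S \<in> GLss r1 \<and> a1 \<in> p_poly_rows r1 \<and> a2 \<in> p_poly_rows (l - r1)
     \<and> \<alpha>2 \<in> p_poly_rows r2 \<and> \<alpha> \<in> p_polys
     \<and> row_lin_indep (a1 @\<^sub>c a2) \<and> row_lin_indep (a1 @\<^sub>c \<alpha>2)}"

definition hbar :: "nat \<Rightarrow> nat \<Rightarrow> nat \<Rightarrow> nat \<Rightarrow> 'k::field datum \<Rightarrow> 'k poly mat" where
  "hbar m l r1 r2 = (\<lambda>(S, a1, a2, \<alpha>2, \<alpha>).
     h_mat m l r1 r2 a1 a2 (a1 * cmat S) \<alpha>2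
       (if CHAR('k) = 2
        then \<alpha> + (\<Sum>(i,j) \<in> {(i,j). i < j \<and> j < r1}. smult (S $$ (i,j)) (a1 $$ (0,i) * a1 $$ (0,j)))
        else \<alpha> + smult (1 / 2) ((a1 * cmat S * transpose_mat a1) $$ (0,0))))"


text \<open>The block of \<open>g\<close> in block position \<open>(i,j)\<close>, counted from 1, for diagonal block sizes \<open>ns\<close>.\<close>

definition block :: "nat list \<Rightarrow> 'a mat \<Rightarrow> nat \<Rightarrow> nat \<Rightarrow> 'a mat" where
  "block ns g i j = mat (ns ! (i - 1)) (ns ! (j - 1))
     (\<lambda>(u,v). g $$ (sum_list (take (i - 1) ns) + u, sum_list (take (j - 1) ns) + v))"

definition G_sizes :: "nat \<Rightarrow> nat \<Rightarrow> nat \<Rightarrow> nat list" where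
  "G_sizes l r1 r2 = [r1, r1, l - r1, r2, 1]"

definition G_set :: "nat \<Rightarrow> nat \<Rightarrow> nat \<Rightarrow> 'k::field mat set" where
  "G_set l r1 r2 = {g \<in> GL (l + r1 + r2 + 1).
     let ns = G_sizes l r1 r2; b = block ns g in
       (\<forall>i\<in>{1..5}. \<forall>j\<in>{1..5}. i \<noteq> j \<and> (i,j) \<notin> {(2,3), (2,4), (2,5), (3,5), (4,5)}
           \<longrightarrow> b i j = 0\<^sub>m (ns ! (i - 1)) (ns ! (j - 1)))
       \<and> b 1 1 * transpose_mat (b 2 2) = (b 5 5 $$ (0,0)) \<cdot>\<^sub>m 1\<^sub>m r1}"

text \<open>The argument \<open>U\<close> of \<open>Delta\<close> is the strictly upper triangular matrix \<open>\<Sigma>\<^sub>+\<close>.\<close>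

definition Delta :: "nat \<Rightarrow> 'k::field poly mat \<Rightarrow> 'k mat \<Rightarrow> 'k mat \<Rightarrow> 'k poly" where
  "Delta n a Q U =
     (if CHAR('k) = 2
      then mat_trace (mat_diag n (\<lambda>i. a $$ (0,i)) * cmat (Q * U * transpose_mat Q)
                        * mat_diag n (\<lambda>i. a $$ (0,i)))
      else 0)"

definition star :: "nat \<Rightarrow> nat \<Rightarrow> nat \<Rightarrow> 'k::field datum \<Rightarrow> 'k mat \<Rightarrow> 'k datum" where
  "star l r1 r2 = (\<lambda>(S, a1, a2, \<alpha>2, \<alpha>) g.
     let b = block (G_sizes l r1 r2) g;
         S' = mat_inv r1 (b 2 2) * S * b 1 1
     in (S',
         a1 * cmat (b 2 2),
         a1 * cmat (b 2 3) + a2 * cmat (b 3 3),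
         a1 * cmat (b 2 4) + \<alpha>2 * cmat (b 4 4),
         (a1 * cmat (b 2 5) + a2 * cmat (b 3 5) + \<alpha>2 * cmat (b 4 5)) $$ (0,0)
           + smult (b 5 5 $$ (0,0)) \<alpha> - Delta r1 a1 (b 2 2) (strict_upper S')))"

text \<open>The image of \<open>{x}\<close> under this relation is the orbit of \<open>x\<close>.\<close>

definition orbit_rel :: "nat \<Rightarrow> nat \<Rightarrow> nat \<Rightarrow> ('k::field datum \<times> 'k datum) set" where
  "orbit_rel l r1 r2 = {(x, star l r1 r2 x g) | x g. x \<in> X_set l r1 r2 \<and> g \<in> G_set l r1 r2}"

end

theory Submission
  imports Defs "HOL-Algebra.Exponent" "Jordan_Normal_Form.Determinant"
begin

text \<open>
  Comparing coefficients of \<open>T\<^sup>u T'\<^sup>v\<close> shows that a matrix \<open>h(a\<^sub>1, a\<^sub>2, \<alpha>\<^sub>1, \<alpha>\<^sub>2, \<phi>)\<close> is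
  exponential iff the entries of the four rows are additive, hence \<open>p\<close>-polynomials, and
  \<open>a\<^sub>1(T) \<cdot> \<alpha>\<^sub>1(T')\<close> is the polarization of \<open>\<phi>\<close>. The polarization is symmetric (and alternating if
  \<open>p = 2\<close>), so linear independence forces \<open>\<alpha>\<^sub>1 = a\<^sub>1 S\<close> with \<open>S\<close> in \<open>GLss\<close>; subtracting the quadratic form of
  \<open>S\<close> from \<open>\<phi>\<close> leaves a \<open>p\<close>-polynomial. Hence every exponential matrix in question is a value of \<open>hbar\<close>.

  If \<open>A P = P B\<close> for two such matrices, linear independence forces most blocks of \<open>P\<close> and of its
  inverse to vanish, so that the diagonal blocks of \<open>P\<close> are invertible. What remains of \<open>A P = P B\<close> are
  its first row and its last column, and these say that the two data differ by the action of an
  element of the group. Thus the orbit relation is the pullback of \<open>\<sim>\<close> along \<open>hbar\<close>, and the bijection of the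
  quotients is formal.
\<close>

subsection \<open>Additive polynomials\<close>

text \<open>Apart from \<open>Delta\<close>, the action is right multiplication of the row (a1, a2,
  \<alpha>2, \<alpha>) by the blocks g_ij of g with i, j >= 2, while g11 and g22 encode the
  congruence Q S' Q^T = e S for Q = g22 and e = g55. The correction \<open>Delta\<close> is caused
  by p = 2: there the quadratic form of S is written with the part S_+ above the diagonal, and this
  part is not transported by congruence. Q S'_+ Q^T has the same polar form as e S_+, but its
  diagonal contributes multiples of the squares of the entries of a1. In characteristic 2 these
  squares are again p-polynomials, so they can be moved into \<alpha>.

  A conjugating matrix has blocks that g does not have, namely those through which \<alpha>1,
  \<alpha>2 and the corner mix with the other datum. Since \<alpha>1 = a1 S, their contributions can
  be rewritten in terms of a1 and \<alpha>2; in one direction they are eliminated, in the other they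
  are solved for.

  That the orbits partition the set of data follows from \<open>orbit_rel\<close> being a pullback
  of an equivalence relation.\<close>

interpretation C_hom: comm_ring_hom "\<lambda>c::'a::comm_ring_1. [:c:]"
proof unfold_locales
  show "[:1:] = (1 :: 'a poly)" by (rule pCons_one)
qed simp_all

interpretation in_T_hom: comm_ring_hom "in_T :: 'k::field poly \<Rightarrow> _"
  by unfold_locales (simp_all add: in_T_def)

lemma map_poly_C_mult:
  "map_poly (\<lambda>c::'a::comm_ring_1. [:c:]) (f * g) = map_poly (\<lambda>c. [:c:]) f * map_poly (\<lambda>c. [:c:]) g"
  by (rule poly_eqI)
    (simp add: coeff_map_poly coeff_mult C_hom.hom_sum, simp add: mult.commute)

lemma map_poly_C_add:
  "map_poly (\<lambda>c::'a::comm_ring_1. [:c:]) (f + g) = map_poly (\<lambda>c. [:c:]) f + map_poly (\<lambda>c. [:c:]) g"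
  by (rule poly_eqI) (simp add: coeff_map_poly)

interpretation in_T'_hom: comm_ring_hom "in_T' :: 'k::field poly \<Rightarrow> _"
  by unfold_locales (simp_all add: in_T'_def map_poly_C_mult map_poly_C_add map_poly_1)

interpretation in_T_plus_T'_hom: comm_ring_hom "in_T_plus_T' :: 'k::field poly \<Rightarrow> _"
  by unfold_locales
    (simp_all add: in_T_plus_T'_def map_poly_C_mult map_poly_C_add map_poly_1
      pcompose_add pcompose_mult pcompose_1)

section \<open>Coefficients of f(T), f(T') and f(T + T')\<close>

lemma coeff_in_T: "coeff (coeff (in_T f) v) u = (if v = 0 then coeff f u else 0)"
  by (cases v) (simp_all add: in_T_def)

lemma coeff_in_T': "coeff (coeff (in_T' f) v) u = (if u = 0 then coeff f v else 0)"
  by (cases u) (simp_all add: in_T'_def coeff_map_poly)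

lemma coeff_in_T_mult_in_T': "coeff (coeff (in_T f * in_T' g) v) u = coeff f u * coeff g v"
  by (simp add: in_T_def in_T'_def coeff_map_poly mult.commute)

lemma in_T_plus_T'_monom:
  "in_T_plus_T' (monom c n) = [:[:c:]:] * ([:[:0, 1:], 1:] :: 'k::field poly poly) ^ n"
proof -
  have "map_poly (\<lambda>c. [:c:]) (monom c n) = (monom [:c:] n :: 'k poly poly)"
    by (rule poly_eqI) (simp add: coeff_map_poly)
  moreover have "pcompose (X ^ i) Y = pcompose X Y ^ i" for X Y :: "'k poly poly" and i
    by (induction i) (simp_all add: pcompose_1 pcompose_mult)
  ultimately show ?thesis
    by (simp add: in_T_plus_T'_def monom_altdef pcompose_smult pcompose_pCons pcompose_1)
qed

text \<open>By linearity it suffices to treat monomials, where this is the binomial theorem for (T +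
  T')^n: each term of the expansion is a polynomial in T times a polynomial in T', and
  \<open>coeff_in_T_mult_in_T'\<close> reads off its coefficients.\<close>

lemma coeff_in_T_plus_T':
  fixes f :: "'k::field poly"
  shows "coeff (coeff (in_T_plus_T' f) v) u = of_nat (u + v choose u) * coeff f (u + v)"
proof -
  have X: "[:[:0, 1:], 1:] = in_T [:0, 1:] + (in_T' [:0, 1:] :: 'k poly poly)"
    by (simp add: in_T_def in_T'_def map_poly_pCons)
  have m: "coeff (coeff (in_T_plus_T' (monom c n)) v) u = (if n = u + v then of_nat (u + v choose u) * c else 0)" for c :: 'k and n
  proof -
    have "coeff (coeff ([:[:0, 1:], 1:] ^ n) v) u = (if n = u + v then of_nat (n choose u) else (0::'k))"
    proof -
      have a: "of_nat (n choose k) * in_T [:0, 1:] ^ k * in_T' [:0, 1:] ^ (n - k)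
        = in_T (of_nat (n choose k) * monom 1 k) * (in_T' (monom 1 (n - k)) :: 'k poly poly)" for k
        by (simp add: in_T_hom.hom_mult in_T_hom.hom_of_nat in_T_hom.hom_power in_T'_hom.hom_power monom_altdef)
      have b: "coeff (coeff (of_nat (n choose k) * in_T [:0, 1:] ^ k * in_T' [:0, 1:] ^ (n - k)) v) u
          = (if k = u then (if n = u + v then of_nat (n choose u) else 0) else (0::'k))"
        if "k \<le> n" for k
        using that unfolding a coeff_in_T_mult_in_T' by (auto simp: of_nat_poly)
      show ?thesis
      proof -
        have "coeff (coeff ([:[:0, 1:], 1:] ^ n) v) u
          = (\<Sum>k\<le>n. if k = u then (if n = u + v then of_nat (n choose u) else 0) else (0::'k))"
          unfolding X binomial_ring coeff_sum by (rule sum.cong[OF refl], rule b) simp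
        also have "\<dots> = (if n = u + v then of_nat (n choose u) else 0)"
          by (subst sum.delta) auto
        finally show ?thesis .
      qed
    qed
    then show ?thesis
      by (simp add: in_T_plus_T'_monom)
  qed
  have "in_T_plus_T' f = (\<Sum>n\<le>degree f. in_T_plus_T' (monom (coeff f n) n))"
    by (subst (1) poly_as_sum_of_monoms[symmetric, of f]) (simp add: in_T_plus_T'_hom.hom_sum)
  also have "coeff (coeff \<dots> v) u = of_nat (u + v choose u) * coeff f (u + v)"
    by (simp add: coeff_sum m coeff_eq_0 sum.delta')
  finally show ?thesis .
qed

section \<open>The p-polynomials as the additive polynomials\<close>

lemma prime_CHAR: "CHAR('k::field) > 0 \<Longrightarrow> prime CHAR('k)"
  using prime_CHAR_semidom by blast

lemma p_polys_0 [simp]: "0 \<in> (p_polys :: 'k::field poly set)"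
  unfolding p_polys_def by (auto intro!: exI[of _ 0])

text \<open>Describing p-polynomials by their support makes closure under sums and scalar multiples
  immediate, and it is the form in which additivity can be tested one coefficient at a time.\<close>

lemma p_polys_coeff:
  assumes "CHAR('k::field) > 0"
  shows "(f :: 'k poly) \<in> p_polys \<longleftrightarrow> (\<forall>n. coeff f n \<noteq> 0 \<longrightarrow> (\<exists>i. n = CHAR('k) ^ i))"
proof
  assume "f \<in> p_polys"
  then obtain N c where f: "f = (\<Sum>i<N::nat. monom (c i) (CHAR('k) ^ i))"
    unfolding p_polys_def by auto
  show "\<forall>n. coeff f n \<noteq> 0 \<longrightarrow> (\<exists>i. n = CHAR('k) ^ i)"
  proof (intro allI impI, rule ccontr)
    fix n assume n: "coeff f n \<noteq> 0" "\<nexists>i. n = CHAR('k) ^ i"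
    then have "coeff f n = 0" unfolding f coeff_sum by (intro sum.neutral) auto
    then show False using n(1) by simp
  qed
next
  assume *: "\<forall>n. coeff f n \<noteq> 0 \<longrightarrow> (\<exists>i. n = CHAR('k) ^ i)"
  have p: "CHAR('k) > 1" using prime_CHAR[OF assms] prime_gt_1_nat by auto
  let ?N = "Suc (degree f)"
  have "f = (\<Sum>i<?N. monom (coeff f (CHAR('k) ^ i)) (CHAR('k) ^ i))"
  proof (rule poly_eqI)
    fix n
    show "coeff f n = coeff (\<Sum>i<?N. monom (coeff f (CHAR('k) ^ i)) (CHAR('k) ^ i)) n"
    proof (cases "coeff f n = 0")
      case True
      then have "(\<Sum>i<?N. coeff (monom (coeff f (CHAR('k) ^ i)) (CHAR('k) ^ i)) n) = 0"
        by (intro sum.neutral) auto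
      then show ?thesis using True by (simp add: coeff_sum)
    next
      case False
      then obtain i where i: "n = CHAR('k) ^ i" using * by auto
      \<comment> \<open>An exponent p^i in the support satisfies i < p^i <= degree, so the cut-off
        \<open>?N\<close> loses no term.\<close>
      have "i < n" using p i by (simp add: power_gt_expt)
      also have "n \<le> degree f" using False by (rule le_degree)
      finally have "i < ?N" by simp
      then show ?thesis using p by (simp add: coeff_sum i sum.delta')
    qed
  qed
  then show "f \<in> p_polys"
    unfolding p_polys_def mem_Collect_eq by (intro exI[of _ ?N] exI[of _ "\<lambda>i. coeff f (CHAR('k) ^ i)"])
qed

lemma p_polys_add [intro]:
  assumes "CHAR('k::field) > 0" "(f :: 'k poly) \<in> p_polys" "g \<in> p_polys" shows "f + g \<in> p_polys"
  using assms(2,3) unfolding p_polys_coeff[OF assms(1)] by (metis add.right_neutral coeff_add)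

lemma p_polys_smult [intro]:
  assumes "CHAR('k::field) > 0" "(f :: 'k poly) \<in> p_polys" shows "smult c f \<in> p_polys"
  using assms(2) unfolding p_polys_coeff[OF assms(1)] by auto

lemma p_polys_sum:
  assumes "CHAR('k::field) > 0" "\<And>i. i \<in> I \<Longrightarrow> (f i :: 'k poly) \<in> p_polys" shows "sum f I \<in> p_polys"
  using assms(2) by (induction I rule: infinite_finite_induct) (auto intro: p_polys_add[OF assms(1)])

text \<open>An identity in k[T,T'] and not a property of values: over the field with q elements,
  T^(2q-1) induces the identity function without being a p-polynomial.\<close>

definition additive_poly :: "'k::field poly \<Rightarrow> bool" where
  "additive_poly f \<longleftrightarrow> in_T f + in_T' f = in_T_plus_T' f"

text \<open>Linearity reduces this to a monomial c T^(p^i), and there it is the additivity of the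
  iterated Frobenius map of k[T,T'].\<close>

lemma p_polys_imp_additive:
  assumes "CHAR('k::field) > 0" "(f :: 'k poly) \<in> p_polys"
  shows "additive_poly f"
proof -
  have m: "additive_poly (monom c (CHAR('k) ^ i) :: 'k poly)" for c i
  proof -
    have "[:[:0, 1:], 1:] = in_T [:0, 1:] + (in_T' [:0, 1:] :: 'k poly poly)"
      by (simp add: in_T_def in_T'_def map_poly_pCons)
    moreover have "(in_T [:0, 1:] + in_T' [:0, 1:]) ^ (CHAR('k) ^ i)
      = in_T [:0, 1:] ^ (CHAR('k) ^ i) + (in_T' [:0, 1:] ^ (CHAR('k) ^ i) :: 'k poly poly)"
      by (rule freshmans_dream') (simp_all add: prime_CHAR[OF assms(1)])
    moreover have "in_T [:c:] = [:[:c:]:]" "in_T' [:c:] = [:[:c:]:]"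
      by (simp_all add: in_T_def in_T'_def map_poly_pCons)
    moreover have "in_T (monom c n) = in_T [:c:] * in_T [:0, 1:] ^ n"
      "in_T' (monom c n) = in_T' [:c:] * in_T' [:0, 1:] ^ n" for n
      unfolding in_T_hom.hom_power[symmetric] in_T'_hom.hom_power[symmetric]
        in_T_hom.hom_mult[symmetric] in_T'_hom.hom_mult[symmetric] by (simp_all add: monom_altdef)
    ultimately show ?thesis
      unfolding additive_poly_def in_T_plus_T'_monom by (simp only: distrib_left)
  qed
  obtain N c where "f = (\<Sum>i<N::nat. monom (c i) (CHAR('k) ^ i))"
    using assms(2) unfolding p_polys_def by auto
  then show ?thesis
    using m unfolding additive_poly_def
    by (simp add: in_T_hom.hom_sum in_T'_hom.hom_sum in_T_plus_T'_hom.hom_sum sum.distrib[symmetric])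
qed

text \<open>If \<open>n = p\<^sup>a q\<close> with \<open>p\<close> not dividing \<open>q > 1\<close>, then \<open>p\<close> does not divide the binomial coefficient of \<open>n\<close> over
  \<open>p\<^sup>a\<close>, which is the coefficient of a mixed term of \<open>(T + T')\<^sup>n\<close>.\<close>

lemma additive_imp_p_polys:
  assumes "CHAR('k::field) > 0" "additive_poly (f :: 'k poly)"
  shows "f \<in> p_polys"
  unfolding p_polys_coeff[OF assms(1)]
proof (intro allI impI)
  fix n assume n: "coeff f n \<noteq> 0"
  let ?p = "CHAR('k)"
  have p: "prime ?p" using prime_CHAR[OF assms(1)] .
  have *: "(if v = 0 then coeff f u else 0) + (if u = 0 then coeff f v else 0)
      = of_nat (u + v choose u) * coeff f (u + v)" for u v
    using arg_cong[OF assms(2)[unfolded additive_poly_def], of "\<lambda>F. coeff (coeff F v) u"]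
    by (simp add: coeff_in_T coeff_in_T' coeff_in_T_plus_T')
  \<comment> \<open>At u = v = 0 the relation reads c + c = c for the constant coefficient c, hence
    c = 0.\<close>
  have n0: "n \<noteq> 0" using *[of 0 0] n by (metis add.right_neutral add_cancel_right_right binomial_n_0 mult_1 of_nat_1)
  then obtain a q where q: "n = ?p ^ a * q" "\<not> ?p dvd q"
    using p by (metis multiplicity_decompose' not_prime_unit n0)
  have "q = 1"
  proof (rule ccontr)
    assume "q \<noteq> 1"
    moreover have "q \<noteq> 0" using q(2) by (metis dvd_0_right)
    ultimately have q1: "q > 1" by simp
    let ?u = "?p ^ a" and ?v = "?p ^ a * (q - 1)"
    have uv: "?u + ?v = n" using q(1) q1 by (simp add: algebra_simps)
    have "?u \<noteq> 0" "?v \<noteq> 0" using assms(1) q1 by simp_all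
    then have "of_nat (n choose ?u) * coeff f n = 0"
      using *[of ?v ?u, unfolded uv if_not_P[OF \<open>?u \<noteq> 0\<close>] if_not_P[OF \<open>?v \<noteq> 0\<close>]] by simp
    then have "?p dvd (n choose ?u)"
      using n by (simp add: of_nat_eq_0_iff_char_dvd)
    \<comment> \<open>The p-adic valuation of the binomial coefficient of p^a q over p^a equals that
      of q; this is the counting lemma behind Sylow's theorem.\<close>
    moreover have "multiplicity ?p (n choose ?u) = 0"
      using const_p_fac[of q ?p a] q1 p q by (simp add: not_dvd_imp_multiplicity_0)
    moreover have "(n choose ?u) \<noteq> 0" using uv by (metis binomial_eq_0_iff le_add1 not_less)
    ultimately show False
      using p by (simp add: multiplicity_eq_zero_iff)
  qed
  then show "\<exists>i. n = ?p ^ i" using q(1) by auto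
qed

lemma p_polys_poly_0:
  assumes "CHAR('k::field) > 0" "(f :: 'k poly) \<in> p_polys" shows "poly f 0 = 0"
  using assms(2) unfolding p_polys_coeff[OF assms(1)] poly_0_coeff_0
  by (metis assms(1) bot_nat_0.not_eq_extremum zero_less_power)

subsection \<open>Matrices with a nontrivial first row and last column\<close>

text \<open>A form of \<open>h_mat\<close> that forgets the block sizes: the border is given by
  functions, of which only the values on {1..m} enter. Products and intertwining relations can then
  be computed without distinguishing blocks.\<close>

definition border_mat :: "nat \<Rightarrow> (nat \<Rightarrow> 'a) \<Rightarrow> (nat \<Rightarrow> 'a) \<Rightarrow> 'a \<Rightarrow> 'a::comm_ring_1 mat" where
  "border_mat m f c \<phi> = mat (m + 2) (m + 2) (\<lambda>(i, j).
     if i = j then 1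
     else if i = 0 then (if j = Suc m then \<phi> else f j)
     else if j = Suc m then c i else 0)"

lemma border_mat_carrier [simp]: "border_mat m f c \<phi> \<in> carrier_mat (m + 2) (m + 2)"
  and border_mat_dim [simp]: "dim_row (border_mat m f c \<phi>) = m + 2" "dim_col (border_mat m f c \<phi>) = m + 2"
  by (simp_all add: border_mat_def)

lemma sum_ends:
  fixes F :: "nat \<Rightarrow> 'a::comm_monoid_add"
  shows "sum F {0..<m + 2} = F 0 + (\<Sum>k=1..m. F k) + F (Suc m)"
proof -
  have "{0..<m + 2} = insert 0 (insert (Suc m) {1..m})" by auto
  then show ?thesis by (simp add: ac_simps)
qed

lemma border_mat_mult_left:
  assumes "M \<in> carrier_mat (m + 2) nc" "i < m + 2" "j < nc"
  shows "(border_mat m f c \<phi> * M) $$ (i, j) = M $$ (i, j) +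
    (if i = 0 then (\<Sum>k=1..m. f k * M $$ (k, j)) + \<phi> * M $$ (Suc m, j)
     else if i \<le> m then c i * M $$ (Suc m, j) else 0)"
proof -
  have "(border_mat m f c \<phi> * M) $$ (i, j) = (\<Sum>k\<in>{0..<m + 2}. border_mat m f c \<phi> $$ (i, k) * M $$ (k, j))"
    using assms by (simp add: scalar_prod_def)
  also have "\<dots> = border_mat m f c \<phi> $$ (i, 0) * M $$ (0, j)
      + (\<Sum>k=1..m. border_mat m f c \<phi> $$ (i, k) * M $$ (k, j)) + border_mat m f c \<phi> $$ (i, Suc m) * M $$ (Suc m, j)"
    by (rule sum_ends)
  also have "(\<Sum>k=1..m. border_mat m f c \<phi> $$ (i, k) * M $$ (k, j))
      = (if i = 0 then \<Sum>k=1..m. f k * M $$ (k, j) else if i \<le> m then M $$ (i, j) else 0)"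
  proof (cases "1 \<le> i \<and> i \<le> m")
    case True
    then have "(\<Sum>k=1..m. border_mat m f c \<phi> $$ (i, k) * M $$ (k, j)) = (\<Sum>k\<in>{i}. border_mat m f c \<phi> $$ (i, k) * M $$ (k, j))"
      by (intro sum.mono_neutral_right) (auto simp: border_mat_def)
    then show ?thesis using True by (simp add: border_mat_def)
  next
    case False
    then show ?thesis using assms by (auto simp: border_mat_def intro!: sum.cong sum.neutral)
  qed
  finally show ?thesis
    using assms by (cases "i = Suc m") (auto simp: border_mat_def)
qed

lemma border_mat_mult_right:
  assumes "M \<in> carrier_mat nr (m + 2)" "i < nr" "j < m + 2"
  shows "(M * border_mat m f c \<phi>) $$ (i, j) = M $$ (i, j) +
    (if j = Suc m then M $$ (i, 0) * \<phi> + (\<Sum>k=1..m. M $$ (i, k) * c k)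
     else if 1 \<le> j then M $$ (i, 0) * f j else 0)"
proof -
  have "(M * border_mat m f c \<phi>) $$ (i, j) = (\<Sum>k\<in>{0..<m + 2}. M $$ (i, k) * border_mat m f c \<phi> $$ (k, j))"
    using assms by (simp add: scalar_prod_def)
  also have "\<dots> = M $$ (i, 0) * border_mat m f c \<phi> $$ (0, j)
      + (\<Sum>k=1..m. M $$ (i, k) * border_mat m f c \<phi> $$ (k, j)) + M $$ (i, Suc m) * border_mat m f c \<phi> $$ (Suc m, j)"
    by (rule sum_ends)
  also have "(\<Sum>k=1..m. M $$ (i, k) * border_mat m f c \<phi> $$ (k, j))
      = (if j = Suc m then \<Sum>k=1..m. M $$ (i, k) * c k else if 1 \<le> j then M $$ (i, j) else 0)"
  proof (cases "1 \<le> j \<and> j \<le> m")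
    case True
    then have "(\<Sum>k=1..m. M $$ (i, k) * border_mat m f c \<phi> $$ (k, j)) = (\<Sum>k\<in>{j}. M $$ (i, k) * border_mat m f c \<phi> $$ (k, j))"
      by (intro sum.mono_neutral_right) (auto simp: border_mat_def)
    then show ?thesis using True by (simp add: border_mat_def)
  next
    case False
    then show ?thesis using assms by (auto simp: border_mat_def intro!: sum.cong sum.neutral)
  qed
  finally show ?thesis
    using assms by (cases "j = 0") (auto simp: border_mat_def)
qed

text \<open>This is the group law of a Heisenberg group, with the pairing of the left row with the
  right column as its cocycle. The cocycle is the origin of the mixed term in the exponential
  condition on \<phi>.\<close>

lemma border_mat_mult:
  "border_mat m f c \<phi> * border_mat m f' c' \<phi>' = border_mat m (\<lambda>k. f k + f' k) (\<lambda>k. c k + c' k) (\<phi> + \<phi>' + (\<Sum>k=1..m. f k * c' k))"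
  (is "?L = ?R")
proof (rule eq_matI)
  fix i j assume "i < dim_row ?R" "j < dim_col ?R"
  then have ij: "i < m + 2" "j < m + 2" by simp_all
  show "?L $$ (i, j) = ?R $$ (i, j)"
  proof (cases "i = 0")
    case True
    have "(\<Sum>k=1..m. f k * border_mat m f' c' \<phi>' $$ (k, j)) = (if j = Suc m then \<Sum>k=1..m. f k * c' k else if 1 \<le> j then f j else 0)"
    proof (cases "1 \<le> j \<and> j \<le> m")
      case True
      then have "(\<Sum>k=1..m. f k * border_mat m f' c' \<phi>' $$ (k, j)) = (\<Sum>k\<in>{j}. f k * border_mat m f' c' \<phi>' $$ (k, j))"
        by (intro sum.mono_neutral_right) (auto simp: border_mat_def)
      then show ?thesis using True by (simp add: border_mat_def)
    next
      case False
      then show ?thesis using ij by (auto simp: border_mat_def intro!: sum.cong sum.neutral)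
    qed
    then show ?thesis using True ij
      by (subst border_mat_mult_left[OF border_mat_carrier]) (auto simp: border_mat_def algebra_simps)
  next
    case False
    then show ?thesis using ij
      by (subst border_mat_mult_left[OF border_mat_carrier]) (auto simp: border_mat_def algebra_simps)
  qed
qed simp_all

lemma border_mat_eq_iff:
  "border_mat m f c \<phi> = border_mat m f' c' \<phi>' \<longleftrightarrow> (\<forall>k\<in>{1..m}. f k = f' k \<and> c k = c' k) \<and> \<phi> = \<phi>'"
proof (intro iffI conjI ballI)
  assume e: "border_mat m f c \<phi> = border_mat m f' c' \<phi>'"
  show "\<phi> = \<phi>'" using arg_cong[OF e, of "\<lambda>M. M $$ (0, Suc m)"] by (simp add: border_mat_def)
  fix k assume k: "k \<in> {1..m}"
  show "f k = f' k" using k arg_cong[OF e, of "\<lambda>M. M $$ (0, k)"] by (simp add: border_mat_def)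
  show "c k = c' k" using k arg_cong[OF e, of "\<lambda>M. M $$ (k, Suc m)"] by (simp add: border_mat_def)
next
  assume "(\<forall>k\<in>{1..m}. f k = f' k \<and> c k = c' k) \<and> \<phi> = \<phi>'"
  then show "border_mat m f c \<phi> = border_mat m f' c' \<phi>'"
    by (intro eq_matI) (auto simp: border_mat_def)
qed

lemma map_mat_border_mat:
  assumes "h 0 = 0" "h 1 = 1"
  shows "map_mat h (border_mat m f c \<phi>) = border_mat m (\<lambda>k. h (f k)) (\<lambda>k. h (c k)) (h \<phi>)"
  by (rule eq_matI) (auto simp: border_mat_def assms)

lemma one_mat_border_mat: "1\<^sub>m (m + 2) = border_mat m (\<lambda>_. 0) (\<lambda>_. 0) 0"
  by (rule eq_matI) (auto simp: border_mat_def)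

lemma exponential_border_mat_iff:
  "exponential (m + 2) (border_mat m f c \<phi>) \<longleftrightarrow>
    (\<forall>k\<in>{1..m}. poly (f k) 0 = 0 \<and> poly (c k) 0 = 0 \<and> additive_poly (f k) \<and> additive_poly (c k)) \<and>
    poly \<phi> 0 = 0 \<and>
    in_T \<phi> + in_T' \<phi> + (\<Sum>k=1..m. in_T (f k) * in_T' (c k)) = in_T_plus_T' \<phi>"
proof -
  have 0: "map_mat (\<lambda>f. poly f 0) (border_mat m f c \<phi>) = border_mat m (\<lambda>k. poly (f k) 0) (\<lambda>k. poly (c k) 0) (poly \<phi> 0)"
    by (rule map_mat_border_mat) simp_all
  have 1: "map_mat in_T (border_mat m f c \<phi>) = border_mat m (\<lambda>k. in_T (f k)) (\<lambda>k. in_T (c k)) (in_T \<phi>)"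
    "map_mat in_T' (border_mat m f c \<phi>) = border_mat m (\<lambda>k. in_T' (f k)) (\<lambda>k. in_T' (c k)) (in_T' \<phi>)"
    "map_mat in_T_plus_T' (border_mat m f c \<phi>) = border_mat m (\<lambda>k. in_T_plus_T' (f k)) (\<lambda>k. in_T_plus_T' (c k)) (in_T_plus_T' \<phi>)"
    by (rule map_mat_border_mat; simp)+
  show ?thesis
    unfolding exponential_def 0 1 one_mat_border_mat border_mat_mult border_mat_eq_iff additive_poly_def by auto
qed

text \<open>The first row and the last column of \<open>h_mat\<close>. Only indices \<open>k \<ge> 1\<close> are meaningful, since \<open>k - 1\<close> is
  truncated.\<close>

definition row_entry :: "nat \<Rightarrow> nat \<Rightarrow> 'a::zero mat \<Rightarrow> 'a mat \<Rightarrow> nat \<Rightarrow> 'a" where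
  "row_entry l r1 a1 a2 k = (if k \<le> r1 then a1 $$ (0, k - 1) else if k \<le> l then a2 $$ (0, k - 1 - r1) else 0)"

definition col_entry :: "nat \<Rightarrow> nat \<Rightarrow> nat \<Rightarrow> 'a::zero mat \<Rightarrow> 'a mat \<Rightarrow> nat \<Rightarrow> 'a" where
  "col_entry l r1 r2 \<alpha>1 \<alpha>2 k = (if k \<le> r1 then \<alpha>1 $$ (0, k - 1) else if k \<le> l then 0
     else if k \<le> l + r2 then \<alpha>2 $$ (0, k - 1 - l) else 0)"

section \<open>Comparison of the block matrix with its bordered form\<close>

lemma index_append_cols:
  assumes "dim_row A = dim_row B" "i < dim_row A" "j < dim_col A + dim_col B"
  shows "(A @\<^sub>c B) $$ (i, j) = (if j < dim_col A then A $$ (i, j) else B $$ (i, j - dim_col A))"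
  using assms by (simp add: append_cols_def)

lemma dim_append_cols [simp]: "dim_row (A @\<^sub>c B) = dim_row A" "dim_col (A @\<^sub>c B) = dim_col A + dim_col B"
  by (simp_all add: append_cols_def)

lemma index_append_rows:
  assumes "dim_col A = dim_col B" "i < dim_row A + dim_row B" "j < dim_col A"
  shows "(A @\<^sub>r B) $$ (i, j) = (if i < dim_row A then A $$ (i, j) else B $$ (i - dim_row A, j))"
  using assms by (simp add: append_rows_def)

lemma dim_append_rows [simp]: "dim_row (A @\<^sub>r B) = dim_row A + dim_row B" "dim_col (A @\<^sub>r B) = dim_col A"
  by (simp_all add: append_rows_def)

text \<open>The bound keeps the bracketing in which the blocks of \<open>h_mat\<close> are appended,
  and each block is parametrized by an offset; every position of \<open>h_mat\<close> can then be
  evaluated by rewriting.\<close>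

lemma block_index_cases:
  assumes "i < 1 + (r1 + (s + (r2 + (t + 1))))"
  obtains "i = 0" | u where "i = Suc u" "u < r1" | u where "i = Suc (r1 + u)" "u < s"
    | u where "i = Suc (r1 + s + u)" "u < r2" | u where "i = Suc (r1 + s + r2 + u)" "u < t"
    | "i = Suc (r1 + s + r2 + t)"
proof -
  consider "i = 0" | "0 < i" "i \<le> r1" | "r1 < i" "i \<le> r1 + s" | "r1 + s < i" "i \<le> r1 + s + r2"
    | "r1 + s + r2 < i" "i \<le> r1 + s + r2 + t" | "i = Suc (r1 + s + r2 + t)"
    using assms by linarith
  then show ?thesis
  proof cases
    case 1 then show ?thesis by (rule that(1))
  next
    case 2 then show ?thesis by (intro that(2)[of "i - 1"]) auto
  next
    case 3 then show ?thesis by (intro that(3)[of "i - 1 - r1"]) auto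
  next
    case 4 then show ?thesis by (intro that(4)[of "i - 1 - r1 - s"]) auto
  next
    case 5 then show ?thesis by (intro that(5)[of "i - 1 - r1 - s - r2"]) auto
  next
    case 6 then show ?thesis by (rule that(6))
  qed
qed

lemma h_mat_eq_border_mat:
  assumes "r1 \<le> l" "l + r2 \<le> m"
    "a1 \<in> carrier_mat 1 r1" "a2 \<in> carrier_mat 1 (l - r1)" "\<alpha>1 \<in> carrier_mat 1 r1" "\<alpha>2 \<in> carrier_mat 1 r2"
  shows "h_mat m l r1 r2 a1 a2 \<alpha>1 \<alpha>2 \<phi> = border_mat m (row_entry l r1 a1 a2) (col_entry l r1 r2 \<alpha>1 \<alpha>2) \<phi>"
proof -
  obtain s where s: "l = r1 + s" using assms(1) le_Suc_ex by blast
  obtain t where t: "m = r1 + s + r2 + t" using assms(2) s le_Suc_ex by blast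
  have st: "l - r1 = s" "m - l - r2 = t" using s t by simp_all
  have d: "dim_row a1 = 1" "dim_col a1 = r1" "dim_row a2 = 1" "dim_col a2 = s"
    "dim_row \<alpha>1 = 1" "dim_col \<alpha>1 = r1" "dim_row \<alpha>2 = 1" "dim_col \<alpha>2 = r2"
    using assms(3-6) st by auto
  show ?thesis
  proof (rule eq_matI)
    fix i j
    assume "i < dim_row (border_mat m (row_entry l r1 a1 a2) (col_entry l r1 r2 \<alpha>1 \<alpha>2) \<phi>)"
      "j < dim_col (border_mat m (row_entry l r1 a1 a2) (col_entry l r1 r2 \<alpha>1 \<alpha>2) \<phi>)"
    then have i: "i < 1 + (r1 + (s + (r2 + (t + 1))))" and j: "j < 1 + (r1 + (s + (r2 + (t + 1))))"
      by (simp_all add: t)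
    show "h_mat m l r1 r2 a1 a2 \<alpha>1 \<alpha>2 \<phi> $$ (i, j) = border_mat m (row_entry l r1 a1 a2) (col_entry l r1 r2 \<alpha>1 \<alpha>2) \<phi> $$ (i, j)"
      unfolding h_mat_def Let_def st
      by (rule block_index_cases[OF i]; rule block_index_cases[OF j])
        (simp_all add: index_append_cols index_append_rows d border_mat_def row_entry_def col_entry_def s t)
  qed (simp_all add: h_mat_def Let_def st d, simp_all add: s t)
qed

lemma sum_row_entry:
  fixes a1 a2 :: "'a::comm_ring_1 mat"
  assumes "r1 \<le> l" "l \<le> m"
  shows "(\<Sum>k=1..m. row_entry l r1 a1 a2 k * G k)
    = (\<Sum>k<r1. a1 $$ (0, k) * G (Suc k)) + (\<Sum>k<l - r1. a2 $$ (0, k) * G (Suc (r1 + k)))"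
proof -
  have "(\<Sum>k=1..m. row_entry l r1 a1 a2 k * G k) = (\<Sum>k<m. row_entry l r1 a1 a2 (Suc k) * G (Suc k))"
    by (intro sum.reindex_bij_witness[of _ Suc "\<lambda>k. k - 1"]) auto
  also have "\<dots> = (\<Sum>k\<in>{..<r1} \<union> {r1..<l} \<union> {l..<m}. row_entry l r1 a1 a2 (Suc k) * G (Suc k))"
    using assms by (intro sum.cong) auto
  also have "\<dots> = (\<Sum>k<r1. row_entry l r1 a1 a2 (Suc k) * G (Suc k)) + (\<Sum>k=r1..<l. row_entry l r1 a1 a2 (Suc k) * G (Suc k))
      + (\<Sum>k=l..<m. row_entry l r1 a1 a2 (Suc k) * G (Suc k))"
    using assms by (subst sum.union_disjoint; (subst sum.union_disjoint)?; auto)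
  also have "(\<Sum>k=l..<m. row_entry l r1 a1 a2 (Suc k) * G (Suc k)) = 0"
    using assms by (intro sum.neutral) (auto simp: row_entry_def)
  also have "(\<Sum>k=r1..<l. row_entry l r1 a1 a2 (Suc k) * G (Suc k)) = (\<Sum>k<l - r1. a2 $$ (0, k) * G (Suc (r1 + k)))"
    using assms by (intro sum.reindex_bij_witness[of _ "\<lambda>k. r1 + k" "\<lambda>k. k - r1"]) (auto simp: row_entry_def)
  finally show ?thesis by (simp add: row_entry_def)
qed

lemma sum_col_entry:
  fixes \<alpha>1 \<alpha>2 :: "'a::comm_ring_1 mat"
  assumes "r1 \<le> l" "l + r2 \<le> m"
  shows "(\<Sum>k=1..m. G k * col_entry l r1 r2 \<alpha>1 \<alpha>2 k)
    = (\<Sum>k<r1. G (Suc k) * \<alpha>1 $$ (0, k)) + (\<Sum>k<r2. G (Suc (l + k)) * \<alpha>2 $$ (0, k))"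
proof -
  have "(\<Sum>k=1..m. G k * col_entry l r1 r2 \<alpha>1 \<alpha>2 k) = (\<Sum>k<m. G (Suc k) * col_entry l r1 r2 \<alpha>1 \<alpha>2 (Suc k))"
    by (intro sum.reindex_bij_witness[of _ Suc "\<lambda>k. k - 1"]) auto
  also have "\<dots> = (\<Sum>k\<in>{..<r1} \<union> {l..<l + r2}. G (Suc k) * col_entry l r1 r2 \<alpha>1 \<alpha>2 (Suc k))"
    using assms by (intro sum.mono_neutral_right) (auto simp: col_entry_def)
  also have "\<dots> = (\<Sum>k<r1. G (Suc k) * col_entry l r1 r2 \<alpha>1 \<alpha>2 (Suc k)) + (\<Sum>k=l..<l + r2. G (Suc k) * col_entry l r1 r2 \<alpha>1 \<alpha>2 (Suc k))"
    using assms by (subst sum.union_disjoint) auto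
  also have "(\<Sum>k=l..<l + r2. G (Suc k) * col_entry l r1 r2 \<alpha>1 \<alpha>2 (Suc k)) = (\<Sum>k<r2. G (Suc (l + k)) * \<alpha>2 $$ (0, k))"
    using assms by (intro sum.reindex_bij_witness[of _ "\<lambda>k. l + k" "\<lambda>k. k - l"]) (auto simp: col_entry_def)
  finally show ?thesis by (simp add: col_entry_def)
qed

subsection \<open>Invertible matrices and linear independence\<close>

lemma GL_iff_det: "A \<in> GL n \<longleftrightarrow> A \<in> carrier_mat n n \<and> det A \<noteq> (0::'k::field)"
  unfolding GL_def using unit_imp_det_non_zero[of A n "()"] det_non_zero_imp_unit[of A n "()"]
  by (auto simp: Units_def ring_mat_def)

lemma GL_carrier: "A \<in> GL n \<Longrightarrow> A \<in> carrier_mat n n"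
  by (simp add: GL_iff_det)

lemma
  fixes A :: "'k::field mat"
  assumes "A \<in> GL n"
  shows mat_inv_GL: "mat_inv n A \<in> GL n"
    and mat_inv_carrier: "mat_inv n A \<in> carrier_mat n n"
    and mat_inv_left: "mat_inv n A * A = 1\<^sub>m n"
    and mat_inv_right: "A * mat_inv n A = 1\<^sub>m n"
proof -
  interpret ring "ring_mat TYPE('k) n ()" by (rule ring_mat)
  show "mat_inv n A \<in> GL n" "mat_inv n A * A = 1\<^sub>m n" "A * mat_inv n A = 1\<^sub>m n"
    using assms Units_inv_Units[of A] Units_l_inv[of A] Units_r_inv[of A]
    unfolding GL_def mat_inv_def by (simp_all add: ring_mat_simps)
  then show "mat_inv n A \<in> carrier_mat n n" by (simp add: GL_carrier)
qed

lemma GL_transpose: "A \<in> GL n \<Longrightarrow> transpose_mat A \<in> GL n"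
  by (auto simp: GL_iff_det det_transpose)

lemma GL_mult: "A \<in> GL n \<Longrightarrow> B \<in> GL n \<Longrightarrow> A * B \<in> GL n"
  by (auto simp: GL_iff_det det_mult)

lemma GL_smult: "A \<in> GL n \<Longrightarrow> c \<noteq> 0 \<Longrightarrow> c \<cdot>\<^sub>m A \<in> GL n"
  by (auto simp: GL_iff_det det_smult)

lemma GL_one: "1\<^sub>m n \<in> GL n"
  by (simp add: GL_iff_det)

lemma GL_injective:
  fixes A :: "'k::field mat"
  assumes A: "A \<in> GL n" and C: "C \<in> carrier_mat n c" and 0: "A * C = 0\<^sub>m n c"
  shows "C = 0\<^sub>m n c"
proof -
  have "C = (mat_inv n A * A) * C" using C by (simp add: mat_inv_left[OF A])
  also have "\<dots> = mat_inv n A * (A * C)" using A C by (intro assoc_mult_mat[OF mat_inv_carrier GL_carrier]) auto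
  finally show ?thesis using mat_inv_carrier[OF A] by (simp add: 0)
qed

lemma cmat_carrier [simp]: "cmat A \<in> carrier_mat nr nc \<longleftrightarrow> A \<in> carrier_mat nr nc"
  by auto

lemma cmat_mult:
  "A \<in> carrier_mat nr n \<Longrightarrow> B \<in> carrier_mat n nc \<Longrightarrow> cmat (A * B) = cmat A * cmat (B :: 'k::field mat)"
  by (rule C_hom.mat_hom_mult)

lemma cmat_add:
  "A \<in> carrier_mat nr nc \<Longrightarrow> B \<in> carrier_mat nr nc \<Longrightarrow> cmat (A + B) = cmat A + cmat (B :: 'k::field mat)"
  by (rule eq_matI) auto

lemma cmat_zero: "cmat (0\<^sub>m nr nc) = 0\<^sub>m nr nc"
  by (rule eq_matI) auto

lemma cmat_one: "cmat (1\<^sub>m n :: 'k::field mat) = 1\<^sub>m n"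
  by (rule C_hom.mat_hom_one)

lemma cmat_smult: "cmat (c \<cdot>\<^sub>m A) = [:c:] \<cdot>\<^sub>m cmat (A :: 'k::field mat)"
  by (rule eq_matI) auto

lemma mult_mat_index:
  fixes A B :: "'a::comm_semiring_0 mat"
  assumes "A \<in> carrier_mat nr n" "B \<in> carrier_mat n nc" "i < nr" "j < nc"
  shows "(A * B) $$ (i, j) = (\<Sum>k<n. A $$ (i, k) * B $$ (k, j))"
  using assms by (auto simp: scalar_prod_def lessThan_atLeast0 intro!: sum.cong)

lemma row_mult_index:
  fixes v :: "'a::comm_semiring_0 mat"
  assumes "v \<in> carrier_mat 1 n" "C \<in> carrier_mat n c" "j < c"
  shows "(v * C) $$ (0, j) = (\<Sum>k<n. v $$ (0, k) * C $$ (k, j))"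
  by (rule mult_mat_index[OF assms(1,2) _ assms(3)]) simp

section \<open>Linear independence of row entries over k\<close>

lemma row_lin_indep_iff:
  assumes v: "v \<in> carrier_mat 1 n"
  shows "row_lin_indep v \<longleftrightarrow> (\<forall>c. (\<Sum>i<n. [:c i:] * v $$ (0, i)) = 0 \<longrightarrow> (\<forall>i<n. c i = (0::'k::field)))"
  using v by (simp add: row_lin_indep_def)

text \<open>Each column of C - D is a linear relation between the entries of v. This turns
  identities between polynomial rows into identities between constant matrices.\<close>

lemma row_lin_indep_cancel:
  fixes v :: "'k::field poly mat"
  assumes v: "v \<in> carrier_mat 1 n" and i: "row_lin_indep v"
    and CD: "C \<in> carrier_mat n c" "D \<in> carrier_mat n c" and e: "v * cmat C = v * cmat D"
  shows "C = D"
proof (rule eq_matI)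
  fix k j assume "k < dim_row D" "j < dim_col D"
  then have k: "k < n" and j: "j < c" using CD by auto
  have "(\<Sum>k<n. [:C $$ (k, j) - D $$ (k, j):] * v $$ (0, k)) = (v * cmat C) $$ (0, j) - (v * cmat D) $$ (0, j)"
    using CD j by (simp add: row_mult_index[OF v] sum_subtractf[symmetric] left_diff_distrib smult_diff_left)
  then have "(\<Sum>k<n. [:C $$ (k, j) - D $$ (k, j):] * v $$ (0, k)) = 0" using e by simp
  then have "C $$ (k, j) - D $$ (k, j) = 0"
    using i[unfolded row_lin_indep_iff[OF v], rule_format, of "\<lambda>k. C $$ (k, j) - D $$ (k, j)"] k by blast
  then show "C $$ (k, j) = D $$ (k, j)" by simp
qed (use CD in auto)

text \<open>A relation with coefficient vector c between the entries of v W is a relation with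
  coefficient vector W c between those of v, and W is injective.\<close>

lemma row_lin_indep_mult_GL:
  fixes v :: "'k::field poly mat"
  assumes v: "v \<in> carrier_mat 1 n" "row_lin_indep v" and W: "W \<in> GL n"
  shows "row_lin_indep (v * cmat W)"
proof -
  have W': "W \<in> carrier_mat n n" using W by (rule GL_carrier)
  have vW: "v * cmat W \<in> carrier_mat 1 n" using v W' by simp
  show ?thesis unfolding row_lin_indep_iff[OF vW]
  proof (intro allI impI)
    fix c i assume z: "(\<Sum>i<n. [:c i:] * (v * cmat W) $$ (0, i)) = 0" and i: "i < n"
    let ?C = "mat n 1 (\<lambda>(i, _). c i)"
    have C: "?C \<in> carrier_mat n 1" by simp
    have "v * cmat (W * ?C) = (v * cmat W) * cmat ?C"
      unfolding cmat_mult[OF W' C] by (rule assoc_mult_mat[symmetric]) (use v W' in auto)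
    also have "\<dots> = 0\<^sub>m 1 1"
    proof (rule eq_matI)
      fix i j assume "i < dim_row (0\<^sub>m 1 1 :: 'k poly mat)" "j < dim_col (0\<^sub>m 1 1 :: 'k poly mat)"
      then have ij: "i = 0" "j = 0" by simp_all
      have "((v * cmat W) * cmat ?C) $$ (0, 0) = (\<Sum>k<n. (v * cmat W) $$ (0, k) * cmat ?C $$ (k, 0))"
        by (rule row_mult_index[OF vW, of _ 1]) simp_all
      also have "\<dots> = (\<Sum>k<n. [:c k:] * (v * cmat W) $$ (0, k))"
        by (intro sum.cong) (simp_all add: mult.commute del: index_mult_mat)
      finally show "((v * cmat W) * cmat ?C) $$ (i, j) = 0\<^sub>m 1 1 $$ (i, j)" using z ij by simp
    qed (use v in simp_all)
    also have "\<dots> = v * cmat (0\<^sub>m n 1)" using v by (simp add: cmat_zero)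
    finally have "W * ?C = 0\<^sub>m n 1"
      by (intro row_lin_indep_cancel[OF v]) (use W' in auto)
    then have "?C = 0\<^sub>m n 1" by (rule GL_injective[OF W C])
    from arg_cong[OF this, of "\<lambda>M. M $$ (i, 0)"] show "c i = 0" using i by simp
  qed
qed

lemma append_cols_carrier [simp]:
  "A \<in> carrier_mat nr n1 \<Longrightarrow> B \<in> carrier_mat nr n2 \<Longrightarrow> A @\<^sub>c B \<in> carrier_mat nr (n1 + n2)"
  by (intro carrier_matI) simp_all

text \<open>The new row is (a, b) times the block triangular matrix with block rows (Q, L) and (0,
  M), which is invertible. This serves both the group action and the exchange of a1 with a1
  S.\<close>

lemma row_lin_indep_transform:
  fixes a b :: "'k::field poly mat"
  assumes a: "a \<in> carrier_mat 1 r" and b: "b \<in> carrier_mat 1 s" and i: "row_lin_indep (a @\<^sub>c b)"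
    and Q: "Q \<in> GL r" and M: "M \<in> GL s" and L: "L \<in> carrier_mat r s"
  shows "row_lin_indep (a * cmat Q @\<^sub>c (a * cmat L + b * cmat M))"
proof -
  let ?W = "four_block_mat Q L (0\<^sub>m s r) M"
  have c: "Q \<in> carrier_mat r r" "M \<in> carrier_mat s s" using Q M by (simp_all add: GL_carrier)
  have W: "?W \<in> GL (r + s)"
    using Q M L by (auto simp: GL_iff_det det_four_block_mat_lower_left_zero)
  have cW: "cmat ?W = four_block_mat (cmat Q) (cmat L) (0\<^sub>m s r) (cmat M)"
    by (rule eq_matI) (use c L in auto)
  have "(a @\<^sub>c b) * cmat ?W = a * cmat Q @\<^sub>c (a * cmat L + b * cmat M)"
    unfolding append_cols_def cW using a b c L
    by (subst mult_four_block_mat[of _ 1 r _ s _ 0 _ _ r _ s]) auto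
  then show ?thesis
    using row_lin_indep_mult_GL[OF append_cols_carrier[OF a b] i W] by simp
qed

lemma row_lin_indep_append_left:
  fixes a b :: "'k::field poly mat"
  assumes a: "a \<in> carrier_mat 1 r" and b: "b \<in> carrier_mat 1 s" and i: "row_lin_indep (a @\<^sub>c b)"
  shows "row_lin_indep a"
  unfolding row_lin_indep_iff[OF a]
proof (intro allI impI)
  fix c i assume z: "(\<Sum>i<r. [:c i:] * a $$ (0, i)) = 0" and k: "i < r"
  have "(\<Sum>i<r + s. [:if i < r then c i else 0:] * (a @\<^sub>c b) $$ (0, i)) = (\<Sum>i<r. [:if i < r then c i else 0:] * (a @\<^sub>c b) $$ (0, i))"
    by (rule sum.mono_neutral_right) auto
  also have "\<dots> = (\<Sum>i<r. [:c i:] * a $$ (0, i))"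
    using a b by (intro sum.cong refl) (auto simp: index_append_cols)
  finally have "(\<Sum>i<r + s. [:if i < r then c i else 0:] * (a @\<^sub>c b) $$ (0, i)) = 0" using z by simp
  with assms(3)[unfolded row_lin_indep_iff[OF append_cols_carrier[OF a b]], rule_format, of "\<lambda>i. if i < r then c i else 0" i] k
  show "c i = 0" by simp
qed

text \<open>A functional on k[T] dual to the a i exists because an independent set extends to a
  basis; \<open>d i u\<close> is the value of the i-th functional at T^u. Recording these values
  lets a functional act on one variable of a polynomial in T and T' through its coefficients. The
  bound N is free, so that one range of summation can serve several polynomials.\<close>

lemma dual_functionals:
  fixes a :: "nat \<Rightarrow> 'k::field poly"
  assumes ind: "\<And>c i. (\<Sum>i<r. [:c i:] * a i) = 0 \<Longrightarrow> i < r \<Longrightarrow> c i = 0"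
  obtains d :: "nat \<Rightarrow> nat \<Rightarrow> 'k" where
    "\<And>i k N. i < r \<Longrightarrow> k < r \<Longrightarrow> degree (a k) \<le> N \<Longrightarrow> (\<Sum>u\<le>N. d i u * coeff (a k) u) = (if i = k then 1 else 0)"
proof -
  interpret vp: vector_space_pair "smult :: 'k \<Rightarrow> 'k poly \<Rightarrow> 'k poly" "(*) :: 'k \<Rightarrow> 'k \<Rightarrow> 'k"
    by unfold_locales (simp_all add: smult_add_right smult_add_left algebra_simps)
  \<comment> \<open>The notion of independence used below concerns the set of the a i, so repeated
    entries are excluded first: they would give the relation with coefficients 1 and -1.\<close>
  have inj: "inj_on a {..<r}"
  proof (rule inj_onI, rule ccontr)
    fix i j assume ij: "i \<in> {..<r}" "j \<in> {..<r}" "a i = a j" "i \<noteq> j"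
    let ?c = "\<lambda>k. if k = i then 1 else if k = j then -1 else (0::'k)"
    have "(\<Sum>k<r. [:?c k:] * a k) = (\<Sum>k\<in>{i, j}. [:?c k:] * a k)"
      using ij by (intro sum.mono_neutral_right) auto
    also have "\<dots> = 0" using ij by simp
    finally show False using ind[of ?c i] ij by simp
  qed
  have B: "vp.vs1.independent (a ` {..<r})"
    unfolding vp.vs1.dependent_finite[OF finite_imageI[OF finite_lessThan]]
    using ind by (force simp: sum.reindex[OF inj])
  have "\<exists>g. Vector_Spaces.linear smult (*) g \<and> (\<forall>x\<in>a ` {..<r}. g x = (if x = a i then 1 else 0))" for i
    by (rule vp.linear_independent_extend[OF B])
  then obtain g where g: "\<And>i. Vector_Spaces.linear smult (*) (g i)"
    "\<And>i k. k < r \<Longrightarrow> g i (a k) = (if a k = a i then 1 else 0)"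
    by (metis (no_types, lifting) imageI lessThan_iff)
  show ?thesis
  proof (rule that[of "\<lambda>i u. g i (monom 1 u)"])
    fix i k N assume *: "i < r" "k < r" "degree (a k) \<le> N"
    interpret l: Vector_Spaces.linear smult "(*)" "g i" by (rule g)
    have "a k = (\<Sum>u\<le>N. smult (coeff (a k) u) (monom 1 u))"
      using poly_as_sum_of_monoms'[OF *(3)] by (simp add: smult_monom)
    then have "g i (a k) = (\<Sum>u\<le>N. coeff (a k) u * g i (monom 1 u))"
      by (metis (no_types, lifting) l.scale l.sum sum.cong)
    then show "(\<Sum>u\<le>N. g i (monom 1 u) * coeff (a k) u) = (if i = k then 1 else 0)"
      using g(2)[OF *(2), of i] inj_on_eq_iff[OF inj, of k i] * by (auto simp: mult.commute)
  qed
qed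

subsection \<open>Exponential matrices\<close>

lemma in_T_smult: "in_T (smult c f) = in_T [:c:] * in_T f"
  "in_T' (smult c f) = in_T [:c:] * in_T' f" "in_T_plus_T' (smult c f) = in_T [:c:] * in_T_plus_T' f"
proof -
  have "in_T' [:c:] = in_T [:c:]" "in_T_plus_T' [:c:] = in_T [:c:]"
    by (simp_all add: in_T_def in_T'_def in_T_plus_T'_def map_poly_pCons pcompose_pCons)
  moreover have "smult c f = [:c:] * f" by simp
  ultimately show "in_T (smult c f) = in_T [:c:] * in_T f"
    "in_T' (smult c f) = in_T [:c:] * in_T' f" "in_T_plus_T' (smult c f) = in_T [:c:] * in_T_plus_T' f"
    by (metis in_T_hom.hom_mult, metis in_T'_hom.hom_mult, metis in_T_plus_T'_hom.hom_mult)
qed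

lemma p_polys_iff_additive:
  assumes "CHAR('k::field) > 0"
  shows "(f :: 'k poly) \<in> p_polys \<longleftrightarrow> poly f 0 = 0 \<and> additive_poly f"
  using additive_imp_p_polys p_polys_imp_additive p_polys_poly_0 assms by blast

text \<open>The supports of the first row and of the last column meet only in {1..r1}, so of the
  cocycle only the pairing of a1 with \<alpha>1 is left.\<close>

lemma exponential_h_mat_iff:
  fixes a1 a2 \<alpha>1 \<alpha>2 :: "'k::field poly mat"
  assumes dim: "r1 \<le> l" "l + r2 \<le> m"
    "a1 \<in> carrier_mat 1 r1" "a2 \<in> carrier_mat 1 (l - r1)" "\<alpha>1 \<in> carrier_mat 1 r1" "\<alpha>2 \<in> carrier_mat 1 r2"
    and char: "CHAR('k) > 0"
  shows "exponential (m + 2) (h_mat m l r1 r2 a1 a2 \<alpha>1 \<alpha>2 \<phi>) \<longleftrightarrow>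
    a1 \<in> p_poly_rows r1 \<and> a2 \<in> p_poly_rows (l - r1) \<and> \<alpha>1 \<in> p_poly_rows r1 \<and> \<alpha>2 \<in> p_poly_rows r2 \<and>
    poly \<phi> 0 = 0 \<and>
    in_T \<phi> + in_T' \<phi> + (\<Sum>k<r1. in_T (a1 $$ (0, k)) * in_T' (\<alpha>1 $$ (0, k))) = in_T_plus_T' \<phi>"
proof -
  have 1: "(\<forall>k\<in>{1..m}. row_entry l r1 a1 a2 k \<in> p_polys) \<longleftrightarrow> a1 \<in> p_poly_rows r1 \<and> a2 \<in> p_poly_rows (l - r1)" (is "?L \<longleftrightarrow> ?R")
  proof (intro iffI conjI)
    assume L: ?L
    show "a1 \<in> p_poly_rows r1"
    proof -
      have "a1 $$ (0, k) \<in> p_polys" if "k < r1" for k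
        using dim L[rule_format, of "Suc k"] that by (simp add: row_entry_def)
      then show ?thesis using dim by (simp add: p_poly_rows_def)
    qed
    show "a2 \<in> p_poly_rows (l - r1)"
    proof -
      have "a2 $$ (0, k) \<in> p_polys" if "k < l - r1" for k
      proof -
        have "Suc (r1 + k) \<le> l" using that by linarith
        then show ?thesis using dim L[rule_format, of "Suc (r1 + k)"] by (simp add: row_entry_def)
      qed
      then show ?thesis using dim by (simp add: p_poly_rows_def)
    qed
  next
    assume ?R then show ?L using dim unfolding p_poly_rows_def row_entry_def by auto
  qed
  have 2: "(\<forall>k\<in>{1..m}. col_entry l r1 r2 \<alpha>1 \<alpha>2 k \<in> p_polys) \<longleftrightarrow> \<alpha>1 \<in> p_poly_rows r1 \<and> \<alpha>2 \<in> p_poly_rows r2" (is "?L \<longleftrightarrow> ?R")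
  proof (intro iffI conjI)
    assume L: ?L
    show "\<alpha>1 \<in> p_poly_rows r1"
    proof -
      have "\<alpha>1 $$ (0, k) \<in> p_polys" if "k < r1" for k
        using dim L[rule_format, of "Suc k"] that by (simp add: col_entry_def)
      then show ?thesis using dim by (simp add: p_poly_rows_def)
    qed
    show "\<alpha>2 \<in> p_poly_rows r2"
    proof -
      have "\<alpha>2 $$ (0, k) \<in> p_polys" if "k < r2" for k
        using dim L[rule_format, of "Suc (l + k)"] that by (simp add: col_entry_def)
      then show ?thesis using dim by (simp add: p_poly_rows_def)
    qed
  next
    assume ?R then show ?L using dim unfolding p_poly_rows_def col_entry_def by auto
  qed
  have "(\<Sum>k=1..m. in_T (row_entry l r1 a1 a2 k) * in_T' (col_entry l r1 r2 \<alpha>1 \<alpha>2 k))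
      = (\<Sum>k\<in>{1..r1}. in_T (row_entry l r1 a1 a2 k) * in_T' (col_entry l r1 r2 \<alpha>1 \<alpha>2 k))"
    using dim by (intro sum.mono_neutral_right) (auto simp: row_entry_def col_entry_def)
  also have "\<dots> = (\<Sum>k<r1. in_T (a1 $$ (0, k)) * in_T' (\<alpha>1 $$ (0, k)))"
    by (intro sum.reindex_bij_witness[of _ Suc "\<lambda>k. k - 1"]) (auto simp: row_entry_def col_entry_def)
  finally have 3: "(\<Sum>k=1..m. in_T (row_entry l r1 a1 a2 k) * in_T' (col_entry l r1 r2 \<alpha>1 \<alpha>2 k))
      = (\<Sum>k<r1. in_T (a1 $$ (0, k)) * in_T' (\<alpha>1 $$ (0, k)))" .
  have "(\<forall>k\<in>{1..m}. poly (row_entry l r1 a1 a2 k) 0 = 0 \<and> poly (col_entry l r1 r2 \<alpha>1 \<alpha>2 k) 0 = 0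
        \<and> additive_poly (row_entry l r1 a1 a2 k) \<and> additive_poly (col_entry l r1 r2 \<alpha>1 \<alpha>2 k))
      \<longleftrightarrow> (\<forall>k\<in>{1..m}. row_entry l r1 a1 a2 k \<in> p_polys) \<and> (\<forall>k\<in>{1..m}. col_entry l r1 r2 \<alpha>1 \<alpha>2 k \<in> p_polys)"
    unfolding p_polys_iff_additive[OF char] by blast
  then show ?thesis
    unfolding h_mat_eq_border_mat[OF dim] exponential_border_mat_iff 1 2 3 by simp
qed

section \<open>The quadratic form attached to S\<close>

definition quad :: "nat \<Rightarrow> 'k::field mat \<Rightarrow> 'k poly mat \<Rightarrow> 'k poly" where
  "quad r S a = (if CHAR('k) = 2
     then \<Sum>(i,j) \<in> {(i,j). i < j \<and> j < r}. smult (S $$ (i,j)) (a $$ (0,i) * a $$ (0,j))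
     else smult (1 / 2) ((a * cmat S * transpose_mat a) $$ (0,0)))"

lemma hbar_eq: "hbar m l r1 r2 (S, a1, a2, \<alpha>2, \<alpha>) = h_mat m l r1 r2 a1 a2 (a1 * cmat S) \<alpha>2 (\<alpha> + quad r1 S a1)"
  by (simp add: hbar_def quad_def)

text \<open>In characteristic 2 and for symmetric F, the off-diagonal terms cancel in pairs and the
  diagonal sum remains; this is how alternating forms are handled below.\<close>

lemma sum_offdiag:
  fixes F :: "nat \<Rightarrow> nat \<Rightarrow> 'a::comm_monoid_add"
  shows "(\<Sum>i<r. \<Sum>j<r. F i j) = (\<Sum>(i,j)\<in>{(i,j). i < j \<and> j < r}. F i j + F j i) + (\<Sum>i<r. F i i)"
proof -
  let ?U = "{(i,j). i < j \<and> j < r}" and ?L = "{(i,j). j < i \<and> i < r}" and ?D = "{(i,j). i = j \<and> i < r}"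
  have fin: "finite ?U" "finite ?L" "finite ?D"
    by (rule finite_subset[of _ "{..<r} \<times> {..<r}"]; auto)+
  have "(\<Sum>i<r. \<Sum>j<r. F i j) = (\<Sum>(i,j)\<in>{..<r} \<times> {..<r}. F i j)" by (rule sum.cartesian_product)
  also have "{..<r} \<times> {..<r} = ?U \<union> ?L \<union> ?D" by auto
  also have "(\<Sum>(i,j)\<in>?U \<union> ?L \<union> ?D. F i j) = (\<Sum>(i,j)\<in>?U. F i j) + (\<Sum>(i,j)\<in>?L. F i j) + (\<Sum>(i,j)\<in>?D. F i j)"
    using fin by (subst sum.union_disjoint; (subst sum.union_disjoint)?; auto)
  also have "(\<Sum>(i,j)\<in>?L. F i j) = (\<Sum>(i,j)\<in>?U. F j i)"
    by (rule sum.reindex_bij_witness[of _ "\<lambda>(i,j). (j,i)" "\<lambda>(i,j). (j,i)"]) auto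
  also have "(\<Sum>(i,j)\<in>?D. F i j) = (\<Sum>i<r. F i i)"
    by (rule sum.reindex_bij_witness[of _ "\<lambda>i. (i,i)" fst]) auto
  finally show ?thesis by (simp add: sum.distrib split_def)
qed

lemma row_form_index:
  fixes a b :: "'a::comm_ring_1 mat"
  assumes "a \<in> carrier_mat 1 r" "b \<in> carrier_mat 1 r" "Z \<in> carrier_mat r r"
  shows "(a * Z * transpose_mat b) $$ (0, 0) = (\<Sum>i<r. \<Sum>j<r. Z $$ (i, j) * (a $$ (0, i) * b $$ (0, j)))"
proof -
  have "(a * Z * transpose_mat b) $$ (0, 0) = (\<Sum>j<r. (\<Sum>i<r. a $$ (0, i) * Z $$ (i, j)) * b $$ (0, j))"
    using assms by (subst row_mult_index[of _ r _ 1]) (auto simp: row_mult_index[OF assms(1,3)] simp del: index_mult_mat(1))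
  also have "\<dots> = (\<Sum>j<r. \<Sum>i<r. Z $$ (i, j) * (a $$ (0, i) * b $$ (0, j)))"
    by (simp add: sum_distrib_right sum_distrib_left ac_simps)
  finally show ?thesis by (subst sum.swap)
qed

lemma CHAR_2_add_self: "CHAR('a::comm_ring_1) = 2 \<Longrightarrow> x + x = (0::'a)"
  using of_nat_CHAR[where ?'a = 'a] by (simp add: mult_2[symmetric])

lemma two_neq_0: "CHAR('k::field) > 0 \<Longrightarrow> CHAR('k) \<noteq> 2 \<Longrightarrow> (2::'k) \<noteq> 0"
proof
  assume *: "CHAR('k) > 0" "CHAR('k) \<noteq> 2" "(2::'k) = 0"
  then have "of_nat 2 = (0::'k)" by simp
  then have "CHAR('k) dvd 2" by (simp only: of_nat_eq_0_iff_char_dvd)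
  then show False using *(2) two_is_prime_nat prime_CHAR[OF *(1)] primes_dvd_imp_eq by blast
qed

lemma GLss_symmetric:
  assumes "S \<in> GLss r" "i < r" "j < r" shows "S $$ (i, j) = S $$ (j, i)"
proof -
  have "transpose_mat S = S" "S \<in> carrier_mat r r" using assms(1) by (simp_all add: GLss_def GL_carrier)
  then show ?thesis using assms(2,3) by (metis carrier_matD index_transpose_mat(1))
qed

text \<open>With x = a(T) and y = a(T'), additivity gives a(T + T') = x + y, and the claim is that
  the polar form of \<open>quad\<close> is the bilinear form of S at (x, y). For odd p the factor
  1/2 absorbs the two equal mixed terms. For p = 2 the sum over i < j yields each off-diagonal mixed
  term once, and the diagonal ones are absent because S has zero diagonal.\<close>

lemma quad_polar:
  fixes a :: "'k::field poly mat"
  assumes char: "CHAR('k) > 0" and S: "S \<in> GLss r" and a: "a \<in> p_poly_rows r"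
  shows "in_T (quad r S a) + in_T' (quad r S a) + (\<Sum>k<r. in_T (a $$ (0, k)) * in_T' ((a * cmat S) $$ (0, k)))
    = in_T_plus_T' (quad r S a)"
proof -
  let ?x = "\<lambda>k. in_T (a $$ (0, k))" and ?y = "\<lambda>k. in_T' (a $$ (0, k))" and ?s = "\<lambda>i j. in_T [:S $$ (i, j):]"
  have ac: "a \<in> carrier_mat 1 r" using a by (simp add: p_poly_rows_def)
  have Sc: "S \<in> carrier_mat r r" using S by (simp add: GLss_def GL_carrier)
  note St = GLss_symmetric[OF S]
  have z: "in_T_plus_T' (a $$ (0, k)) = ?x k + ?y k" if "k < r" for k
    using p_polys_imp_additive[OF char, of "a $$ (0, k)"] a that by (simp add: p_poly_rows_def additive_poly_def)
  have B: "(\<Sum>k<r. in_T (a $$ (0, k)) * in_T' ((a * cmat S) $$ (0, k))) = (\<Sum>i<r. \<Sum>j<r. ?s i j * (?x j * ?y i))"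
  proof -
    have "in_T' ((a * cmat S) $$ (0, k)) = (\<Sum>i<r. ?s i k * ?y i)" if "k < r" for k
      using row_mult_index[OF ac, of "cmat S" r k] that Sc
      by (simp add: in_T'_hom.hom_sum in_T_smult mult.commute)
    then show ?thesis by (subst sum.swap) (simp add: sum_distrib_left ac_simps)
  qed
  show ?thesis
  proof (cases "CHAR('k) = 2")
    case True
    have diag: "S $$ (i, i) = 0" if "i < r" for i using S True that by (simp add: GLss_def)
    have "in_T_plus_T' (quad r S a) = (\<Sum>(i,j)\<in>{(i,j). i < j \<and> j < r}. ?s i j * ((?x i + ?y i) * (?x j + ?y j)))"
      using True z by (auto simp: quad_def in_T_plus_T'_hom.hom_sum in_T_smult in_T_plus_T'_hom.hom_mult intro!: sum.cong)
    moreover have "in_T (quad r S a) = (\<Sum>(i,j)\<in>{(i,j). i < j \<and> j < r}. ?s i j * (?x i * ?x j))"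
      using True by (auto simp: quad_def in_T_hom.hom_sum in_T_smult in_T_hom.hom_mult intro!: sum.cong)
    moreover have "in_T' (quad r S a) = (\<Sum>(i,j)\<in>{(i,j). i < j \<and> j < r}. ?s i j * (?y i * ?y j))"
      using True by (auto simp: quad_def in_T'_hom.hom_sum in_T_smult in_T'_hom.hom_mult intro!: sum.cong)
    moreover have "(\<Sum>i<r. \<Sum>j<r. ?s i j * (?x j * ?y i)) = (\<Sum>(i,j)\<in>{(i,j). i < j \<and> j < r}. ?s i j * (?x j * ?y i) + ?s i j * (?x i * ?y j))"
      unfolding sum_offdiag using diag St by (auto intro!: sum.cong)
    ultimately show ?thesis
      unfolding B by (simp add: sum.distrib[symmetric] split_def algebra_simps)
  next
    case False
    let ?h = "in_T [:1 / 2 :: 'k:]"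
    have q: "quad r S a = smult (1 / 2) (\<Sum>i<r. \<Sum>j<r. smult (S $$ (i, j)) (a $$ (0, i) * a $$ (0, j)))"
      using False row_form_index[OF ac ac, of "cmat S"] Sc by (simp add: quad_def)
    have p: "in_T_plus_T' (quad r S a) = ?h * (\<Sum>i<r. \<Sum>j<r. ?s i j * ((?x i + ?y i) * (?x j + ?y j)))"
      using z by (simp add: q in_T_plus_T'_hom.hom_sum in_T_smult in_T_plus_T'_hom.hom_mult)
    have x: "in_T (quad r S a) = ?h * (\<Sum>i<r. \<Sum>j<r. ?s i j * (?x i * ?x j))"
      by (simp add: q in_T_hom.hom_sum in_T_smult in_T_hom.hom_mult)
    have y: "in_T' (quad r S a) = ?h * (\<Sum>i<r. \<Sum>j<r. ?s i j * (?y i * ?y j))"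
      by (simp add: q in_T'_hom.hom_sum in_T_smult in_T'_hom.hom_mult)
    let ?b = "\<Sum>i<r. \<Sum>j<r. ?s i j * (?x j * ?y i)"
    have b: "(\<Sum>i<r. \<Sum>j<r. ?s i j * (?x i * ?y j)) = ?b"
      using St by (subst sum.swap) (auto intro!: sum.cong)
    have "?h * (?b + ?b) = ?b"
    proof -
      have "?h * (?b + ?b) = in_T ([:1 / 2:] * 2) * ?b" 
        by (simp only: in_T_hom.hom_mult in_T_hom.hom_numeral mult_2[symmetric] mult.assoc)
      also have "[:1 / 2 :: 'k:] * 2 = 1"
        using two_neq_0[OF char False] by (simp add: numeral_poly)
      finally show ?thesis by simp
    qed
    moreover have "in_T_plus_T' (quad r S a) = in_T (quad r S a) + in_T' (quad r S a) + ?h * (?b + ?b)"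
    proof -
      have "(\<Sum>i<r. \<Sum>j<r. ?s i j * ((?x i + ?y i) * (?x j + ?y j)))
          = (\<Sum>i<r. \<Sum>j<r. ?s i j * (?x i * ?x j) + ?s i j * (?y i * ?y j) + ?s i j * (?x i * ?y j) + ?s i j * (?x j * ?y i))"
        by (intro sum.cong refl) (simp add: algebra_simps)
      also have "\<dots> = (\<Sum>i<r. \<Sum>j<r. ?s i j * (?x i * ?x j)) + (\<Sum>i<r. \<Sum>j<r. ?s i j * (?y i * ?y j)) + ?b + ?b"
        by (simp only: sum.distrib b)
      finally show ?thesis unfolding p x y by (simp only: distrib_left add.assoc)
    qed
    ultimately show ?thesis unfolding B by simp
  qed
qed

lemma quad_poly_0:
  fixes a :: "'k::field poly mat"
  assumes char: "CHAR('k) > 0" and S: "S \<in> carrier_mat r r" and a: "a \<in> p_poly_rows r"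
  shows "poly (quad r S a) 0 = 0"
proof -
  have z: "poly (a $$ (0, k)) 0 = 0" if "k < r" for k
    using a p_polys_poly_0[OF char] that by (auto simp: p_poly_rows_def)
  have ac: "a \<in> carrier_mat 1 r" using a by (simp add: p_poly_rows_def)
  show ?thesis
    using S z unfolding quad_def row_form_index[OF ac ac, of "cmat S", simplified, OF S]
    by (auto simp: poly_sum intro!: sum.neutral)
qed

lemma p_poly_rows_mult:
  assumes char: "CHAR('k::field) > 0" and a: "(a :: 'k poly mat) \<in> p_poly_rows r" and C: "C \<in> carrier_mat r c"
  shows "a * cmat C \<in> p_poly_rows c"
proof -
  have ac: "a \<in> carrier_mat 1 r" using a by (simp add: p_poly_rows_def)
  have "(a * cmat C) $$ (0, j) \<in> p_polys" if "j < c" for j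
    using that a C row_mult_index[OF ac, of "cmat C" c j]
    by (auto simp: p_poly_rows_def intro!: p_polys_sum[OF char] p_polys_smult[OF char])
  then show ?thesis using ac C by (simp add: p_poly_rows_def)
qed

text \<open>The coefficients \<open>M u v\<close> of \<open>a(T) \<cdot> \<alpha>(T')\<close> are binomial multiples of coefficients of \<open>\<phi>\<close>, hence symmetric in
  \<open>u, v\<close>, and \<open>M u u = 0\<close> if \<open>p = 2\<close> because the central binomial coefficients are even. Functionals dual
  to \<open>a\<close> transport this to the coordinates \<open>s\<close> of \<open>\<alpha>\<close>; no root extraction in \<open>k\<close> is needed, so \<open>k\<close>
  may be imperfect.\<close>

lemma symmetric_factor:
  fixes a \<alpha> :: "'k::field poly mat"
  assumes char: "CHAR('k) > 0"
    and a: "a \<in> carrier_mat 1 r" "row_lin_indep a" and \<alpha>: "\<alpha> \<in> carrier_mat 1 r" "row_lin_indep \<alpha>"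
    and \<phi>0: "poly \<phi> 0 = 0"
    and \<phi>: "in_T \<phi> + in_T' \<phi> + (\<Sum>k<r. in_T (a $$ (0, k)) * in_T' (\<alpha> $$ (0, k))) = in_T_plus_T' \<phi>"
  obtains S where "S \<in> GLss r" "\<alpha> = a * cmat S"
proof -
  define M where "M u v = (\<Sum>k<r. coeff (a $$ (0, k)) u * coeff (\<alpha> $$ (0, k)) v)" for u v
  have M: "M u v = of_nat (u + v choose u) * coeff \<phi> (u + v)
      - (if v = 0 then coeff \<phi> u else 0) - (if u = 0 then coeff \<phi> v else 0)" for u v
    using arg_cong[OF \<phi>, of "\<lambda>F. coeff (coeff F v) u"]
    by (simp add: M_def coeff_in_T coeff_in_T' coeff_in_T_plus_T' coeff_in_T_mult_in_T' coeff_sum algebra_simps)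
  have Msym: "M u v = M v u" for u v
    unfolding M using binomial_symmetric[of u "u + v"] by (auto simp: add.commute)
  have Mdiag: "M u u = 0" if "CHAR('k) = 2" for u
  proof (cases "u = 0")
    case True
    then show ?thesis using \<phi>0 by (simp add: M poly_0_coeff_0)
  next
    case False
    then have "u + u = Suc (2 * u - 1)" "u = Suc (u - 1)" by simp_all
    then have "(u + u choose u) = (2 * u - 1 choose (u - 1)) + (2 * u - 1 choose u)"
      by (metis binomial_Suc_Suc)
    also have "(2 * u - 1 choose u) = (2 * u - 1 choose (u - 1))"
      using binomial_symmetric[of u "2 * u - 1"] False by (simp add: mult_2)
    finally have "CHAR('k) dvd (u + u choose u)" using that by simp
    then have "of_nat (u + u choose u) = (0::'k)" by (simp only: of_nat_eq_0_iff_char_dvd)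
    then show ?thesis using False by (simp add: M)
  qed
  obtain d where d: "\<And>i k N. i < r \<Longrightarrow> k < r \<Longrightarrow> degree (a $$ (0, k)) \<le> N
      \<Longrightarrow> (\<Sum>u\<le>N. d i u * coeff (a $$ (0, k)) u) = (if i = k then 1 else 0)"
    using dual_functionals[where r = r and a = "\<lambda>k. a $$ (0, k)"] a(2)[unfolded row_lin_indep_iff[OF a(1)]] by blast
  define N where "N = (\<Sum>k<r. degree (a $$ (0, k)) + degree (\<alpha> $$ (0, k)))"
  have N: "degree (a $$ (0, k)) \<le> N" "degree (\<alpha> $$ (0, k)) \<le> N" if "k < r" for k
    using member_le_sum[of k "{..<r}" "\<lambda>k. degree (a $$ (0, k)) + degree (\<alpha> $$ (0, k))"] that
    by (simp_all add: N_def)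
  define s where "s i j = (\<Sum>u\<le>N. d i u * coeff (\<alpha> $$ (0, j)) u)" for i j
  \<comment> \<open>Applying the i-th dual functional in T isolates \<alpha>_i(T'); applying it in
    T', as in \<open>Md\<close>, gives a combination of the entries of a. The symmetry of M equates
    the two.\<close>
  have dM: "(\<Sum>u\<le>N. d i u * M u v) = coeff (\<alpha> $$ (0, i)) v" if i: "i < r" for i v
  proof -
    have "(\<Sum>u\<le>N. d i u * M u v) = (\<Sum>k<r. (\<Sum>u\<le>N. d i u * coeff (a $$ (0, k)) u) * coeff (\<alpha> $$ (0, k)) v)"
      unfolding M_def sum_distrib_left sum_distrib_right by (subst sum.swap) (simp add: mult.assoc)
    also have "\<dots> = (\<Sum>k<r. if i = k then coeff (\<alpha> $$ (0, k)) v else 0)"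
      using d[OF i _ N(1)] by (intro sum.cong) auto
    finally show ?thesis using i by simp
  qed
  have Md: "(\<Sum>u\<le>N. d i u * M v u) = (\<Sum>k<r. s i k * coeff (a $$ (0, k)) v)" for i v
    unfolding M_def s_def sum_distrib_left sum_distrib_right by (subst sum.swap) (simp add: ac_simps)
  have \<alpha>_s: "\<alpha> $$ (0, i) = (\<Sum>k<r. [:s i k:] * a $$ (0, k))" if i: "i < r" for i
  proof (rule poly_eqI)
    fix v
    have "coeff (\<alpha> $$ (0, i)) v = (\<Sum>u\<le>N. d i u * M v u)"
      unfolding dM[OF i, symmetric] by (simp add: Msym)
    then show "coeff (\<alpha> $$ (0, i)) v = coeff (\<Sum>k<r. [:s i k:] * a $$ (0, k)) v"
      unfolding Md by (simp add: coeff_sum)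
  qed
  have sym: "s i j = s j i" if ij: "i < r" "j < r" for i j
  proof -
    have "s i j = (\<Sum>u\<le>N. d i u * (\<Sum>k<r. s j k * coeff (a $$ (0, k)) u))"
      unfolding s_def[of i] \<alpha>_s[OF ij(2)] by (simp add: coeff_sum)
    also have "\<dots> = (\<Sum>k<r. s j k * (\<Sum>u\<le>N. d i u * coeff (a $$ (0, k)) u))"
      unfolding sum_distrib_left by (subst sum.swap) (simp add: ac_simps)
    also have "\<dots> = (\<Sum>k<r. if i = k then s j k else 0)"
      using d[OF ij(1) _ N(1)] by (intro sum.cong) auto
    finally show ?thesis using ij by simp
  qed
  let ?S = "mat r r (\<lambda>(i, j). s i j)"
  have "\<alpha> = a * cmat ?S"
  proof (rule eq_matI)
    fix i j assume "i < dim_row (a * cmat ?S)" "j < dim_col (a * cmat ?S)"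
    then have ij: "i = 0" "j < r" using a by auto
    have "(a * cmat ?S) $$ (0, j) = (\<Sum>k<r. a $$ (0, k) * [:s k j:])"
      using ij(2) by (subst row_mult_index[OF a(1), of _ r]) auto
    then show "\<alpha> $$ (i, j) = (a * cmat ?S) $$ (i, j)"
      using ij sym by (simp add: \<alpha>_s mult.commute)
  qed (use a \<alpha> in auto)
  moreover have "?S \<in> GLss r"
  proof -
    \<comment> \<open>A kernel vector of \<open>?S\<close> would be a linear relation between the
      entries of \<alpha>.\<close>
    have "det ?S \<noteq> 0"
    proof
      assume "det ?S = 0"
      then obtain v where v: "v \<in> carrier_vec r" "v \<noteq> 0\<^sub>v r" "?S *\<^sub>v v = 0\<^sub>v r"
        using det_0_iff_vec_prod_zero_field[of ?S r] by auto
      have 0: "(\<Sum>i<r. s k i * v $ i) = 0" if "k < r" for k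
      proof -
        have "(?S *\<^sub>v v) $ k = (\<Sum>i<r. s k i * v $ i)"
          using that v(1) by (auto simp: scalar_prod_def lessThan_atLeast0 intro!: sum.cong)
        then show ?thesis using v(3) that by simp
      qed
      have "(\<Sum>i<r. [:v $ i:] * \<alpha> $$ (0, i)) = (\<Sum>i<r. \<Sum>k<r. [:v $ i:] * ([:s i k:] * a $$ (0, k)))"
        by (intro sum.cong refl) (simp only: \<alpha>_s sum_distrib_left lessThan_iff)
      also have "\<dots> = (\<Sum>k<r. [:\<Sum>i<r. s k i * v $ i:] * a $$ (0, k))"
        unfolding C_hom.hom_sum sum_distrib_right
        by (subst sum.swap) (intro sum.cong refl, simp add: sym mult.commute)
      also have "\<dots> = 0" by (rule sum.neutral) (use 0 in auto)
      finally have "\<forall>i<r. v $ i = 0" using \<alpha>(2)[unfolded row_lin_indep_iff[OF \<alpha>(1)]] by blast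
      then show False using v(1,2) by auto
    qed
    moreover have "transpose_mat ?S = ?S" by (rule eq_matI) (auto simp: sym)
    moreover have "s i i = 0" if "CHAR('k) = 2" "i < r" for i
    proof -
      \<comment> \<open>The diagonal entry is the form M evaluated at the vector \<open>d i\<close>
        in both arguments; M is symmetric with zero diagonal, so for p = 2 the value
        vanishes.\<close>
      have "s i i = (\<Sum>v\<le>N. \<Sum>u\<le>N. d i v * (d i u * M u v))"
        unfolding s_def by (simp add: dM[OF that(2), symmetric] sum_distrib_left)
      also have "\<dots> = (\<Sum>v<Suc N. \<Sum>u<Suc N. d i v * (d i u * M u v))"
        by (simp only: lessThan_Suc_atMost)
      also have "\<dots> = 0"
      proof -
        have "x + x = (0::'k)" for x
          using that(1) by (rule CHAR_2_add_self)
        then show ?thesis unfolding sum_offdiag Mdiag[OF that(1)]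
          by (subst sum.neutral) (auto simp: Msym mult.left_commute)
      qed
      finally show ?thesis .
    qed
    ultimately show ?thesis by (auto simp: GLss_def GL_iff_det)
  qed
  ultimately show ?thesis using that by blast
qed

lemma X_setD:
  fixes S :: "'k::field mat"
  assumes "(S, a1, a2, \<alpha>2, \<alpha>) \<in> X_set l r1 r2"
  shows "S \<in> GLss r1" "a1 \<in> p_poly_rows r1" "a2 \<in> p_poly_rows (l - r1)" "\<alpha>2 \<in> p_poly_rows r2" "\<alpha> \<in> p_polys"
    "row_lin_indep (a1 @\<^sub>c a2)" "row_lin_indep (a1 @\<^sub>c \<alpha>2)"
    and "S \<in> GL r1" "S \<in> carrier_mat r1 r1" "a1 \<in> carrier_mat 1 r1" "a2 \<in> carrier_mat 1 (l - r1)" "\<alpha>2 \<in> carrier_mat 1 r2"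
    "a1 * cmat S \<in> carrier_mat 1 r1" "row_lin_indep (a1 * cmat S @\<^sub>c \<alpha>2)"
proof -
  show X: "S \<in> GLss r1" "a1 \<in> p_poly_rows r1" "a2 \<in> p_poly_rows (l - r1)" "\<alpha>2 \<in> p_poly_rows r2" "\<alpha> \<in> p_polys"
    "row_lin_indep (a1 @\<^sub>c a2)" "row_lin_indep (a1 @\<^sub>c \<alpha>2)"
    using assms by (simp_all add: X_set_def)
  show S: "S \<in> GL r1" using X(1) by (simp add: GLss_def)
  show c: "S \<in> carrier_mat r1 r1" "a1 \<in> carrier_mat 1 r1" "a2 \<in> carrier_mat 1 (l - r1)" "\<alpha>2 \<in> carrier_mat 1 r2"
    using X S by (simp_all add: p_poly_rows_def GL_carrier)
  then show "a1 * cmat S \<in> carrier_mat 1 r1" by simp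
  have "a1 * cmat (0\<^sub>m r1 r2) + \<alpha>2 * cmat (1\<^sub>m r2) = \<alpha>2"
    using c by (simp add: cmat_zero cmat_one)
  then show "row_lin_indep (a1 * cmat S @\<^sub>c \<alpha>2)"
    using row_lin_indep_transform[OF c(2,4) X(7) S GL_one, of "0\<^sub>m r1 r2"] by simp
qed


lemma exp_part_H_set_eq:
  assumes "(l, r1, r2) \<in> Omega m" and char: "CHAR('k::field) > 0"
  shows "exp_part (m + 2) (H_set m l r1 r2) = hbar m l r1 r2 ` (X_set l r1 r2 :: 'k datum set)"
proof (intro equalityI subsetI)
  have dim: "r1 \<le> l" "l + r2 \<le> m" using assms(1) by (auto simp: Omega_def)
  fix A :: "'k poly mat"
  {
    assume "A \<in> exp_part (m + 2) (H_set m l r1 r2)"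
    then obtain a1 a2 \<alpha>1 \<alpha>2 \<phi> where A: "A = h_mat m l r1 r2 a1 a2 \<alpha>1 \<alpha>2 \<phi>" "exponential (m + 2) A"
      and c: "a1 \<in> carrier_mat 1 r1" "a2 \<in> carrier_mat 1 (l - r1)" "\<alpha>1 \<in> carrier_mat 1 r1" "\<alpha>2 \<in> carrier_mat 1 r2"
      and i: "row_lin_indep (a1 @\<^sub>c a2)" "row_lin_indep (\<alpha>1 @\<^sub>c \<alpha>2)"
      unfolding exp_part_def H_set_def by blast
    have e: "a1 \<in> p_poly_rows r1" "a2 \<in> p_poly_rows (l - r1)" "\<alpha>2 \<in> p_poly_rows r2" "poly \<phi> 0 = 0"
      "in_T \<phi> + in_T' \<phi> + (\<Sum>k<r1. in_T (a1 $$ (0, k)) * in_T' (\<alpha>1 $$ (0, k))) = in_T_plus_T' \<phi>"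
      using A exponential_h_mat_iff[OF dim c char] by auto
    obtain S where S: "S \<in> GLss r1" "\<alpha>1 = a1 * cmat S"
      using symmetric_factor[OF char c(1) row_lin_indep_append_left[OF c(1,2) i(1)] c(3)
          row_lin_indep_append_left[OF c(3,4) i(2)] e(4,5)] .
    have SG: "S \<in> GL r1" using S(1) by (simp add: GLss_def)
    define \<alpha> where "\<alpha> = \<phi> - quad r1 S a1"
    have "\<alpha> \<in> p_polys"
      unfolding p_polys_iff_additive[OF char] additive_poly_def
    proof
      show "poly \<alpha> 0 = 0"
        using e(4) quad_poly_0[OF char GL_carrier[OF SG] e(1)] by (simp add: \<alpha>_def)
      show "in_T \<alpha> + in_T' \<alpha> = in_T_plus_T' \<alpha>"
        unfolding \<alpha>_def in_T_plus_T'_hom.hom_minus in_T_hom.hom_minus in_T'_hom.hom_minus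
          e(5)[symmetric] quad_polar[OF char S(1) e(1), symmetric] S(2) by simp
    qed
    moreover have "row_lin_indep (a1 @\<^sub>c \<alpha>2)"
    proof -
      have "\<alpha>1 * cmat (mat_inv r1 S) = a1 * (cmat S * cmat (mat_inv r1 S))"
        unfolding S(2) by (rule assoc_mult_mat) (use c SG GL_carrier mat_inv_carrier in auto)
      also have "cmat S * cmat (mat_inv r1 S) = 1\<^sub>m r1"
        using cmat_mult[OF GL_carrier[OF SG] mat_inv_carrier[OF SG]] by (simp add: mat_inv_right[OF SG] cmat_one)
      finally have "\<alpha>1 * cmat (mat_inv r1 S) = a1" using c by simp
      moreover have "\<alpha>1 * cmat (0\<^sub>m r1 r2) + \<alpha>2 * cmat (1\<^sub>m r2) = \<alpha>2"
        using c by (simp add: cmat_zero cmat_one)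
      ultimately show ?thesis
        using row_lin_indep_transform[OF c(3,4) i(2) mat_inv_GL[OF SG] GL_one, of "0\<^sub>m r1 r2"] by simp
    qed
    ultimately have "(S, a1, a2, \<alpha>2, \<alpha>) \<in> X_set l r1 r2"
      using S e i by (simp add: X_set_def)
    moreover have "hbar m l r1 r2 (S, a1, a2, \<alpha>2, \<alpha>) = A"
      by (simp add: hbar_eq A(1) S(2) \<alpha>_def)
    ultimately show "A \<in> hbar m l r1 r2 ` X_set l r1 r2" by force
  }
  {
    assume "A \<in> hbar m l r1 r2 ` X_set l r1 r2"
    then obtain S a1 a2 \<alpha>2 \<alpha> where A: "A = h_mat m l r1 r2 a1 a2 (a1 * cmat S) \<alpha>2 (\<alpha> + quad r1 S a1)"
      and X: "(S, a1, a2, \<alpha>2, \<alpha>) \<in> X_set l r1 r2"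
      by (auto simp: hbar_eq)
    note X' = X_setD[OF X]
    note e = X'(1-5) and i = X'(6,7) and SG = X'(8) and c = X'(10,11,13,12)
    have "A \<in> H_set m l r1 r2" unfolding H_set_def A using c i X'(14) by blast
    moreover have "a1 * cmat S \<in> p_poly_rows r1" by (rule p_poly_rows_mult[OF char e(2) GL_carrier[OF SG]])
    moreover have "poly (\<alpha> + quad r1 S a1) 0 = 0"
      using p_polys_poly_0[OF char e(5)] quad_poly_0[OF char GL_carrier[OF SG] e(2)] by simp
    moreover have "in_T (\<alpha> + quad r1 S a1) + in_T' (\<alpha> + quad r1 S a1)
        + (\<Sum>k<r1. in_T (a1 $$ (0, k)) * in_T' ((a1 * cmat S) $$ (0, k))) = in_T_plus_T' (\<alpha> + quad r1 S a1)"
      using quad_polar[OF char e(1,2)] p_polys_imp_additive[OF char e(5)]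
      by (simp add: additive_poly_def in_T_hom.hom_add in_T'_hom.hom_add in_T_plus_T'_hom.hom_add algebra_simps del: index_mult_mat)
    ultimately show "A \<in> exp_part (m + 2) (H_set m l r1 r2)"
      unfolding exp_part_def A using exponential_h_mat_iff[OF dim c char] e by auto
  }
qed

subsection \<open>Equivalence of bordered matrices\<close>

text \<open>The intertwining form avoids the inverse and is homogeneous in P, so entries can be
  compared directly and P may be rescaled.\<close>

lemma pmat_equiv_iff:
  fixes A B :: "'k::field poly mat"
  assumes A: "A \<in> carrier_mat n n" and B: "B \<in> carrier_mat n n"
  shows "pmat_equiv n A B \<longleftrightarrow> (\<exists>P\<in>GL n. A * cmat P = cmat P * B)"
proof -
  have "cmat (mat_inv n P) * A * cmat P = B \<longleftrightarrow> A * cmat P = cmat P * B" if P: "P \<in> GL n" for P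
  proof -
    have c: "cmat P \<in> carrier_mat n n" "cmat (mat_inv n P) \<in> carrier_mat n n"
      using GL_carrier[OF P] mat_inv_carrier[OF P] by simp_all
    have inv: "cmat (mat_inv n P) * cmat P = 1\<^sub>m n" "cmat P * cmat (mat_inv n P) = 1\<^sub>m n"
      using cmat_mult[OF mat_inv_carrier[OF P] GL_carrier[OF P]] cmat_mult[OF GL_carrier[OF P] mat_inv_carrier[OF P]]
      by (simp_all add: mat_inv_left[OF P] mat_inv_right[OF P] cmat_one)
    have 1: "cmat P * (cmat (mat_inv n P) * (A * cmat P)) = A * cmat P"
      using A c assoc_mult_mat[OF c(1,2), of "A * cmat P" n] by (simp add: inv)
    have 2: "cmat (mat_inv n P) * (cmat P * B) = B"
      using B assoc_mult_mat[OF c(2,1) B] by (simp add: inv)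
    have 3: "cmat (mat_inv n P) * A * cmat P = cmat (mat_inv n P) * (A * cmat P)"
      by (rule assoc_mult_mat[OF c(2) A c(1)])
    show ?thesis using 1 2 3 by metis
  qed
  then show ?thesis unfolding pmat_equiv_def by blast
qed

text \<open>Each side contains the summand P coming from the identity part of the bordered matrix;
  once it is cancelled, only the contributions of the borders are left.\<close>

lemma border_mat_intertwine_iff:
  fixes f c f' c' :: "nat \<Rightarrow> 'k::field poly" and P :: "'k mat"
  assumes P: "P \<in> carrier_mat (m + 2) (m + 2)"
  shows "border_mat m f c \<phi> * cmat P = cmat P * border_mat m f' c' \<psi> \<longleftrightarrow>
    (\<forall>i<m + 2. \<forall>j<m + 2.
      (if i = 0 then (\<Sum>k=1..m. f k * [:P $$ (k, j):]) + \<phi> * [:P $$ (Suc m, j):]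
       else if i \<le> m then c i * [:P $$ (Suc m, j):] else 0)
      = (if j = Suc m then [:P $$ (i, 0):] * \<psi> + (\<Sum>k=1..m. [:P $$ (i, k):] * c' k)
         else if 1 \<le> j then [:P $$ (i, 0):] * f' j else 0))" (is "_ \<longleftrightarrow> (\<forall>i<m + 2. \<forall>j<m + 2. ?l i j = ?r i j)")
proof -
  have cP: "cmat P \<in> carrier_mat (m + 2) (m + 2)" using P by simp
  have l: "(border_mat m f c \<phi> * cmat P) $$ (i, j) = [:P $$ (i, j):] + ?l i j" if "i < m + 2" "j < m + 2" for i j
  proof -
    have "(\<Sum>k=1..m. f k * cmat P $$ (k, j)) = (\<Sum>k=1..m. f k * [:P $$ (k, j):])"
      using P that by (intro sum.cong) auto
    then show ?thesis using P that unfolding border_mat_mult_left[OF cP that] by auto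
  qed
  have r: "(cmat P * border_mat m f' c' \<psi>) $$ (i, j) = [:P $$ (i, j):] + ?r i j" if "i < m + 2" "j < m + 2" for i j
  proof -
    have "(\<Sum>k=1..m. cmat P $$ (i, k) * c' k) = (\<Sum>k=1..m. [:P $$ (i, k):] * c' k)"
      using P that by (intro sum.cong) auto
    then show ?thesis using P that unfolding border_mat_mult_right[OF cP that] by auto
  qed
  have "border_mat m f c \<phi> * cmat P = cmat P * border_mat m f' c' \<psi> \<longleftrightarrow>
    (\<forall>i<m + 2. \<forall>j<m + 2. (border_mat m f c \<phi> * cmat P) $$ (i, j) = (cmat P * border_mat m f' c' \<psi>) $$ (i, j))"
    using P by (auto simp del: index_mult_mat(1) intro!: eq_matI)
  also have "\<dots> \<longleftrightarrow> (\<forall>i<m + 2. \<forall>j<m + 2. ?l i j = ?r i j)"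
    by (intro all_cong imp_cong refl) (simp only: l r add_left_cancel)
  finally show ?thesis .
qed

text \<open>The positions in \<open>{1..m}\<close> where the first row, respectively the last column, of \<open>h_mat\<close> may be nonzero.\<close>

definition row_supp :: "nat \<Rightarrow> nat set" where "row_supp l = {1..l}"

definition col_supp :: "nat \<Rightarrow> nat \<Rightarrow> nat \<Rightarrow> nat set" where
  "col_supp l r1 r2 = {1..r1} \<union> {l + 1..l + r2}"

text \<open>In terms of the standard basis e_0, ..., e_(m+1), the condition says that P maps four
  coordinate subspaces into themselves: the line of e_0, the hyperplane of vectors with last
  coordinate 0, the span of e_0 and the e_j with j in \<open>col_supp\<close>, and the span of e_0
  and the e_j with j in {1..m} outside \<open>row_supp\<close>. For A in \<open>H_set\<close> with
  r1 >= 1, the third is spanned by the coefficient vectors of the columns of A - I, and the fourth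
  is the kernel of A - I on constant vectors.\<close>

definition block_pattern :: "nat \<Rightarrow> nat \<Rightarrow> nat \<Rightarrow> nat \<Rightarrow> 'a::zero mat \<Rightarrow> bool" where
  "block_pattern m l r1 r2 P \<longleftrightarrow>
    (\<forall>i. 1 \<le> i \<longrightarrow> i \<le> Suc m \<longrightarrow> P $$ (i, 0) = 0) \<and> (\<forall>j\<le>m. P $$ (Suc m, j) = 0) \<and>
    (\<forall>i\<in>{1..m} - col_supp l r1 r2. \<forall>j\<in>col_supp l r1 r2. P $$ (i, j) = 0) \<and>
    (\<forall>i\<in>row_supp l. \<forall>j\<in>{1..m} - row_supp l. P $$ (i, j) = 0)"

text \<open>The relation x runs over all of {1..m}, but only its part on J is forced to vanish: for
  f vanishing off J this is linear independence of the f k with k in J.\<close>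

definition indep_on :: "nat \<Rightarrow> nat set \<Rightarrow> (nat \<Rightarrow> 'k::field poly) \<Rightarrow> bool" where
  "indep_on m J f \<longleftrightarrow> (\<forall>x. (\<Sum>k=1..m. f k * [:x k:]) = 0 \<longrightarrow> (\<forall>k\<in>J. x k = 0))"

lemma indep_on_nonzero:
  assumes "indep_on m J f" "k \<in> J" "1 \<le> k" "k \<le> m" shows "f k \<noteq> 0"
proof
  assume "f k = 0"
  then have "(\<Sum>j=1..m. f j * [:if j = k then 1 else 0:]) = 0" by (intro sum.neutral) auto
  from assms(1)[unfolded indep_on_def, rule_format, OF this assms(2)] show False by simp
qed

text \<open>Away from the first row and the last column, the equations have at most a constant times
  a border entry on each side, and a nonzero border entry can be cancelled. In the first row and the
  last column they become linear relations between border entries with coefficients from P, which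
  independence kills; zeros found before remove the terms with \<phi> and \<psi>.\<close>

lemma intertwine_block_pattern:
  fixes f c f' c' :: "nat \<Rightarrow> 'k::field poly" and P :: "'k mat"
  assumes dim: "1 \<le> r1" "r1 \<le> l" "l + r2 \<le> m"
    and P: "P \<in> carrier_mat (m + 2) (m + 2)"
    and e: "border_mat m f c \<phi> * cmat P = cmat P * border_mat m f' c' \<psi>"
    and f': "\<And>k. k \<in> {1..m} - row_supp l \<Longrightarrow> f' k = 0" and c: "\<And>k. k \<in> {1..m} - col_supp l r1 r2 \<Longrightarrow> c k = 0"
    and ind: "indep_on m (row_supp l) f" "indep_on m (row_supp l) f'" "indep_on m (col_supp l r1 r2) c" "indep_on m (col_supp l r1 r2) c'"
  shows "block_pattern m l r1 r2 P"
proof -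
  have E: "(if i = 0 then (\<Sum>k=1..m. f k * [:P $$ (k, j):]) + \<phi> * [:P $$ (Suc m, j):]
       else if i \<le> m then c i * [:P $$ (Suc m, j):] else 0)
      = (if j = Suc m then [:P $$ (i, 0):] * \<psi> + (\<Sum>k=1..m. [:P $$ (i, k):] * c' k)
         else if 1 \<le> j then [:P $$ (i, 0):] * f' j else 0)" if "i \<le> Suc m" "j \<le> Suc m" for i j
    using e[unfolded border_mat_intertwine_iff[OF P]] that by simp
  \<comment> \<open>Index 1 lies in both supports because r1 >= 1; this makes f' 1 and c 1 available
    for cancellation.\<close>
  have one: "1 \<in> row_supp l" "1 \<in> col_supp l r1 r2" "1 \<le> m" using dim by (auto simp: row_supp_def col_supp_def)
  have f'1: "f' 1 \<noteq> 0" and c1: "c 1 \<noteq> 0"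
    using indep_on_nonzero[OF ind(2) one(1)] indep_on_nonzero[OF ind(3) one(2)] one(3) by auto
  have colD: "P $$ (i, k) = 0" if "(\<Sum>k=1..m. [:P $$ (i, k):] * c' k) = 0" "k \<in> col_supp l r1 r2" for i k
    using ind(4)[unfolded indep_on_def, rule_format, of "\<lambda>k. P $$ (i, k)"] that by (simp add: mult.commute)
  have z1: "P $$ (Suc m, 0) = 0" using E[of "Suc m" 1] f'1 one(3) by auto
  have z2: "P $$ (Suc m, k) = 0" if "k \<in> col_supp l r1 r2" for k
    using colD[OF _ that] E[of "Suc m" "Suc m"] z1 by simp
  have z3: "P $$ (i, 0) = 0" if "1 \<le> i" "i \<le> m" for i
  proof (cases "i \<in> col_supp l r1 r2")
    case True
    then show ?thesis using E[of i 1] f'1 one(3) that z2[OF one(2)] by auto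
  next
    case False
    then show ?thesis using E[of i 1] f'1 one(3) that c[of i] by auto
  qed
  have z4: "P $$ (Suc m, j) = 0" if "1 \<le> j" "j \<le> m" for j
    using E[of 1 j] z3[of 1] c1 one(3) that by auto
  have z5: "P $$ (i, k) = 0" if "i \<in> {1..m} - col_supp l r1 r2" "k \<in> col_supp l r1 r2" for i k
    using colD[OF _ that(2), of i] E[of i "Suc m"] that z3[of i] c[OF that(1)] by auto
  have z6: "P $$ (k, j) = 0" if "k \<in> row_supp l" "j \<in> {1..m} - row_supp l" for k j
    using ind(1)[unfolded indep_on_def, rule_format, of "\<lambda>k. P $$ (k, j)" k] E[of 0 j] that f'[OF that(2)] z4[of j] by auto
  show ?thesis
    unfolding block_pattern_def using z1 z3 z4 z5 z6
    by (auto simp: le_Suc_eq) (metis One_nat_def Suc_leI gr0I)+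
qed

section \<open>Invertibility of the diagonal blocks\<close>

definition sub_mat :: "nat \<Rightarrow> nat \<Rightarrow> nat \<Rightarrow> nat \<Rightarrow> 'a mat \<Rightarrow> 'a mat" where
  "sub_mat o1 n1 o2 n2 P = mat n1 n2 (\<lambda>(i, j). P $$ (o1 + i, o2 + j))"

lemma sub_mat_carrier [simp]: "sub_mat o1 n1 o2 n2 P \<in> carrier_mat n1 n2"
  and sub_mat_index [simp]: "i < n1 \<Longrightarrow> j < n2 \<Longrightarrow> sub_mat o1 n1 o2 n2 P $$ (i, j) = P $$ (o1 + i, o2 + j)"
  and sub_mat_dim [simp]: "dim_row (sub_mat o1 n1 o2 n2 P) = n1" "dim_col (sub_mat o1 n1 o2 n2 P) = n2"
  by (simp_all add: sub_mat_def)

text \<open>Under the vanishing condition the window of R is a left inverse of the window of P. The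
  condition is put on products because the zero comes from R for some blocks and from P for
  others.\<close>

lemma sub_mat_GL:
  fixes P R :: "'k::field mat"
  assumes P: "P \<in> carrier_mat n n" and R: "R \<in> carrier_mat n n" and RP: "R * P = 1\<^sub>m n" and on: "o1 + r \<le> n"
    and z: "\<And>i k j. i \<in> {o1..<o1 + r} \<Longrightarrow> j \<in> {o1..<o1 + r} \<Longrightarrow> k < n \<Longrightarrow> k \<notin> {o1..<o1 + r} \<Longrightarrow> R $$ (i, k) * P $$ (k, j) = 0"
  shows "sub_mat o1 r o1 r P \<in> GL r"
proof -
  have "sub_mat o1 r o1 r R * sub_mat o1 r o1 r P = 1\<^sub>m r"
  proof (rule eq_matI)
    fix i j assume "i < dim_row (1\<^sub>m r)" "j < dim_col (1\<^sub>m r)"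
    then have ij: "i < r" "j < r" by simp_all
    have "(R * P) $$ (o1 + i, o1 + j) = (\<Sum>k\<in>{0..<n}. R $$ (o1 + i, k) * P $$ (k, o1 + j))"
      using P R ij on by (simp add: scalar_prod_def)
    also have "\<dots> = (\<Sum>k\<in>{o1..<o1 + r}. R $$ (o1 + i, k) * P $$ (k, o1 + j))"
      using on ij by (intro sum.mono_neutral_right) (auto simp del: mult_eq_0_iff intro!: z)
    also have "\<dots> = (\<Sum>k\<in>{0..<r}. R $$ (o1 + i, o1 + k) * P $$ (o1 + k, o1 + j))"
      by (intro sum.reindex_bij_witness[of _ "\<lambda>k. o1 + k" "\<lambda>k. k - o1"]) auto
    also have "\<dots> = (sub_mat o1 r o1 r R * sub_mat o1 r o1 r P) $$ (i, j)"
      using ij by (simp add: scalar_prod_def)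
    finally show "(sub_mat o1 r o1 r R * sub_mat o1 r o1 r P) $$ (i, j) = 1\<^sub>m r $$ (i, j)"
      using ij on by (simp add: RP)
  qed simp_all
  then have "det (sub_mat o1 r o1 r R) * det (sub_mat o1 r o1 r P) = 1"
    by (metis det_mult det_one sub_mat_carrier)
  then show ?thesis unfolding GL_iff_det by auto
qed

lemma sub_mat_GL_kernel:
  fixes P :: "'k::field mat"
  assumes "sub_mat o1 r o1 r P \<in> GL r" and z: "\<And>i. i < r \<Longrightarrow> (\<Sum>k<r. P $$ (o1 + i, o1 + k) * v (o1 + k)) = 0"
    and k: "k < r"
  shows "v (o1 + k) = 0"
proof -
  let ?v = "mat r 1 (\<lambda>(k, _). v (o1 + k))"
  have "sub_mat o1 r o1 r P * ?v = 0\<^sub>m r 1"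
    by (rule eq_matI) (auto simp: scalar_prod_def z[unfolded lessThan_atLeast0])
  then have "?v = 0\<^sub>m r 1" by (rule GL_injective[OF assms(1) mat_carrier])
  from arg_cong[OF this, of "\<lambda>M. M $$ (k, 0)"] show ?thesis using k by simp
qed

text \<open>For i, j in one of the three index windows and k in {1..m} outside it, the patterns
  force R i k = 0 or P k j = 0. For the window of a1 the factor depends on k: it is P for k <= l and
  R for k > l. For the window of a2 it is always R, for that of \<alpha>2 always P.\<close>

lemma
  fixes P R :: "'k::field mat"
  assumes dim: "r1 \<le> l" "l + r2 \<le> m"
    and P: "P \<in> carrier_mat (m + 2) (m + 2)" "block_pattern m l r1 r2 P"
    and R: "R \<in> carrier_mat (m + 2) (m + 2)" "block_pattern m l r1 r2 R"
    and RP: "R * P = 1\<^sub>m (m + 2)"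
  shows block_pattern_GL_1: "sub_mat 1 r1 1 r1 P \<in> GL r1"
    and block_pattern_GL_2: "sub_mat (1 + r1) (l - r1) (1 + r1) (l - r1) P \<in> GL (l - r1)"
    and block_pattern_GL_3: "sub_mat (1 + l) r2 (1 + l) r2 P \<in> GL r2"
    and block_pattern_first: "P $$ (0, 0) \<noteq> 0"
    and block_pattern_last: "P $$ (Suc m, Suc m) \<noteq> 0"
proof -
  have R0: "R $$ (i, 0) = 0" if "1 \<le> i" "i \<le> Suc m" for i using R(2) that by (simp add: block_pattern_def)
  have P0: "P $$ (i, 0) = 0" if "1 \<le> i" "i \<le> Suc m" for i using P(2) that by (simp add: block_pattern_def)
  have PS: "P $$ (Suc m, j) = 0" if "j \<le> m" for j using P(2) that by (simp add: block_pattern_def)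
  have RS: "R $$ (Suc m, j) = 0" if "j \<le> m" for j using R(2) that by (simp add: block_pattern_def)
  have pat: "M $$ (i, j) = 0" if "block_pattern m l r1 r2 M" "i \<in> {1..m} - col_supp l r1 r2" "j \<in> col_supp l r1 r2" for M :: "'k mat" and i j
    using that by (simp add: block_pattern_def)
  have pat': "M $$ (i, j) = 0" if "block_pattern m l r1 r2 M" "i \<in> row_supp l" "j \<in> {1..m} - row_supp l" for M :: "'k mat" and i j
    using that by (simp add: block_pattern_def)
  have mid: "R $$ (i, k) * P $$ (k, j) = 0"
    if a: "1 \<le> i" "i \<le> m" "1 \<le> j" "j \<le> m" "k < m + 2" "1 \<le> k \<Longrightarrow> k \<le> m \<Longrightarrow> R $$ (i, k) = 0 \<or> P $$ (k, j) = 0" for i j k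
  proof -
    consider "k = 0" | "1 \<le> k" "k \<le> m" | "k = Suc m" using a(5) by linarith
    then show ?thesis using a R0[of i] PS[of j] by cases auto
  qed
  show "sub_mat 1 r1 1 r1 P \<in> GL r1"
  proof (rule sub_mat_GL[OF P(1) R(1) RP])
    fix i k j assume *: "i \<in> {1..<1 + r1}" "j \<in> {1..<1 + r1}" "k < m + 2" "k \<notin> {1..<1 + r1}"
    show "R $$ (i, k) * P $$ (k, j) = 0"
    proof (rule mid)
      assume k: "1 \<le> k" "k \<le> m"
      show "R $$ (i, k) = 0 \<or> P $$ (k, j) = 0"
        using pat[OF P(2), of k j] pat'[OF R(2), of i k] * k dim unfolding row_supp_def col_supp_def
        by (cases "k \<le> l") auto
    qed (use * dim in auto)
  qed (use dim in auto)
  show "sub_mat (1 + r1) (l - r1) (1 + r1) (l - r1) P \<in> GL (l - r1)"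
  proof (rule sub_mat_GL[OF P(1) R(1) RP])
    fix i k j assume *: "i \<in> {1 + r1..<1 + r1 + (l - r1)}" "j \<in> {1 + r1..<1 + r1 + (l - r1)}" "k < m + 2" "k \<notin> {1 + r1..<1 + r1 + (l - r1)}"
    show "R $$ (i, k) * P $$ (k, j) = 0"
    proof (rule mid)
      assume k: "1 \<le> k" "k \<le> m"
      show "R $$ (i, k) = 0 \<or> P $$ (k, j) = 0"
        using pat[OF R(2), of i k] pat'[OF R(2), of i k] * k dim unfolding row_supp_def col_supp_def
        by (cases "k \<le> l") auto
    qed (use * dim in auto)
  qed (use dim in auto)
  show "sub_mat (1 + l) r2 (1 + l) r2 P \<in> GL r2"
  proof (rule sub_mat_GL[OF P(1) R(1) RP])
    fix i k j assume *: "i \<in> {1 + l..<1 + l + r2}" "j \<in> {1 + l..<1 + l + r2}" "k < m + 2" "k \<notin> {1 + l..<1 + l + r2}"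
    show "R $$ (i, k) * P $$ (k, j) = 0"
    proof (rule mid)
      assume k: "1 \<le> k" "k \<le> m"
      show "R $$ (i, k) = 0 \<or> P $$ (k, j) = 0"
        using pat[OF P(2), of k j] pat'[OF P(2), of k j] * k dim unfolding row_supp_def col_supp_def
        by (cases "k \<le> r1") auto
    qed (use * dim in auto)
  qed (use dim in auto)
  have prod: "(R * P) $$ (i, i) = (\<Sum>k\<in>{0..<m + 2}. R $$ (i, k) * P $$ (k, i))" if "i < m + 2" for i
    using P R that by (simp add: scalar_prod_def)
  have "(\<Sum>k\<in>{0..<m + 2}. R $$ (0, k) * P $$ (k, 0)) = (\<Sum>k\<in>{0}. R $$ (0, k) * P $$ (k, 0))"
    by (rule sum.mono_neutral_right) (auto simp: P0)
  then show "P $$ (0, 0) \<noteq> 0" using prod[of 0] by (auto simp: RP)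
  have "(\<Sum>k\<in>{0..<m + 2}. R $$ (Suc m, k) * P $$ (k, Suc m)) = (\<Sum>k\<in>{Suc m}. R $$ (Suc m, k) * P $$ (k, Suc m))"
    by (rule sum.mono_neutral_right) (auto simp: RS less_Suc_eq_le le_Suc_eq)
  then show "P $$ (Suc m, Suc m) \<noteq> 0" using prod[of "Suc m"] by (auto simp: RP)
qed

lemma sum_append_cols:
  fixes a b :: "'a::comm_semiring_0 mat"
  assumes "a \<in> carrier_mat 1 r" "b \<in> carrier_mat 1 s"
  shows "(\<Sum>i<r + s. H i * (a @\<^sub>c b) $$ (0, i)) = (\<Sum>i<r. H i * a $$ (0, i)) + (\<Sum>i<s. H (r + i) * b $$ (0, i))"
proof -
  have "(\<Sum>i<r + s. H i * (a @\<^sub>c b) $$ (0, i)) = (\<Sum>i\<in>{..<r} \<union> {r..<r + s}. H i * (a @\<^sub>c b) $$ (0, i))"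
    by (intro sum.cong) auto
  also have "\<dots> = (\<Sum>i<r. H i * (a @\<^sub>c b) $$ (0, i)) + (\<Sum>i=r..<r + s. H i * (a @\<^sub>c b) $$ (0, i))"
    by (rule sum.union_disjoint) auto
  also have "(\<Sum>i<r. H i * (a @\<^sub>c b) $$ (0, i)) = (\<Sum>i<r. H i * a $$ (0, i))"
    using assms by (intro sum.cong) (auto simp: index_append_cols)
  also have "(\<Sum>i=r..<r + s. H i * (a @\<^sub>c b) $$ (0, i)) = (\<Sum>i<s. H (r + i) * b $$ (0, i))"
    using assms by (intro sum.reindex_bij_witness[of _ "\<lambda>i. r + i" "\<lambda>i. i - r"]) (auto simp: index_append_cols)
  finally show ?thesis .
qed

lemma indep_on_row_entry:
  fixes a1 a2 :: "'k::field poly mat"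
  assumes dim: "r1 \<le> l" "l \<le> m" and a: "a1 \<in> carrier_mat 1 r1" "a2 \<in> carrier_mat 1 (l - r1)"
    and i: "row_lin_indep (a1 @\<^sub>c a2)"
  shows "indep_on m (row_supp l) (row_entry l r1 a1 a2)"
  unfolding indep_on_def
proof (intro allI impI ballI)
  fix x k assume *: "(\<Sum>k=1..m. row_entry l r1 a1 a2 k * [:x k:]) = 0" "k \<in> row_supp l"
  have "(\<Sum>i<r1 + (l - r1). [:x (Suc i):] * (a1 @\<^sub>c a2) $$ (0, i)) = 0"
    unfolding sum_append_cols[OF a] using *(1) unfolding sum_row_entry[OF dim] by (simp add: mult.commute)
  then have "\<forall>i<r1 + (l - r1). x (Suc i) = 0"
    by (rule i[unfolded row_lin_indep_iff[OF append_cols_carrier[OF a]], THEN spec, of "\<lambda>i. x (Suc i)", THEN mp])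
  then show "x k = 0" using *(2) dim by (cases k) (auto simp: row_supp_def)
qed

lemma indep_on_col_entry:
  fixes \<alpha>1 \<alpha>2 :: "'k::field poly mat"
  assumes dim: "r1 \<le> l" "l + r2 \<le> m" and a: "\<alpha>1 \<in> carrier_mat 1 r1" "\<alpha>2 \<in> carrier_mat 1 r2"
    and i: "row_lin_indep (\<alpha>1 @\<^sub>c \<alpha>2)"
  shows "indep_on m (col_supp l r1 r2) (col_entry l r1 r2 \<alpha>1 \<alpha>2)"
  unfolding indep_on_def
proof (intro allI impI ballI)
  fix x k assume *: "(\<Sum>k=1..m. col_entry l r1 r2 \<alpha>1 \<alpha>2 k * [:x k:]) = 0" "k \<in> col_supp l r1 r2"
  \<comment> \<open>The index gap from r1 + 1 to l between the two parts of the last column is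
    closed up.\<close>
  let ?y = "\<lambda>i. if i < r1 then x (Suc i) else x (Suc (l + (i - r1)))"
  have "(\<Sum>k=1..m. [:x k:] * col_entry l r1 r2 \<alpha>1 \<alpha>2 k) = 0" using *(1) by (simp add: mult.commute)
  then have "(\<Sum>i<r1 + r2. [:?y i:] * (\<alpha>1 @\<^sub>c \<alpha>2) $$ (0, i)) = 0"
    unfolding sum_append_cols[OF a] sum_col_entry[OF dim] by simp
  then have y: "\<forall>i<r1 + r2. ?y i = 0"
    by (rule i[unfolded row_lin_indep_iff[OF append_cols_carrier[OF a]], THEN spec, of ?y, THEN mp])
  show "x k = 0"
  proof (cases "k \<le> r1")
    case True
    then have "k - 1 < r1" "Suc (k - 1) = k" using *(2) by (auto simp: col_supp_def)
    then show ?thesis using y[rule_format, of "k - 1"] by simp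
  next
    case False
    then have "l + 1 \<le> k" "k \<le> l + r2" using *(2) by (auto simp: col_supp_def)
    then have "k - 1 - l < r2" "Suc (l + (k - 1 - l)) = k" by linarith+
    then show ?thesis using y[rule_format, of "r1 + (k - 1 - l)"] by (metis add_diff_cancel_left' add_less_cancel_left not_add_less1)
  qed
qed

lemma row_eq_iff:
  assumes "v \<in> carrier_mat 1 n" "w \<in> carrier_mat 1 n"
  shows "v = w \<longleftrightarrow> (\<forall>j<n. v $$ (0, j) = w $$ (0, j))"
  using assms by (auto intro!: eq_matI)

text \<open>With the zero pattern of a conjugating matrix \<open>P\<close> known, the intertwining relation reduces to its
  first row and its last column.\<close>

lemma intertwine_blocks:
  fixes a1 a2 \<alpha>1 \<alpha>2 b1 b2 \<beta>1 \<beta>2 :: "'k::field poly mat" and P :: "'k mat"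
  assumes dim: "r1 \<le> l" "l + r2 \<le> m"
    and P: "P \<in> carrier_mat (m + 2) (m + 2)" "block_pattern m l r1 r2 P" "P $$ (0, 0) = 1"
    and a: "a1 \<in> carrier_mat 1 r1" "a2 \<in> carrier_mat 1 (l - r1)" "\<alpha>1 \<in> carrier_mat 1 r1" "\<alpha>2 \<in> carrier_mat 1 r2"
    and b: "b1 \<in> carrier_mat 1 r1" "b2 \<in> carrier_mat 1 (l - r1)" "\<beta>1 \<in> carrier_mat 1 r1" "\<beta>2 \<in> carrier_mat 1 r2"
  shows "border_mat m (row_entry l r1 a1 a2) (col_entry l r1 r2 \<alpha>1 \<alpha>2) \<phi> * cmat P = cmat P * border_mat m (row_entry l r1 b1 b2) (col_entry l r1 r2 \<beta>1 \<beta>2) \<psi> \<longleftrightarrow>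
    b1 = a1 * cmat (sub_mat 1 r1 1 r1 P) \<and>
    b2 = a1 * cmat (sub_mat 1 r1 (1 + r1) (l - r1) P) + a2 * cmat (sub_mat (1 + r1) (l - r1) (1 + r1) (l - r1) P) \<and>
    [:P $$ (Suc m, Suc m):] \<cdot>\<^sub>m \<alpha>1 = \<beta>1 * cmat (transpose_mat (sub_mat 1 r1 1 r1 P)) \<and>
    [:P $$ (Suc m, Suc m):] \<cdot>\<^sub>m \<alpha>2 = \<beta>1 * cmat (transpose_mat (sub_mat (1 + l) r2 1 r1 P))
      + \<beta>2 * cmat (transpose_mat (sub_mat (1 + l) r2 (1 + l) r2 P)) \<and>
    smult (P $$ (Suc m, Suc m)) \<phi> + (a1 * cmat (sub_mat 1 r1 (Suc m) 1 P) + a2 * cmat (sub_mat (1 + r1) (l - r1) (Suc m) 1 P)) $$ (0, 0)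
      = \<psi> + (\<beta>1 * cmat (transpose_mat (sub_mat 0 1 1 r1 P)) + \<beta>2 * cmat (transpose_mat (sub_mat 0 1 (1 + l) r2 P))) $$ (0, 0)"
    (is "?L \<longleftrightarrow> ?e1 \<and> ?e2 \<and> ?e3 \<and> ?e4 \<and> ?e5")
proof -
  let ?f = "row_entry l r1 a1 a2" and ?c = "col_entry l r1 r2 \<alpha>1 \<alpha>2" and ?f' = "row_entry l r1 b1 b2" and ?c' = "col_entry l r1 r2 \<beta>1 \<beta>2"
  let ?s = "l - r1"
  have dim': "r1 \<le> l" "l \<le> m" using dim by simp_all
  have p0: "P $$ (i, 0) = 0" if "1 \<le> i" "i \<le> Suc m" for i using P(2) that by (simp add: block_pattern_def)
  have pS: "P $$ (Suc m, j) = 0" if "j \<le> m" for j using P(2) that by (simp add: block_pattern_def)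
  have pc: "P $$ (i, j) = 0" if "i \<in> {1..m} - col_supp l r1 r2" "j \<in> col_supp l r1 r2" for i j
    using P(2) that by (simp add: block_pattern_def)
  have pr: "P $$ (i, j) = 0" if "i \<in> row_supp l" "j \<in> {1..m} - row_supp l" for i j
    using P(2) that by (simp add: block_pattern_def)
  let ?R = "\<lambda>j. (\<Sum>k<r1. a1 $$ (0, k) * [:P $$ (Suc k, j):]) + (\<Sum>k<?s. a2 $$ (0, k) * [:P $$ (Suc (r1 + k), j):])"
  let ?C = "\<lambda>i. (\<Sum>k<r1. [:P $$ (i, Suc k):] * \<beta>1 $$ (0, k)) + (\<Sum>k<r2. [:P $$ (i, Suc (l + k)):] * \<beta>2 $$ (0, k))"
  let ?d = "P $$ (Suc m, Suc m)"
  have R: "(\<Sum>k=1..m. ?f k * [:P $$ (k, j):]) = ?R j" for j by (rule sum_row_entry[OF dim'])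
  have C: "(\<Sum>k=1..m. [:P $$ (i, k):] * ?c' k) = ?C i" for i by (rule sum_col_entry[OF dim])
  have mR: "(v * cmat (sub_mat (Suc o1) n o2 n' P)) $$ (0, j) = (\<Sum>k<n. v $$ (0, k) * [:P $$ (Suc (o1 + k), o2 + j):])"
    if "v \<in> carrier_mat 1 n" "j < n'" for v n o1 o2 n' j
    using that by (subst row_mult_index[OF that(1), of _ n']) (auto intro!: sum.cong)
  have mC: "(v * cmat (transpose_mat (sub_mat o1 n' (Suc o2) n P))) $$ (0, j) = (\<Sum>k<n. [:P $$ (o1 + j, Suc (o2 + k)):] * v $$ (0, k))"
    if "v \<in> carrier_mat 1 n" "j < n'" for v n o1 o2 n' j
    using that by (subst row_mult_index[OF that(1), of _ n']) (auto simp: mult.commute intro!: sum.cong)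
  have f'0: "?f' j = 0" if "j \<in> {1..m} - row_supp l" for j using that dim by (auto simp: row_entry_def row_supp_def)
  have c0: "?c i = 0" if "i \<in> {1..m} - col_supp l r1 r2" for i using that by (auto simp: col_entry_def col_supp_def)
  have "?L \<longleftrightarrow> (\<forall>j\<in>row_supp l. ?R j = ?f' j) \<and> (\<forall>i\<in>col_supp l r1 r2. ?c i * [:?d:] = ?C i)
      \<and> ?R (Suc m) + \<phi> * [:?d:] = \<psi> + ?C 0" (is "_ \<longleftrightarrow> ?M")
    unfolding border_mat_intertwine_iff[OF P(1)] R C
  proof (intro iffI conjI ballI)
    let ?E = "\<lambda>i j. (if i = 0 then ?R j + \<phi> * [:P $$ (Suc m, j):] else if i \<le> m then ?c i * [:P $$ (Suc m, j):] else 0)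
      = (if j = Suc m then [:P $$ (i, 0):] * \<psi> + ?C i else if 1 \<le> j then [:P $$ (i, 0):] * ?f' j else 0)"
    {
      assume E: "\<forall>i<m + 2. \<forall>j<m + 2. ?E i j"
      show "?R j = ?f' j" if "j \<in> row_supp l" for j
        using E[rule_format, of 0 j] that dim' pS[of j] P(3) by (auto simp: row_supp_def)
      show "?c i * [:?d:] = ?C i" if "i \<in> col_supp l r1 r2" for i
        using E[rule_format, of i "Suc m"] that dim p0[of i] by (auto simp: col_supp_def)
      show "?R (Suc m) + \<phi> * [:?d:] = \<psi> + ?C 0"
        using E[rule_format, of 0 "Suc m"] P(3) by simp
    }
    assume M: ?M
    show "\<forall>i<m + 2. \<forall>j<m + 2. ?E i j"
    proof (intro allI impI)
      fix i j assume ij: "i < m + 2" "j < m + 2"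
      \<comment> \<open>Only \<open>r1\<close>, \<open>rS\<close> and \<open>m2\<close> carry
        information; in the other cases the zero pattern of P and the supports of the borders make
        both sides vanish.\<close>
      consider (r0) "i = 0" "j = 0" | (r1) "i = 0" "j \<in> row_supp l" | (r2) "i = 0" "j \<in> {1..m} - row_supp l"
        | (rS) "i = 0" "j = Suc m" | (m1) "1 \<le> i" "i \<le> m" "j \<le> m" | (m2) "i \<in> col_supp l r1 r2" "j = Suc m"
        | (m3) "i \<in> {1..m} - col_supp l r1 r2" "j = Suc m" | (S) "i = Suc m"
        using ij by (cases "i = 0"; cases "j = Suc m"; cases "i = Suc m"; cases "j = 0") (force simp: row_supp_def)+
      then show "?E i j"
      proof cases
        case r0
        have "?R 0 = 0" using dim by (simp add: p0)
        then show ?thesis using r0 pS[of 0] by simp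
      next
        case r1
        then show ?thesis using M pS[of j] dim' P(3) by (auto simp: row_supp_def)
      next
        case r2
        have "?R j = 0"
          using dim pr[OF _ r2(2)] by (simp add: row_supp_def)
        then show ?thesis using r2 pS[of j] f'0[OF r2(2)] by auto
      next
        case rS
        then show ?thesis using M P(3) by simp
      next
        case m1
        then show ?thesis using pS[of j] p0[of i] by auto
      next
        case m2
        then have "1 \<le> i" "i \<le> m" using dim by (auto simp: col_supp_def)
        then show ?thesis using m2 M p0[of i] by auto
      next
        case m3
        have "?C i = 0" using dim pc[OF m3(1)] by (simp add: col_supp_def)
        then show ?thesis using m3 p0[of i] c0[OF m3(1)] by auto
      next
        case S
        have "?C i = 0" using S dim by (simp add: pS)
        then show ?thesis using S p0[of i] by auto
      qed
    qed
  qed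
  also have "(\<forall>j\<in>row_supp l. ?R j = ?f' j) \<longleftrightarrow> ?e1 \<and> ?e2"
  proof -
    have "(\<forall>j\<in>row_supp l. ?R j = ?f' j) \<longleftrightarrow> (\<forall>j<r1. ?R (Suc j) = b1 $$ (0, j)) \<and> (\<forall>j<?s. ?R (Suc (r1 + j)) = b2 $$ (0, j))"
    proof (intro iffI conjI allI impI ballI)
      fix j assume *: "\<forall>j\<in>row_supp l. ?R j = ?f' j"
      show "?R (Suc j) = b1 $$ (0, j)" if "j < r1"
        using *[rule_format, of "Suc j"] that dim by (simp add: row_supp_def row_entry_def)
      show "?R (Suc (r1 + j)) = b2 $$ (0, j)" if "j < ?s"
      proof -
        have "Suc (r1 + j) \<le> l" using that by linarith
        then show ?thesis using *[rule_format, of "Suc (r1 + j)"] by (simp add: row_supp_def row_entry_def)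
      qed
    next
      fix j assume *: "(\<forall>j<r1. ?R (Suc j) = b1 $$ (0, j)) \<and> (\<forall>j<?s. ?R (Suc (r1 + j)) = b2 $$ (0, j))" "j \<in> row_supp l"
      have j: "1 \<le> j" "j \<le> l" using *(2) by (simp_all add: row_supp_def)
      show "?R j = ?f' j"
      proof (cases "j \<le> r1")
        case True
        then have j': "j - 1 < r1" "Suc (j - 1) = j" using j by simp_all
        show ?thesis using True *(1)[THEN conjunct1, rule_format, OF j'(1)] unfolding j'(2) by (simp add: row_entry_def)
      next
        case False
        then have j': "j - 1 - r1 < ?s" "Suc (r1 + (j - 1 - r1)) = j" using j by linarith+
        show ?thesis using False j *(1)[THEN conjunct2, rule_format, OF j'(1)] unfolding j'(2) by (simp add: row_entry_def)
      qed
    qed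
    also have "(\<forall>j<r1. ?R (Suc j) = b1 $$ (0, j)) \<longleftrightarrow> ?e1"
    proof -
      have "?R (Suc j) = (a1 * cmat (sub_mat 1 r1 1 r1 P)) $$ (0, j)" if "j < r1" for j
      proof -
        \<comment> \<open>The entries of a2 drop out of b1: the row index lies outside
          \<open>col_supp\<close>, the column index inside.\<close>
        have "P $$ (Suc (r1 + k), Suc j) = 0" if "k < ?s" for k
          using that \<open>j < r1\<close> dim by (intro pc) (auto simp: col_supp_def)
        then show ?thesis using that by (simp add: mR[OF a(1)])
      qed
      then show ?thesis using a b by (auto simp: row_eq_iff[OF b(1)] simp del: index_mult_mat(1))
    qed
    also have "(\<forall>j<?s. ?R (Suc (r1 + j)) = b2 $$ (0, j)) \<longleftrightarrow> ?e2"
    proof -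
      have "?R (Suc (r1 + j)) = (a1 * cmat (sub_mat 1 r1 (1 + r1) ?s P) + a2 * cmat (sub_mat (1 + r1) ?s (1 + r1) ?s P)) $$ (0, j)" if "j < ?s" for j
        using that a by (simp add: mR[OF a(1)] mR[OF a(2)] del: index_mult_mat(1))
      then show ?thesis using a b by (auto simp: row_eq_iff[OF b(2)] simp del: index_mult_mat(1) index_add_mat(1))
    qed
    finally show ?thesis .
  qed
  also have "(\<forall>i\<in>col_supp l r1 r2. ?c i * [:?d:] = ?C i) \<longleftrightarrow> ?e3 \<and> ?e4"
  proof -
    have "(\<forall>i\<in>col_supp l r1 r2. ?c i * [:?d:] = ?C i)
      \<longleftrightarrow> (\<forall>i<r1. [:?d:] * \<alpha>1 $$ (0, i) = ?C (Suc i)) \<and> (\<forall>i<r2. [:?d:] * \<alpha>2 $$ (0, i) = ?C (Suc (l + i)))"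
    proof (intro iffI conjI allI impI ballI)
      fix i assume *: "\<forall>i\<in>col_supp l r1 r2. ?c i * [:?d:] = ?C i"
      show "[:?d:] * \<alpha>1 $$ (0, i) = ?C (Suc i)" if "i < r1"
        using *[rule_format, of "Suc i"] that dim by (simp add: col_supp_def col_entry_def)
      show "[:?d:] * \<alpha>2 $$ (0, i) = ?C (Suc (l + i))" if "i < r2"
        using *[rule_format, of "Suc (l + i)"] that dim by (simp add: col_supp_def col_entry_def)
    next
      fix i assume *: "(\<forall>i<r1. [:?d:] * \<alpha>1 $$ (0, i) = ?C (Suc i)) \<and> (\<forall>i<r2. [:?d:] * \<alpha>2 $$ (0, i) = ?C (Suc (l + i)))"
        "i \<in> col_supp l r1 r2"
      show "?c i * [:?d:] = ?C i"
      proof (cases "i \<le> r1")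
        case True
        then have i': "i - 1 < r1" "Suc (i - 1) = i" using *(2) by (auto simp: col_supp_def)
        show ?thesis using True *(1)[THEN conjunct1, rule_format, OF i'(1)] unfolding i'(2) by (simp add: col_entry_def)
      next
        case False
        then have i: "\<not> i \<le> l" "i \<le> l + r2" using *(2) by (auto simp: col_supp_def)
        then have i': "i - 1 - l < r2" "Suc (l + (i - 1 - l)) = i" by linarith+
        show ?thesis using False i *(1)[THEN conjunct2, rule_format, OF i'(1)] unfolding i'(2) by (simp add: col_entry_def)
      qed
    qed
    also have "(\<forall>i<r1. [:?d:] * \<alpha>1 $$ (0, i) = ?C (Suc i)) \<longleftrightarrow> ?e3"
    proof -
      have "?C (Suc i) = (\<beta>1 * cmat (transpose_mat (sub_mat 1 r1 1 r1 P))) $$ (0, i)" if "i < r1" for i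
      proof -
        \<comment> \<open>Dually, \<beta>2 drops out of the equation for \<alpha>1: the row index
          lies in \<open>row_supp\<close>, the column index outside.\<close>
        have "P $$ (Suc i, Suc (l + k)) = 0" if "k < r2" for k
          using that \<open>i < r1\<close> dim by (intro pr) (auto simp: row_supp_def)
        then show ?thesis using that by (simp add: mC[OF b(3)])
      qed
      then show ?thesis using a b by (auto simp: row_eq_iff[of "[:?d:] \<cdot>\<^sub>m \<alpha>1" r1] simp del: index_mult_mat(1))
    qed
    also have "(\<forall>i<r2. [:?d:] * \<alpha>2 $$ (0, i) = ?C (Suc (l + i))) \<longleftrightarrow> ?e4"
    proof -
      have "?C (Suc (l + i)) = (\<beta>1 * cmat (transpose_mat (sub_mat (1 + l) r2 1 r1 P))
          + \<beta>2 * cmat (transpose_mat (sub_mat (1 + l) r2 (1 + l) r2 P))) $$ (0, i)" if "i < r2" for i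
        using that b by (simp add: mC[OF b(3)] mC[OF b(4)] del: index_mult_mat(1))
      then show ?thesis using a b by (auto simp: row_eq_iff[of "[:?d:] \<cdot>\<^sub>m \<alpha>2" r2] simp del: index_mult_mat(1) index_add_mat(1))
    qed
    finally show ?thesis .
  qed
  also have "?R (Suc m) + \<phi> * [:?d:] = \<psi> + ?C 0 \<longleftrightarrow> ?e5"
  proof -
    have "(a1 * cmat (sub_mat 1 r1 (Suc m) 1 P) + a2 * cmat (sub_mat (1 + r1) ?s (Suc m) 1 P)) $$ (0, 0) = ?R (Suc m)"
      using a by (simp add: mR[OF a(1)] mR[OF a(2)] del: index_mult_mat(1))
    moreover have "(\<beta>1 * cmat (transpose_mat (sub_mat 0 1 1 r1 P)) + \<beta>2 * cmat (transpose_mat (sub_mat 0 1 (1 + l) r2 P))) $$ (0, 0) = ?C 0"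
      using b by (simp add: mC[OF b(3)] mC[OF b(4)] del: index_mult_mat(1))
    ultimately show ?thesis by (simp add: add.commute del: index_mult_mat(1) index_add_mat(1))
  qed
  finally show ?thesis by simp
qed

lemma row_entry_supp: "k \<in> {1..m} - row_supp l \<Longrightarrow> r1 \<le> l \<Longrightarrow> row_entry l r1 a1 a2 k = 0"
  by (auto simp: row_entry_def row_supp_def)

lemma col_entry_supp: "k \<in> {1..m} - col_supp l r1 r2 \<Longrightarrow> col_entry l r1 r2 \<alpha>1 \<alpha>2 k = 0"
  by (auto simp: col_entry_def col_supp_def)

text \<open>The conjugating matrix is scaled so that its upper left entry is 1; \<open>d\<close> is then its lower right entry.\<close>

lemma h_equiv_forward:
  fixes a1 a2 \<alpha>1 \<alpha>2 b1 b2 \<beta>1 \<beta>2 :: "'k::field poly mat"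
  assumes dim: "1 \<le> r1" "r1 \<le> l" "l + r2 \<le> m"
    and a: "a1 \<in> carrier_mat 1 r1" "a2 \<in> carrier_mat 1 (l - r1)" "\<alpha>1 \<in> carrier_mat 1 r1" "\<alpha>2 \<in> carrier_mat 1 r2"
    and b: "b1 \<in> carrier_mat 1 r1" "b2 \<in> carrier_mat 1 (l - r1)" "\<beta>1 \<in> carrier_mat 1 r1" "\<beta>2 \<in> carrier_mat 1 r2"
    and ia: "row_lin_indep (a1 @\<^sub>c a2)" "row_lin_indep (\<alpha>1 @\<^sub>c \<alpha>2)"
    and ib: "row_lin_indep (b1 @\<^sub>c b2)" "row_lin_indep (\<beta>1 @\<^sub>c \<beta>2)"
    and eq: "pmat_equiv (m + 2) (h_mat m l r1 r2 a1 a2 \<alpha>1 \<alpha>2 \<phi>) (h_mat m l r1 r2 b1 b2 \<beta>1 \<beta>2 \<psi>)"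
  obtains Q Q12 Q22 L M u v w1 w2 and d :: 'k where
    "Q \<in> GL r1" "Q12 \<in> carrier_mat r1 (l - r1)" "Q22 \<in> GL (l - r1)" "L \<in> carrier_mat r1 r2" "M \<in> GL r2" "d \<noteq> 0"
    "u \<in> carrier_mat r1 1" "v \<in> carrier_mat (l - r1) 1" "w1 \<in> carrier_mat r1 1" "w2 \<in> carrier_mat r2 1"
    "b1 = a1 * cmat Q" "b2 = a1 * cmat Q12 + a2 * cmat Q22"
    "[:d:] \<cdot>\<^sub>m \<alpha>1 = \<beta>1 * cmat (transpose_mat Q)" "[:d:] \<cdot>\<^sub>m \<alpha>2 = \<beta>1 * cmat L + \<beta>2 * cmat M"
    "smult d \<phi> + (a1 * cmat u + a2 * cmat v) $$ (0, 0) = \<psi> + (\<beta>1 * cmat w1 + \<beta>2 * cmat w2) $$ (0, 0)"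
proof -
  let ?A = "border_mat m (row_entry l r1 a1 a2) (col_entry l r1 r2 \<alpha>1 \<alpha>2) \<phi>" and ?B = "border_mat m (row_entry l r1 b1 b2) (col_entry l r1 r2 \<beta>1 \<beta>2) \<psi>"
  have dim': "r1 \<le> l" "l \<le> m" using dim by simp_all
  note ind = indep_on_row_entry[OF dim' a(1,2) ia(1)] indep_on_row_entry[OF dim' b(1,2) ib(1)]
    indep_on_col_entry[OF dim(2,3) a(3,4) ia(2)] indep_on_col_entry[OF dim(2,3) b(3,4) ib(2)]
  obtain P where P: "P \<in> GL (m + 2)" "?A * cmat P = cmat P * ?B"
    using eq unfolding h_mat_eq_border_mat[OF dim(2,3) a] h_mat_eq_border_mat[OF dim(2,3) b] pmat_equiv_iff[OF border_mat_carrier border_mat_carrier] by blast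
  let ?R = "mat_inv (m + 2) P"
  have Pc: "P \<in> carrier_mat (m + 2) (m + 2)" and Rc: "?R \<in> carrier_mat (m + 2) (m + 2)"
    using P(1) by (simp_all add: GL_carrier mat_inv_carrier)
  have RP: "?R * P = 1\<^sub>m (m + 2)" and PR: "P * ?R = 1\<^sub>m (m + 2)"
    using P(1) by (simp_all add: mat_inv_left mat_inv_right)
  \<comment> \<open>The inverse of P intertwines in the opposite direction and hence has the same
    zero pattern, as the invertibility of the diagonal blocks requires.\<close>
  have R: "?B * cmat ?R = cmat ?R * ?A"
  proof -
    have c: "cmat P \<in> carrier_mat (m + 2) (m + 2)" "cmat ?R \<in> carrier_mat (m + 2) (m + 2)" using Pc Rc by simp_all
    have "cmat ?R * (?A * cmat P) * cmat ?R = cmat ?R * ?A * (cmat P * cmat ?R)"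
      using assoc_mult_mat[OF c(2) border_mat_carrier c(1)] assoc_mult_mat[OF mult_carrier_mat[OF c(2) border_mat_carrier] c(1,2)] by metis
    moreover have "cmat ?R * (cmat P * ?B) * cmat ?R = cmat ?R * cmat P * (?B * cmat ?R)"
      using assoc_mult_mat[OF c(2,1) border_mat_carrier] assoc_mult_mat[OF mult_carrier_mat[OF c(2,1)] border_mat_carrier c(2)] by metis
    moreover have "cmat P * cmat ?R = 1\<^sub>m (m + 2)" "cmat ?R * cmat P = 1\<^sub>m (m + 2)"
      using cmat_mult[OF Pc Rc] cmat_mult[OF Rc Pc] unfolding RP PR cmat_one by simp_all
    ultimately have "cmat ?R * ?A * 1\<^sub>m (m + 2) = 1\<^sub>m (m + 2) * (?B * cmat ?R)" using P(2) by metis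
    moreover have "cmat ?R * ?A * 1\<^sub>m (m + 2) = cmat ?R * ?A" by (rule right_mult_one_mat[OF mult_carrier_mat[OF c(2) border_mat_carrier]])
    moreover have "1\<^sub>m (m + 2) * (?B * cmat ?R) = ?B * cmat ?R" by (rule left_mult_one_mat[OF mult_carrier_mat[OF border_mat_carrier c(2)]])
    ultimately show ?thesis by simp
  qed
  have pP: "block_pattern m l r1 r2 P"
    by (rule intertwine_block_pattern[OF dim Pc P(2) row_entry_supp[OF _ dim(2)] col_entry_supp ind]) auto
  have pR: "block_pattern m l r1 r2 ?R"
    by (rule intertwine_block_pattern[OF dim Rc R row_entry_supp[OF _ dim(2)] col_entry_supp ind(2,1,4,3)]) auto
  note first = block_pattern_first[OF dim(2,3) Pc pP Rc pR RP]
  let ?P = "inverse (P $$ (0, 0)) \<cdot>\<^sub>m P" and ?R' = "P $$ (0, 0) \<cdot>\<^sub>m ?R"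
  have Pc': "?P \<in> carrier_mat (m + 2) (m + 2)" and Rc': "?R' \<in> carrier_mat (m + 2) (m + 2)" using Pc Rc by simp_all
  have bp: "block_pattern m l r1 r2 (c \<cdot>\<^sub>m M)" if "block_pattern m l r1 r2 M" "M \<in> carrier_mat (m + 2) (m + 2)" for c and M :: "'k mat"
    using that dim unfolding block_pattern_def row_supp_def col_supp_def by auto
  note pP' = bp[OF pP Pc] and pR' = bp[OF pR Rc]
  have RP': "?R' * ?P = 1\<^sub>m (m + 2)"
  proof -
    have "?R' * ?P = P $$ (0, 0) \<cdot>\<^sub>m (inverse (P $$ (0, 0)) \<cdot>\<^sub>m (?R * P))"
      unfolding mult_smult_assoc_mat[OF Rc Pc'] mult_smult_distrib[OF Rc Pc] ..
    also have "\<dots> = 1\<^sub>m (m + 2)" unfolding RP using first by (intro eq_matI) auto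
    finally show ?thesis .
  qed
  have e: "?A * cmat ?P = cmat ?P * ?B"
    using Pc P(2) mult_smult_distrib[OF border_mat_carrier, of "cmat P"] mult_smult_assoc_mat[of "cmat P" _ _ _ _ , OF _ border_mat_carrier]
    by (simp add: cmat_smult)
  have 1: "?P $$ (0, 0) = 1" using first Pc by simp
  \<comment> \<open>The blocks of P that multiply the last column appear transposed, because
    \<beta>1 and \<beta>2 are stored as rows.\<close>
  show ?thesis
    by (rule that[OF block_pattern_GL_1[OF dim(2,3) Pc' pP' Rc' pR' RP'] sub_mat_carrier
          block_pattern_GL_2[OF dim(2,3) Pc' pP' Rc' pR' RP'] transpose_carrier_mat[THEN iffD2, OF sub_mat_carrier]
          GL_transpose[OF block_pattern_GL_3[OF dim(2,3) Pc' pP' Rc' pR' RP']]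
          block_pattern_last[OF dim(2,3) Pc' pP' Rc' pR' RP'] sub_mat_carrier sub_mat_carrier
          transpose_carrier_mat[THEN iffD2, OF sub_mat_carrier] transpose_carrier_mat[THEN iffD2, OF sub_mat_carrier]])
      (use intertwine_blocks[OF dim(2,3) Pc' pP' 1 a b, THEN iffD1, OF e] in blast)+
qed

lemma h_equiv_backward:
  fixes a1 a2 \<alpha>1 \<alpha>2 b1 b2 \<beta>1 \<beta>2 :: "'k::field poly mat"
  assumes dim: "r1 \<le> l" "l + r2 \<le> m"
    and a: "a1 \<in> carrier_mat 1 r1" "a2 \<in> carrier_mat 1 (l - r1)" "\<alpha>1 \<in> carrier_mat 1 r1" "\<alpha>2 \<in> carrier_mat 1 r2"
    and b: "b1 \<in> carrier_mat 1 r1" "b2 \<in> carrier_mat 1 (l - r1)" "\<beta>1 \<in> carrier_mat 1 r1" "\<beta>2 \<in> carrier_mat 1 r2"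
    and c: "Q \<in> GL r1" "Q12 \<in> carrier_mat r1 (l - r1)" "Q22 \<in> GL (l - r1)" "L \<in> carrier_mat r1 r2" "M \<in> GL r2" "d \<noteq> 0"
      "u \<in> carrier_mat r1 1" "v \<in> carrier_mat (l - r1) 1" "w1 \<in> carrier_mat r1 1" "w2 \<in> carrier_mat r2 1"
    and eqs: "b1 = a1 * cmat Q" "b2 = a1 * cmat Q12 + a2 * cmat Q22"
      "[:d:] \<cdot>\<^sub>m \<alpha>1 = \<beta>1 * cmat (transpose_mat Q)" "[:d:] \<cdot>\<^sub>m \<alpha>2 = \<beta>1 * cmat L + \<beta>2 * cmat M"
      "smult d \<phi> + (a1 * cmat u + a2 * cmat v) $$ (0, 0) = \<psi> + (\<beta>1 * cmat w1 + \<beta>2 * cmat w2) $$ (0, 0)"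
  shows "pmat_equiv (m + 2) (h_mat m l r1 r2 a1 a2 \<alpha>1 \<alpha>2 \<phi>) (h_mat m l r1 r2 b1 b2 \<beta>1 \<beta>2 \<psi>)"
proof -
  \<comment> \<open>The given matrices are put where \<open>intertwine_blocks\<close> reads them,
    with L, M, w1 and w2 transposed. The positions from l + r2 + 1 to m carry an identity block, and
    the corner (0, m + 1), which cancels in the intertwining relation, is 0.\<close>
  define P where "P = mat (m + 2) (m + 2) (\<lambda>(i, j).
    if i = 0 then (if j = 0 then 1 else if j \<le> r1 then w1 $$ (j - 1, 0)
      else if l < j \<and> j \<le> l + r2 then w2 $$ (j - 1 - l, 0) else 0)
    else if i \<le> r1 then (if 1 \<le> j \<and> j \<le> r1 then Q $$ (i - 1, j - 1)
      else if r1 < j \<and> j \<le> l then Q12 $$ (i - 1, j - 1 - r1) else if j = Suc m then u $$ (i - 1, 0) else 0)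
    else if i \<le> l then (if r1 < j \<and> j \<le> l then Q22 $$ (i - 1 - r1, j - 1 - r1)
      else if j = Suc m then v $$ (i - 1 - r1, 0) else 0)
    else if i \<le> l + r2 then (if 1 \<le> j \<and> j \<le> r1 then L $$ (j - 1, i - 1 - l)
      else if l < j \<and> j \<le> l + r2 then M $$ (j - 1 - l, i - 1 - l) else 0)
    else if i = j then (if j = Suc m then d else 1) else 0)"
  have Pc: "P \<in> carrier_mat (m + 2) (m + 2)" by (simp add: P_def)
  have Pi: "P $$ (i, j) = (if i = 0 then (if j = 0 then 1 else if j \<le> r1 then w1 $$ (j - 1, 0)
      else if l < j \<and> j \<le> l + r2 then w2 $$ (j - 1 - l, 0) else 0)
    else if i \<le> r1 then (if 1 \<le> j \<and> j \<le> r1 then Q $$ (i - 1, j - 1)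
      else if r1 < j \<and> j \<le> l then Q12 $$ (i - 1, j - 1 - r1) else if j = Suc m then u $$ (i - 1, 0) else 0)
    else if i \<le> l then (if r1 < j \<and> j \<le> l then Q22 $$ (i - 1 - r1, j - 1 - r1)
      else if j = Suc m then v $$ (i - 1 - r1, 0) else 0)
    else if i \<le> l + r2 then (if 1 \<le> j \<and> j \<le> r1 then L $$ (j - 1, i - 1 - l)
      else if l < j \<and> j \<le> l + r2 then M $$ (j - 1 - l, i - 1 - l) else 0)
    else if i = j then (if j = Suc m then d else 1) else 0)" if "i \<le> Suc m" "j \<le> Suc m" for i j
    using that by (simp add: P_def)
  have pP: "block_pattern m l r1 r2 P"
    unfolding block_pattern_def row_supp_def col_supp_def
    using dim by (intro conjI ballI allI impI) (auto simp: Pi)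
  have Q: "Q \<in> carrier_mat r1 r1" "Q22 \<in> carrier_mat (l - r1) (l - r1)" "M \<in> carrier_mat r2 r2"
    using c by (simp_all add: GL_carrier)
  have s1: "sub_mat 1 r1 1 r1 P = Q"
    by (rule eq_matI) (use dim c Q in \<open>auto simp: Pi\<close>)
  have s2: "sub_mat 1 r1 (1 + r1) (l - r1) P = Q12"
    by (rule eq_matI) (use dim c Q in \<open>auto simp: Pi\<close>)
  have s3: "sub_mat (1 + r1) (l - r1) (1 + r1) (l - r1) P = Q22"
    by (rule eq_matI) (use dim c Q in \<open>auto simp: Pi\<close>)
  have s4: "transpose_mat (sub_mat (1 + l) r2 1 r1 P) = L"
    by (rule eq_matI) (use dim c Q in \<open>auto simp: Pi\<close>)
  have s5: "transpose_mat (sub_mat (1 + l) r2 (1 + l) r2 P) = M"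
    by (rule eq_matI) (use dim c Q in \<open>auto simp: Pi\<close>)
  have s6: "sub_mat 1 r1 (Suc m) 1 P = u"
    by (rule eq_matI) (use dim c Q in \<open>auto simp: Pi\<close>)
  have s7: "sub_mat (1 + r1) (l - r1) (Suc m) 1 P = v"
    by (rule eq_matI) (use dim c Q in \<open>auto simp: Pi\<close>)
  have s8: "transpose_mat (sub_mat 0 1 1 r1 P) = w1"
    by (rule eq_matI) (use dim c Q in \<open>auto simp: Pi\<close>)
  have s9: "transpose_mat (sub_mat 0 1 (1 + l) r2 P) = w2"
    by (rule eq_matI) (use dim c Q in \<open>auto simp: Pi\<close>)
  have s10: "P $$ (Suc m, Suc m) = d" "P $$ (0, 0) = 1" using dim by (simp_all add: Pi)
  have s5': "sub_mat (1 + l) r2 (1 + l) r2 P = transpose_mat M" unfolding s5[symmetric] by simp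
  have "border_mat m (row_entry l r1 a1 a2) (col_entry l r1 r2 \<alpha>1 \<alpha>2) \<phi> * cmat P = cmat P * border_mat m (row_entry l r1 b1 b2) (col_entry l r1 r2 \<beta>1 \<beta>2) \<psi>"
    unfolding intertwine_blocks[OF dim Pc pP s10(2) a b] s1 s2 s3 s4 s5 s6 s7 s8 s9 s10
    using eqs by blast
  moreover have "P \<in> GL (m + 2)"
  proof -
    \<comment> \<open>P is block triangular only up to a permutation of the blocks, so a kernel
      vector is eliminated block by block instead: last coordinate, identity block, a2, a1,
      \<alpha>2, first coordinate. In this order each row block involves only its own columns and
      columns whose coordinates already vanish.\<close>
    have "det P \<noteq> 0"
    proof
      assume "det P = 0"
      then obtain x where x: "x \<in> carrier_vec (m + 2)" "x \<noteq> 0\<^sub>v (m + 2)" "P *\<^sub>v x = 0\<^sub>v (m + 2)"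
        using det_0_iff_vec_prod_zero_field[OF Pc] by auto
      have row: "P $$ (i, 0) * x $ 0 + (\<Sum>k=1..m. P $$ (i, k) * x $ k) + P $$ (i, Suc m) * x $ Suc m = 0" if "i \<le> Suc m" for i
      proof -
        have "(P *\<^sub>v x) $ i = (\<Sum>k\<in>{0..<m + 2}. P $$ (i, k) * x $ k)"
          using that x(1) Pc by (auto simp: scalar_prod_def intro!: sum.cong)
        then show ?thesis unfolding sum_ends using x(3) that by simp
      qed
      have xS: "x $ Suc m = 0"
      proof -
        have "(\<Sum>k=1..m. P $$ (Suc m, k) * x $ k) = 0" using dim by (intro sum.neutral) (auto simp: Pi)
        moreover have "P $$ (Suc m, 0) = 0" using dim by (simp add: Pi)
        ultimately show ?thesis using row[of "Suc m"] c(6) s10(1) by simp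
      qed
      have mid: "(\<Sum>k=1..m. P $$ (i, k) * x $ k) = 0" if "1 \<le> i" "i \<le> m" for i
      proof -
        have "P $$ (i, 0) = 0" using that dim by (simp add: Pi)
        then show ?thesis using row[of i] that xS by simp
      qed
      have x4: "x $ i = 0" if "l + r2 < i" "i \<le> m" for i
      proof -
        have "(\<Sum>k=1..m. P $$ (i, k) * x $ k) = (\<Sum>k\<in>{i}. P $$ (i, k) * x $ k)"
          using that dim by (intro sum.mono_neutral_right) (auto simp: Pi)
        then show ?thesis using mid[of i] that dim by (simp add: Pi)
      qed
      have part: "(\<Sum>k<r. P $$ (i, o1 + k) * x $ (o1 + k)) = 0"
        if "1 \<le> i" "i \<le> m" "1 \<le> o1" "o1 + r \<le> Suc m" "\<And>k. 1 \<le> k \<Longrightarrow> k \<le> m \<Longrightarrow> k \<notin> {o1..<o1 + r} \<Longrightarrow> P $$ (i, k) = 0 \<or> x $ k = 0"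
        for i o1 r
      proof -
        have "(\<Sum>k=1..m. P $$ (i, k) * x $ k) = (\<Sum>k\<in>{o1..<o1 + r}. P $$ (i, k) * x $ k)"
          using that by (intro sum.mono_neutral_right) auto
        also have "\<dots> = (\<Sum>k<r. P $$ (i, o1 + k) * x $ (o1 + k))"
          by (intro sum.reindex_bij_witness[of _ "\<lambda>k. o1 + k" "\<lambda>k. k - o1"]) auto
        finally show ?thesis using mid[OF that(1,2)] by simp
      qed
      have x2: "x $ (1 + r1 + k) = 0" if "k < l - r1" for k
        by (rule sub_mat_GL_kernel[of "1 + r1" "l - r1" P "\<lambda>k. x $ k", OF c(3)[folded s3] part that])
          (use dim in \<open>auto simp: Pi\<close>)
      have x2': "x $ k = 0" if "r1 < k" "k \<le> l" for k using x2[of "k - 1 - r1"] that by simp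
      have x1: "x $ (1 + k) = 0" if "k < r1" for k
        by (rule sub_mat_GL_kernel[of 1 r1 P "\<lambda>k. x $ k", OF c(1)[folded s1] part that])
          (use dim x2' in \<open>auto simp: Pi\<close>)
      have x1': "x $ k = 0" if "1 \<le> k" "k \<le> r1" for k using x1[of "k - 1"] that by simp
      have x3: "x $ (1 + l + k) = 0" if "k < r2" for k
        by (rule sub_mat_GL_kernel[of "1 + l" r2 P "\<lambda>k. x $ k", OF GL_transpose[OF c(5), folded s5'] part that])
          (use dim x1' x2' x4 in \<open>auto simp: Pi\<close>)
      have x3': "x $ k = 0" if "l < k" "k \<le> l + r2" for k using x3[of "k - 1 - l"] that by simp
      have xm: "x $ k = 0" if "1 \<le> k" "k \<le> m" for k
        using x1' x2' x3' x4 that by (meson not_le)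
      have x0: "x $ 0 = 0" using row[of 0] xS xm s10(2) by simp
      have "x $ k = 0" if "k < m + 2" for k
        using that x0 xm xS by (cases "k = 0"; cases "k = Suc m") auto
      then show False using x(1,2) by auto
    qed
    then show ?thesis using Pc by (simp add: GL_iff_det)
  qed
  ultimately show ?thesis
    unfolding h_mat_eq_border_mat[OF dim a] h_mat_eq_border_mat[OF dim b] pmat_equiv_iff[OF border_mat_carrier border_mat_carrier] by blast
qed

subsection \<open>Quadratic forms under congruence\<close>

lemma row_cmat_assoc:
  fixes a :: "'k::field poly mat"
  assumes "a \<in> carrier_mat nr n" "C \<in> carrier_mat n k" "D \<in> carrier_mat k c"
  shows "a * cmat C * cmat D = a * cmat (C * D)"
  unfolding cmat_mult[OF assms(2,3)] by (rule assoc_mult_mat[OF assms(1)]) (use assms in simp_all)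

lemma row_cmat_add:
  fixes a :: "'k::field poly mat"
  assumes "a \<in> carrier_mat nr n" "C \<in> carrier_mat n k" "D \<in> carrier_mat n k"
  shows "a * cmat (C + D) = a * cmat C + a * cmat D"
  unfolding cmat_add[OF assms(2,3)] by (rule mult_add_distrib_mat[OF assms(1)]) (use assms in simp_all)

lemma row_cmat_smult:
  fixes a :: "'k::field poly mat"
  assumes "a \<in> carrier_mat nr n" "C \<in> carrier_mat n k"
  shows "a * cmat (e \<cdot>\<^sub>m C) = [:e:] \<cdot>\<^sub>m (a * cmat C)"
  unfolding cmat_smult by (rule mult_smult_distrib[OF assms(1)]) (use assms in simp)

lemma add_row_cmat:
  fixes a b :: "'k::field poly mat"
  assumes "a \<in> carrier_mat nr n" "b \<in> carrier_mat nr n" "C \<in> carrier_mat n k"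
  shows "(a + b) * cmat C = a * cmat C + b * cmat C"
  by (rule add_mult_distrib_mat[OF assms(1,2)]) (use assms in simp)

lemma row_cmat_one:
  fixes a :: "'k::field poly mat"
  shows "a \<in> carrier_mat nr n \<Longrightarrow> a * cmat (1\<^sub>m n) = a"
  by (simp add: cmat_one)

lemma congruence_cancel:
  fixes Q :: "'k::field mat"
  assumes Q: "Q \<in> GL r" and S: "S \<in> carrier_mat r r"
  shows "mat_inv r Q * (Q * S * transpose_mat Q) * mat_inv r (transpose_mat Q) = S"
proof -
  note QT = GL_transpose[OF Q]
  note c = GL_carrier[OF Q] mat_inv_carrier[OF Q] GL_carrier[OF QT] mat_inv_carrier[OF QT]
  have "mat_inv r Q * (Q * S * transpose_mat Q) * mat_inv r (transpose_mat Q)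
      = (mat_inv r Q * Q) * S * (transpose_mat Q * mat_inv r (transpose_mat Q))"
    using c S by (simp add: assoc_mult_mat[of _ r r _ r _ r])
  then show ?thesis using S by (simp add: mat_inv_left[OF Q] mat_inv_right[OF QT])
qed

lemma index_congruence:
  fixes Q Z :: "'a::comm_ring_1 mat"
  assumes "Q \<in> carrier_mat r r" "Z \<in> carrier_mat r r" "i < r" "j < r"
  shows "(Q * Z * transpose_mat Q) $$ (i, j) = (\<Sum>k<r. \<Sum>n<r. Z $$ (k, n) * (Q $$ (i, k) * Q $$ (j, n)))"
proof -
  have "(Q * Z * transpose_mat Q) $$ (i, j) = (\<Sum>n<r. (\<Sum>k<r. Q $$ (i, k) * Z $$ (k, n)) * Q $$ (j, n))"
    using assms by (subst mult_mat_index[of _ r r _ r]) (auto simp: mult_mat_index[of Q r r] simp del: index_mult_mat(1))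
  also have "\<dots> = (\<Sum>n<r. \<Sum>k<r. Z $$ (k, n) * (Q $$ (i, k) * Q $$ (j, n)))"
    by (simp add: sum_distrib_right sum_distrib_left ac_simps)
  finally show ?thesis by (subst sum.swap)
qed

text \<open>In characteristic 2 a diagonal entry of Q S Q^T is the alternating form of S with one
  row of Q in both arguments: off-diagonal terms cancel in pairs and diagonal ones are 0.\<close>

lemma congruence_GLss:
  fixes Q S :: "'k::field mat"
  assumes Q: "Q \<in> GL r" and S: "S \<in> GLss r" and e: "e \<noteq> 0"
  shows "e \<cdot>\<^sub>m (Q * S * transpose_mat Q) \<in> GLss r"
proof -
  have SG: "S \<in> GL r" using S by (simp add: GLss_def)
  have c: "Q \<in> carrier_mat r r" "S \<in> carrier_mat r r" using Q SG by (simp_all add: GL_carrier)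
  have "Q * S * transpose_mat Q \<in> GL r" using GL_mult[OF GL_mult[OF Q SG] GL_transpose[OF Q]] .
  then have "e \<cdot>\<^sub>m (Q * S * transpose_mat Q) \<in> GL r" using e by (rule GL_smult)
  moreover have "transpose_mat (e \<cdot>\<^sub>m (Q * S * transpose_mat Q)) = e \<cdot>\<^sub>m (Q * S * transpose_mat Q)"
  proof (rule eq_matI)
    fix i j assume "i < dim_row (e \<cdot>\<^sub>m (Q * S * transpose_mat Q))" "j < dim_col (e \<cdot>\<^sub>m (Q * S * transpose_mat Q))"
    then have ij: "i < r" "j < r" using c by simp_all
    have "(Q * S * transpose_mat Q) $$ (j, i) = (Q * S * transpose_mat Q) $$ (i, j)"
      unfolding index_congruence[OF c ij] index_congruence[OF c ij(2,1)]
      by (subst sum.swap) (auto simp: GLss_symmetric[OF S] intro!: sum.cong)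
    then show "transpose_mat (e \<cdot>\<^sub>m (Q * S * transpose_mat Q)) $$ (i, j) = (e \<cdot>\<^sub>m (Q * S * transpose_mat Q)) $$ (i, j)"
      using ij c by (simp del: index_mult_mat(1))
  qed (use c in simp_all)
  moreover have "(Q * S * transpose_mat Q) $$ (i, i) = 0" if "CHAR('k) = 2" "i < r" for i
  proof -
    have "x + x = (0::'k)" for x
      using that(1) by (rule CHAR_2_add_self)
    moreover have "S $$ (k, k) = 0" if "k < r" for k using S that \<open>CHAR('k) = 2\<close> by (simp add: GLss_def)
    ultimately show ?thesis
      unfolding index_congruence[OF c that(2,2)] sum_offdiag
      by (auto simp: GLss_symmetric[OF S, of _ _] mult.commute intro!: sum.neutral)
  qed
  ultimately show ?thesis using c by (simp add: GLss_def del: index_mult_mat(1))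
qed

lemma strict_upper_carrier: "S \<in> carrier_mat r r \<Longrightarrow> strict_upper S \<in> carrier_mat r r"
  and strict_upper_index: "S \<in> carrier_mat r r \<Longrightarrow> i < r \<Longrightarrow> j < r \<Longrightarrow> strict_upper S $$ (i, j) = (if i < j then S $$ (i, j) else 0)"
  by (auto simp: strict_upper_def)

text \<open>The matrix diag(a) Z diag(a) has diagonal entries z_ii a_i^2, so \<open>Delta\<close> is
  the part of the form a Z a^T that involves the squares of the entries of a, for Z = Q U
  Q^T.\<close>

lemma Delta_eq:
  fixes a :: "'k::field poly mat"
  assumes Z: "Q * U * transpose_mat Q \<in> carrier_mat r r"
  shows "Delta r a Q U = (if CHAR('k) = 2
    then \<Sum>i<r. [:(Q * U * transpose_mat Q) $$ (i, i):] * (a $$ (0, i) * a $$ (0, i)) else 0)"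
proof -
  define Z where "Z = Q * U * transpose_mat Q"
  have Z': "Z \<in> carrier_mat r r" using assms by (simp add: Z_def)
  have "mat_diag r (\<lambda>i. a $$ (0, i)) * cmat Z * mat_diag r (\<lambda>i. a $$ (0, i))
      = mat r r (\<lambda>(i, j). a $$ (0, i) * cmat Z $$ (i, j) * a $$ (0, j))"
    using Z' by (subst mat_diag_mult_left[of _ r r], simp, subst mat_diag_mult_right[of _ r r], auto)
  then show ?thesis
    unfolding Delta_def mat_trace_def diag_mat_def Z_def[symmetric] using Z'
    by (simp add: interv_sum_list_conv_sum_set_nat lessThan_atLeast0 ac_simps)
qed

lemma smult_sum_right: "smult c (sum f I) = (\<Sum>i\<in>I. smult c (f i))"
  by (induction I rule: infinite_finite_induct) (simp_all add: smult_add_right)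

text \<open>The origin of \<open>Delta\<close>. For odd p the substitution of a Q is plain
  congruence. For p = 2 the form is given by the strictly upper part of S', and substitution leads
  to Z = Q S'_+ Q^T, in general no longer upper triangular. Its off-diagonal part depends only on
  z_ij + z_ji = e s_ij and gives e times the form of S; its diagonal part is
  \<open>Delta\<close>.\<close>

lemma quad_congruence:
  fixes a :: "'k::field poly mat"
  assumes S': "S' \<in> GLss r" and S: "S \<in> carrier_mat r r" and Q: "Q \<in> carrier_mat r r" and a: "a \<in> carrier_mat 1 r"
    and e: "Q * S' * transpose_mat Q = e \<cdot>\<^sub>m S"
  shows "quad r S' (a * cmat Q) = smult e (quad r S a) + Delta r a Q (strict_upper S')"
proof -
  have S'c: "S' \<in> carrier_mat r r" using S' by (simp add: GLss_def GL_carrier)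
  have b: "a * cmat Q \<in> carrier_mat 1 r" using a Q by simp
  have form: "(a * cmat Q * cmat Z * transpose_mat (a * cmat Q)) $$ (0, 0)
      = (\<Sum>i<r. \<Sum>j<r. [:(Q * Z * transpose_mat Q) $$ (i, j):] * (a $$ (0, i) * a $$ (0, j)))"
    if Z: "Z \<in> carrier_mat r r" for Z
  proof -
    have "a * cmat Q * cmat Z * transpose_mat (a * cmat Q) = a * cmat Q * cmat Z * (cmat (transpose_mat Q) * transpose_mat a)"
      using a Q by (subst transpose_mult[of _ 1 r]) (auto simp: map_mat_transpose)
    also have "\<dots> = a * cmat Q * cmat Z * cmat (transpose_mat Q) * transpose_mat a"
      by (rule assoc_mult_mat[symmetric, of _ 1 r _ r _ 1]) (use a Q Z in auto)
    also have "a * cmat Q * cmat Z * cmat (transpose_mat Q) = a * cmat (Q * Z * transpose_mat Q)"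
      unfolding row_cmat_assoc[OF a Q Z] row_cmat_assoc[OF a mult_carrier_mat[OF Q Z] transpose_carrier_mat[THEN iffD2, OF Q]] ..
    finally show ?thesis
      using row_form_index[OF a a, of "cmat (Q * Z * transpose_mat Q)"] Q Z
      by (simp del: index_mult_mat(1) add: index_map_mat(1)[of _ "Q * Z * transpose_mat Q"])
  qed
  show ?thesis
  proof (cases "CHAR('k) = 2")
    case False
    have "quad r S' (a * cmat Q) = smult (1 / 2) (\<Sum>i<r. \<Sum>j<r. [:e * S $$ (i, j):] * (a $$ (0, i) * a $$ (0, j)))"
      using False S by (simp add: quad_def form[OF S'c] e)
    also have "\<dots> = smult e (smult (1 / 2) (\<Sum>i<r. \<Sum>j<r. [:S $$ (i, j):] * (a $$ (0, i) * a $$ (0, j))))"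
      by (simp add: smult_sum_right ac_simps)
    finally show ?thesis
      using False S row_form_index[OF a a, of "cmat S"] by (simp add: quad_def Delta_def)
  next
    case True
    let ?U = "strict_upper S'" and ?Z = "Q * strict_upper S' * transpose_mat Q"
    have U: "?U \<in> carrier_mat r r" by (rule strict_upper_carrier[OF S'c])
    have Z: "?Z \<in> carrier_mat r r" using Q U by simp
    have "quad r S' (a * cmat Q) = (\<Sum>i<r. \<Sum>j<r. cmat ?U $$ (i, j) * ((a * cmat Q) $$ (0, i) * (a * cmat Q) $$ (0, j)))"
      unfolding sum_offdiag using True U
      by (auto simp: quad_def strict_upper_index[OF S'c] simp del: index_mult_mat(1) intro!: sum.cong)
    also have "\<dots> = (a * cmat Q * cmat ?U * transpose_mat (a * cmat Q)) $$ (0, 0)"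
      by (rule row_form_index[OF b b, symmetric]) (use U in simp)
    also have "\<dots> = (\<Sum>(i,j)\<in>{(i,j). i < j \<and> j < r}. [:?Z $$ (i, j):] * (a $$ (0, i) * a $$ (0, j)) + [:?Z $$ (j, i):] * (a $$ (0, j) * a $$ (0, i)))
        + (\<Sum>i<r. [:?Z $$ (i, i):] * (a $$ (0, i) * a $$ (0, i)))"
      unfolding form[OF U] by (rule sum_offdiag)
    also have "(\<Sum>i<r. [:?Z $$ (i, i):] * (a $$ (0, i) * a $$ (0, i))) = Delta r a Q ?U"
      unfolding Delta_eq[OF Z] using True by simp
    also have "(\<Sum>(i,j)\<in>{(i,j). i < j \<and> j < r}. [:?Z $$ (i, j):] * (a $$ (0, i) * a $$ (0, j)) + [:?Z $$ (j, i):] * (a $$ (0, j) * a $$ (0, i)))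
        = smult e (quad r S a)"
    proof -
      \<comment> \<open>S'_+ plus its transpose is S', as S' is symmetric with zero diagonal;
        congruence by Q carries this over to Z.\<close>
      have ZS: "?Z $$ (i, j) + ?Z $$ (j, i) = e * S $$ (i, j)" if ij: "i < r" "j < r" for i j
      proof -
        have d: "S' $$ (k, k) = 0" if "k < r" for k using S' True that by (simp add: GLss_def)
        have "?Z $$ (j, i) = (\<Sum>k<r. \<Sum>n<r. ?U $$ (n, k) * (Q $$ (i, k) * Q $$ (j, n)))"
          unfolding index_congruence[OF Q U ij(2,1)] by (subst sum.swap) (simp add: mult.commute)
        then have "?Z $$ (i, j) + ?Z $$ (j, i) = (\<Sum>k<r. \<Sum>n<r. (?U $$ (k, n) + ?U $$ (n, k)) * (Q $$ (i, k) * Q $$ (j, n)))"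
          unfolding index_congruence[OF Q U ij] by (simp add: sum.distrib distrib_right)
        also have "\<dots> = (\<Sum>k<r. \<Sum>n<r. S' $$ (k, n) * (Q $$ (i, k) * Q $$ (j, n)))"
        proof (intro sum.cong refl)
          fix k n assume kn: "k \<in> {..<r}" "n \<in> {..<r}"
          have "?U $$ (k, n) + ?U $$ (n, k) = S' $$ (k, n)"
            using kn GLss_symmetric[OF S', of k n] d[of k]
            by (cases k n rule: linorder_cases) (auto simp: strict_upper_index[OF S'c])
          then show "(?U $$ (k, n) + ?U $$ (n, k)) * (Q $$ (i, k) * Q $$ (j, n)) = S' $$ (k, n) * (Q $$ (i, k) * Q $$ (j, n))" by simp
        qed
        also have "\<dots> = (e \<cdot>\<^sub>m S) $$ (i, j)" unfolding e[symmetric] index_congruence[OF Q S'c ij] ..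
        finally show ?thesis using S ij by simp
      qed
      have "[:?Z $$ (i, j):] * (a $$ (0, i) * a $$ (0, j)) + [:?Z $$ (j, i):] * (a $$ (0, j) * a $$ (0, i))
          = smult e (smult (S $$ (i, j)) (a $$ (0, i) * a $$ (0, j)))" if "i < r" "j < r" for i j
      proof -
        have "[:?Z $$ (i, j):] * (a $$ (0, i) * a $$ (0, j)) + [:?Z $$ (j, i):] * (a $$ (0, j) * a $$ (0, i))
            = smult (?Z $$ (i, j) + ?Z $$ (j, i)) (a $$ (0, i) * a $$ (0, j))"
          by (simp add: smult_add_left mult.commute del: index_mult_mat(1))
        then show ?thesis unfolding ZS[OF that] by simp
      qed
      then show ?thesis using True unfolding quad_def by (auto simp: smult_sum_right intro!: sum.cong simp del: index_mult_mat(1))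
    qed
    finally show ?thesis .
  qed
qed

lemma p_poly_rows_add:
  assumes char: "CHAR('k::field) > 0" and a: "(a :: 'k poly mat) \<in> p_poly_rows r" "b \<in> p_poly_rows r"
  shows "a + b \<in> p_poly_rows r"
  using a p_polys_add[OF char] by (auto simp: p_poly_rows_def)

text \<open>Squaring is additive in characteristic 2, also on k[T,T']. This is why
  \<open>Delta\<close> can be absorbed into the last component of a datum.\<close>

lemma p_polys_square:
  assumes "CHAR('k::field) = 2" "(f :: 'k poly) \<in> p_polys" shows "f * f \<in> p_polys"
proof -
  have char: "CHAR('k) > 0" using assms by simp
  have "x + x = 0" for x :: "'k poly poly"
    using assms(1) by (intro CHAR_2_add_self) simp
  then have sq: "(x + y) * (x + y) = x * x + y * y" for x y :: "'k poly poly"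
    by (simp add: algebra_simps)
  have "in_T_plus_T' f = in_T f + in_T' f"
    using assms(2) unfolding p_polys_iff_additive[OF char] additive_poly_def by simp
  then have "in_T (f * f) + in_T' (f * f) = in_T_plus_T' (f * f)"
    by (simp add: in_T_hom.hom_mult in_T'_hom.hom_mult in_T_plus_T'_hom.hom_mult sq)
  then show ?thesis
    using p_polys_poly_0[OF char assms(2)] by (simp add: p_polys_iff_additive[OF char] additive_poly_def)
qed

lemma Delta_p_polys:
  fixes a :: "'k::field poly mat"
  assumes char: "CHAR('k) > 0" and a: "a \<in> p_poly_rows r" and Z: "Q * U * transpose_mat Q \<in> carrier_mat r r"
  shows "Delta r a Q U \<in> p_polys"
  unfolding Delta_eq[OF Z] using a
  by (auto simp: p_poly_rows_def intro!: p_polys_sum[OF char] p_polys_smult[OF char] p_polys_square simp del: index_mult_mat(1))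

subsection \<open>The group and its action\<close>

lemma det_block_triangular:
  fixes A :: "'k::field mat"
  assumes A: "A \<in> carrier_mat (a + b) (a + b)" and z: "\<And>i j. i < b \<Longrightarrow> j < a \<Longrightarrow> A $$ (a + i, j) = 0"
  shows "det A = det (sub_mat 0 a 0 a A) * det (sub_mat a b a b A)"
proof -
  have "A = four_block_mat (sub_mat 0 a 0 a A) (sub_mat 0 a a b A) (0\<^sub>m b a) (sub_mat a b a b A)"
  proof (rule eq_matI)
    fix i j assume "i < dim_row (four_block_mat (sub_mat 0 a 0 a A) (sub_mat 0 a a b A) (0\<^sub>m b a) (sub_mat a b a b A))"
      "j < dim_col (four_block_mat (sub_mat 0 a 0 a A) (sub_mat 0 a a b A) (0\<^sub>m b a) (sub_mat a b a b A))"
    then have "i < a + b" "j < a + b" by simp_all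
    then show "A $$ (i, j) = four_block_mat (sub_mat 0 a 0 a A) (sub_mat 0 a a b A) (0\<^sub>m b a) (sub_mat a b a b A) $$ (i, j)"
      using z[of "i - a" j] by auto
  qed (use A in auto)
  then show ?thesis
    by (metis det_four_block_mat_lower_left_zero sub_mat_carrier)
qed

lemma sub_mat_sub_mat:
  "o1' + n1' \<le> n1 \<Longrightarrow> o2' + n2' \<le> n2 \<Longrightarrow> sub_mat o1' n1' o2' n2' (sub_mat o1 n1 o2 n2 A) = sub_mat (o1 + o1') n1' (o2 + o2') n2' A"
  by (rule eq_matI) (auto simp: add.assoc)

lemma block_eq_sub:
  "block ns g i j = sub_mat (sum_list (take (i - 1) ns)) (ns ! (i - 1)) (sum_list (take (j - 1) ns)) (ns ! (j - 1)) g"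
  by (simp add: block_def sub_mat_def)

lemma G_blocks:
  fixes g :: "'k mat" and l r1 r2 :: nat
  defines "b \<equiv> block (G_sizes l r1 r2) g"
  shows "b 1 1 = sub_mat 0 r1 0 r1 g" "b 2 2 = sub_mat r1 r1 r1 r1 g" "b 2 3 = sub_mat r1 r1 (r1 + r1) (l - r1) g"
    "b 2 4 = sub_mat r1 r1 (r1 + r1 + (l - r1)) r2 g" "b 2 5 = sub_mat r1 r1 (r1 + r1 + (l - r1) + r2) 1 g"
    "b 3 3 = sub_mat (r1 + r1) (l - r1) (r1 + r1) (l - r1) g" "b 3 5 = sub_mat (r1 + r1) (l - r1) (r1 + r1 + (l - r1) + r2) 1 g"
    "b 4 4 = sub_mat (r1 + r1 + (l - r1)) r2 (r1 + r1 + (l - r1)) r2 g"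
    "b 4 5 = sub_mat (r1 + r1 + (l - r1)) r2 (r1 + r1 + (l - r1) + r2) 1 g"
    "b 5 5 = sub_mat (r1 + r1 + (l - r1) + r2) 1 (r1 + r1 + (l - r1) + r2) 1 g"
    "b 2 1 = sub_mat r1 r1 0 r1 g" "b 3 1 = sub_mat (r1 + r1) (l - r1) 0 r1 g" "b 4 1 = sub_mat (r1 + r1 + (l - r1)) r2 0 r1 g"
    "b 5 1 = sub_mat (r1 + r1 + (l - r1) + r2) 1 0 r1 g" "b 3 2 = sub_mat (r1 + r1) (l - r1) r1 r1 g"
    "b 4 2 = sub_mat (r1 + r1 + (l - r1)) r2 r1 r1 g" "b 5 2 = sub_mat (r1 + r1 + (l - r1) + r2) 1 r1 r1 g"
    "b 4 3 = sub_mat (r1 + r1 + (l - r1)) r2 (r1 + r1) (l - r1) g" "b 5 3 = sub_mat (r1 + r1 + (l - r1) + r2) 1 (r1 + r1) (l - r1) g"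
    "b 5 4 = sub_mat (r1 + r1 + (l - r1) + r2) 1 (r1 + r1 + (l - r1)) r2 g"
    "b 1 2 = sub_mat 0 r1 r1 r1 g" "b 1 3 = sub_mat 0 r1 (r1 + r1) (l - r1) g" "b 1 4 = sub_mat 0 r1 (r1 + r1 + (l - r1)) r2 g"
    "b 1 5 = sub_mat 0 r1 (r1 + r1 + (l - r1) + r2) 1 g" "b 3 4 = sub_mat (r1 + r1) (l - r1) (r1 + r1 + (l - r1)) r2 g"
  by (simp_all add: b_def block_eq_sub G_sizes_def numeral_nat add.assoc)

lemma G_zero_pattern_iff:
  fixes g :: "'k::field mat" and b :: "nat \<Rightarrow> nat \<Rightarrow> 'k mat" and l r1 r2 :: nat
  defines "ns \<equiv> G_sizes l r1 r2"
  shows "(\<forall>i\<in>{1..5}. \<forall>j\<in>{1..5}. i \<noteq> j \<and> (i,j) \<notin> {(2,3), (2,4), (2,5), (3,5), (4,5)}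
           \<longrightarrow> b i j = 0\<^sub>m (ns ! (i - 1)) (ns ! (j - 1))) \<longleftrightarrow>
    b 1 2 = 0\<^sub>m r1 r1 \<and> b 1 3 = 0\<^sub>m r1 (l - r1) \<and> b 1 4 = 0\<^sub>m r1 r2 \<and> b 1 5 = 0\<^sub>m r1 1 \<and>
    b 2 1 = 0\<^sub>m r1 r1 \<and> b 3 1 = 0\<^sub>m (l - r1) r1 \<and> b 3 2 = 0\<^sub>m (l - r1) r1 \<and> b 3 4 = 0\<^sub>m (l - r1) r2 \<and>
    b 4 1 = 0\<^sub>m r2 r1 \<and> b 4 2 = 0\<^sub>m r2 r1 \<and> b 4 3 = 0\<^sub>m r2 (l - r1) \<and>
    b 5 1 = 0\<^sub>m 1 r1 \<and> b 5 2 = 0\<^sub>m 1 r1 \<and> b 5 3 = 0\<^sub>m 1 (l - r1) \<and> b 5 4 = 0\<^sub>m 1 r2"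
proof -
  have *: "{1..5} = {1, 2, 3, 4, 5::nat}" by auto
  show ?thesis unfolding * ns_def by (simp add: G_sizes_def numeral_nat conj_ac)
qed

text \<open>The vanishing blocks make g block upper triangular, so the diagonal blocks split off one
  at a time from the upper left.\<close>

lemma G_det:
  fixes g :: "'k::field mat" and l r1 r2 :: nat
  assumes "r1 \<le> l" and g: "g \<in> carrier_mat (l + r1 + r2 + 1) (l + r1 + r2 + 1)"
  defines "b \<equiv> block (G_sizes l r1 r2) g"
  assumes z: "b 2 1 = 0\<^sub>m r1 r1" "b 3 1 = 0\<^sub>m (l - r1) r1" "b 3 2 = 0\<^sub>m (l - r1) r1"
    "b 4 1 = 0\<^sub>m r2 r1" "b 4 2 = 0\<^sub>m r2 r1" "b 4 3 = 0\<^sub>m r2 (l - r1)"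
    "b 5 1 = 0\<^sub>m 1 r1" "b 5 2 = 0\<^sub>m 1 r1" "b 5 3 = 0\<^sub>m 1 (l - r1)" "b 5 4 = 0\<^sub>m 1 r2"
  shows "det g = det (b 1 1) * (det (b 2 2) * (det (b 3 3) * (det (b 4 4) * det (b 5 5))))"
proof -
  define s where "s = l - r1"
  have N: "l + r1 + r2 + 1 = r1 + (r1 + (s + (r2 + 1)))" using assms(1) by (simp add: s_def)
  note blocks = G_blocks[of l r1 r2 g, folded b_def s_def]
  have e: "g $$ (p + i, q + j) = 0" if "sub_mat p n q n' g = 0\<^sub>m n n'" "i < n" "j < n'" for p q n n' i j
    using arg_cong[OF that(1), of "\<lambda>M. M $$ (i, j)"] that(2,3) by simp
  note ez = z[folded s_def, unfolded blocks]
  have c1: "g $$ (r1 + i, j) = 0" if "i < r1 + (s + (r2 + 1))" "j < r1" for i j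
  proof -
    have "i < r1 \<or> (r1 \<le> i \<and> i - r1 < s) \<or> (r1 + s \<le> i \<and> i - (r1 + s) < r2) \<or> i = r1 + s + r2"
      using that(1) by arith
    then show ?thesis
      using e[OF ez(1), of i j] e[OF ez(2), of "i - r1" j] e[OF ez(4), of "i - (r1 + s)" j] e[OF ez(7), of 0 j] that
      by (elim disjE conjE) (simp_all add: add.assoc)
  qed
  have c2: "g $$ (r1 + (r1 + i), r1 + j) = 0" if "i < s + (r2 + 1)" "j < r1" for i j
  proof -
    have "i < s \<or> (s \<le> i \<and> i - s < r2) \<or> i = s + r2"
      using that(1) by arith
    then show ?thesis
      using e[OF ez(3), of i j] e[OF ez(5), of "i - s" j] e[OF ez(8), of 0 j] that
      by (elim disjE conjE) (simp_all add: add.assoc)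
  qed
  have c3: "g $$ (r1 + (r1 + (s + i)), r1 + (r1 + j)) = 0" if "i < r2 + 1" "j < s" for i j
  proof -
    have "i < r2 \<or> i = r2" using that(1) by arith
    then show ?thesis
      using e[OF ez(6), of i j] e[OF ez(9), of 0 j] that by (elim disjE) (simp_all add: add.assoc)
  qed
  have c4: "g $$ (r1 + (r1 + (s + r2)), r1 + (r1 + (s + j))) = 0" if "j < r2" for j
    using e[OF ez(10), of 0 j] that by (simp add: add.assoc)
  let ?n1 = "r1 + (s + (r2 + 1))" and ?n2 = "s + (r2 + 1)"
  have "det g = det (sub_mat 0 r1 0 r1 g) * det (sub_mat r1 ?n1 r1 ?n1 g)"
    by (rule det_block_triangular[OF g[unfolded N] c1])
  also have "det (sub_mat r1 ?n1 r1 ?n1 g) = det (sub_mat r1 r1 r1 r1 g) * det (sub_mat (r1 + r1) ?n2 (r1 + r1) ?n2 g)"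
    by (subst det_block_triangular[of _ r1 ?n2]) (simp_all add: c2 sub_mat_sub_mat)
  also have "det (sub_mat (r1 + r1) ?n2 (r1 + r1) ?n2 g)
      = det (sub_mat (r1 + r1) s (r1 + r1) s g) * det (sub_mat (r1 + r1 + s) (r2 + 1) (r1 + r1 + s) (r2 + 1) g)"
    by (subst det_block_triangular[of _ s "r2 + 1"]) (simp_all add: c3[unfolded One_nat_def] add.assoc sub_mat_sub_mat)
  also have "det (sub_mat (r1 + r1 + s) (r2 + 1) (r1 + r1 + s) (r2 + 1) g)
      = det (sub_mat (r1 + r1 + s) r2 (r1 + r1 + s) r2 g) * det (sub_mat (r1 + r1 + s + r2) 1 (r1 + r1 + s + r2) 1 g)"
    by (subst det_block_triangular[of _ r2 1]) (simp_all add: c4 add.assoc sub_mat_sub_mat)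
  finally show ?thesis unfolding blocks by simp
qed

lemma det_1: "A \<in> carrier_mat 1 1 \<Longrightarrow> det A = A $$ (0, 0)"
  by (rule det_single)

lemma G_set_GL:
  fixes g :: "'k::field mat" and l r1 r2 :: nat
  assumes l: "r1 \<le> l" and g: "g \<in> G_set l r1 r2"
  defines "b \<equiv> block (G_sizes l r1 r2) g"
  shows "b 1 1 \<in> GL r1" "b 2 2 \<in> GL r1" "b 3 3 \<in> GL (l - r1)" "b 4 4 \<in> GL r2" "b 5 5 $$ (0, 0) \<noteq> 0"
    "b 1 1 * transpose_mat (b 2 2) = b 5 5 $$ (0, 0) \<cdot>\<^sub>m 1\<^sub>m r1"
proof -
  have *: "g \<in> GL (l + r1 + r2 + 1)" and z: "b 2 1 = 0\<^sub>m r1 r1" "b 3 1 = 0\<^sub>m (l - r1) r1" "b 3 2 = 0\<^sub>m (l - r1) r1"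
    "b 4 1 = 0\<^sub>m r2 r1" "b 4 2 = 0\<^sub>m r2 r1" "b 4 3 = 0\<^sub>m r2 (l - r1)"
    "b 5 1 = 0\<^sub>m 1 r1" "b 5 2 = 0\<^sub>m 1 r1" "b 5 3 = 0\<^sub>m 1 (l - r1)" "b 5 4 = 0\<^sub>m 1 r2"
    and 1: "b 1 1 * transpose_mat (b 2 2) = b 5 5 $$ (0, 0) \<cdot>\<^sub>m 1\<^sub>m r1"
    using g unfolding G_set_def Let_def mem_Collect_eq G_zero_pattern_iff b_def by blast+
  have "det g \<noteq> 0" using * by (simp add: GL_iff_det)
  then have d: "det (b 1 1) * (det (b 2 2) * (det (b 3 3) * (det (b 4 4) * det (b 5 5)))) \<noteq> 0"
    using G_det[OF l GL_carrier[OF *] z[unfolded b_def]] by (simp add: b_def)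
  show "b 1 1 \<in> GL r1" "b 2 2 \<in> GL r1" "b 3 3 \<in> GL (l - r1)" "b 4 4 \<in> GL r2" "b 5 5 $$ (0, 0) \<noteq> 0"
    using d unfolding GL_iff_det b_def G_blocks by (auto simp: det_1)
  show "b 1 1 * transpose_mat (b 2 2) = b 5 5 $$ (0, 0) \<cdot>\<^sub>m 1\<^sub>m r1" by (rule 1)
qed

lemma G_set_exists:
  fixes Q :: "'k::field mat"
  assumes l: "r1 \<le> l" and GL: "G11 \<in> GL r1" "G22 \<in> GL r1" "G33 \<in> GL (l - r1)" "G44 \<in> GL r2" "e \<noteq> 0"
    and c: "G23 \<in> carrier_mat r1 (l - r1)" "G24 \<in> carrier_mat r1 r2" "G25 \<in> carrier_mat r1 1" "G35 \<in> carrier_mat (l - r1) 1" "G45 \<in> carrier_mat r2 1"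
    and rel: "G11 * transpose_mat G22 = e \<cdot>\<^sub>m 1\<^sub>m r1"
  obtains g where "g \<in> G_set l r1 r2" "block (G_sizes l r1 r2) g 1 1 = G11" "block (G_sizes l r1 r2) g 2 2 = G22"
    "block (G_sizes l r1 r2) g 2 3 = G23" "block (G_sizes l r1 r2) g 2 4 = G24" "block (G_sizes l r1 r2) g 2 5 = G25"
    "block (G_sizes l r1 r2) g 3 3 = G33" "block (G_sizes l r1 r2) g 3 5 = G35" "block (G_sizes l r1 r2) g 4 4 = G44"
    "block (G_sizes l r1 r2) g 4 5 = G45" "block (G_sizes l r1 r2) g 5 5 $$ (0, 0) = e"
proof -
  define s where "s = l - r1"
  define N where "N = r1 + r1 + s + r2 + 1"
  define g where "g = mat N N (\<lambda>(i, j).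
    if i < r1 then (if j < r1 then G11 $$ (i, j) else 0)
    else if i < r1 + r1 then (if j < r1 then 0 else if j < r1 + r1 then G22 $$ (i - r1, j - r1)
      else if j < r1 + r1 + s then G23 $$ (i - r1, j - (r1 + r1))
      else if j < r1 + r1 + s + r2 then G24 $$ (i - r1, j - (r1 + r1 + s)) else G25 $$ (i - r1, 0))
    else if i < r1 + r1 + s then (if j < r1 + r1 then 0 else if j < r1 + r1 + s then G33 $$ (i - (r1 + r1), j - (r1 + r1))
      else if j < r1 + r1 + s + r2 then 0 else G35 $$ (i - (r1 + r1), 0))
    else if i < r1 + r1 + s + r2 then (if j < r1 + r1 + s then 0
      else if j < r1 + r1 + s + r2 then G44 $$ (i - (r1 + r1 + s), j - (r1 + r1 + s)) else G45 $$ (i - (r1 + r1 + s), 0))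
    else (if j < r1 + r1 + s + r2 then 0 else e))"
  have N: "l + r1 + r2 + 1 = N" using l by (simp add: s_def N_def)
  have g: "g \<in> carrier_mat (l + r1 + r2 + 1) (l + r1 + r2 + 1)" unfolding N by (simp add: g_def)
  note GLc = GL(1-4)[THEN GL_carrier, folded s_def] c[folded s_def]
  let ?b = "block (G_sizes l r1 r2) g"
  note blocks = G_blocks[of l r1 r2 g, folded s_def]
  have b: "?b 1 1 = G11" "?b 2 2 = G22" "?b 2 3 = G23" "?b 2 4 = G24" "?b 2 5 = G25" "?b 3 3 = G33" "?b 3 5 = G35"
    "?b 4 4 = G44" "?b 4 5 = G45"
    unfolding blocks by (rule eq_matI; use GLc in \<open>simp add: g_def N_def\<close>)+
  have b5: "?b 5 5 $$ (0, 0) = e" unfolding blocks by (simp add: g_def N_def)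
  have z: "?b 1 2 = 0\<^sub>m r1 r1 \<and> ?b 1 3 = 0\<^sub>m r1 (l - r1) \<and> ?b 1 4 = 0\<^sub>m r1 r2 \<and> ?b 1 5 = 0\<^sub>m r1 1 \<and>
    ?b 2 1 = 0\<^sub>m r1 r1 \<and> ?b 3 1 = 0\<^sub>m (l - r1) r1 \<and> ?b 3 2 = 0\<^sub>m (l - r1) r1 \<and> ?b 3 4 = 0\<^sub>m (l - r1) r2 \<and>
    ?b 4 1 = 0\<^sub>m r2 r1 \<and> ?b 4 2 = 0\<^sub>m r2 r1 \<and> ?b 4 3 = 0\<^sub>m r2 (l - r1) \<and>
    ?b 5 1 = 0\<^sub>m 1 r1 \<and> ?b 5 2 = 0\<^sub>m 1 r1 \<and> ?b 5 3 = 0\<^sub>m 1 (l - r1) \<and> ?b 5 4 = 0\<^sub>m 1 r2"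
    unfolding blocks s_def[symmetric] by (intro conjI; rule eq_matI; simp add: g_def N_def)
  have "det g = det (?b 1 1) * (det (?b 2 2) * (det (?b 3 3) * (det (?b 4 4) * det (?b 5 5))))"
    by (rule G_det[OF l g]) (use z in blast)+
  also have "det (?b 5 5) = e" unfolding b5[symmetric] by (rule det_1) (simp add: blocks)
  finally have "det g \<noteq> 0" using GL unfolding b by (simp add: GL_iff_det)
  then have "g \<in> GL (l + r1 + r2 + 1)" using g by (simp add: GL_iff_det)
  then have "g \<in> G_set l r1 r2"
    unfolding G_set_def Let_def mem_Collect_eq G_zero_pattern_iff using z rel b b5 by simp
  then show ?thesis using b b5 by (rule that)
qed

text \<open>Membership: S' is congruent to S up to the factor e, the rows are transformed by
  invertible block triangular matrices, and \<open>Delta\<close> is a p-polynomial. Equivalence: a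
  conjugating matrix is found by solving the conditions of \<open>h_equiv_backward\<close> for its
  blocks, where \<open>Q\<close>, \<open>G23\<close>, \<open>G33\<close>, \<open>G35\<close> and
  \<open>e\<close> can be taken over unchanged.\<close>

lemma star_in_X_set:
  fixes x :: "'k::field datum"
  assumes char: "CHAR('k) > 0" and om: "(l, r1, r2) \<in> Omega m"
    and x: "x \<in> X_set l r1 r2" and g: "g \<in> G_set l r1 r2"
  shows "star l r1 r2 x g \<in> X_set l r1 r2 \<and> pmat_equiv (m + 2) (hbar m l r1 r2 x) (hbar m l r1 r2 (star l r1 r2 x g))"
proof -
  have dim: "r1 \<le> l" "l + r2 \<le> m" using om by (auto simp: Omega_def)
  obtain S a1 a2 \<alpha>2 \<alpha> where x_eq: "x = (S, a1, a2, \<alpha>2, \<alpha>)" by (cases x)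
  note X = X_setD[OF x[unfolded x_eq]]
  note a = X(10,11,12)
  let ?b = "block (G_sizes l r1 r2) g"
  define G11 Q G23 G24 G25 G33 G35 G44 G45 e where G: "G11 = ?b 1 1" "Q = ?b 2 2" "G23 = ?b 2 3" "G24 = ?b 2 4" "G25 = ?b 2 5"
    "G33 = ?b 3 3" "G35 = ?b 3 5" "G44 = ?b 4 4" "G45 = ?b 4 5" "e = ?b 5 5 $$ (0, 0)"
  have GL: "G11 \<in> GL r1" "Q \<in> GL r1" "G33 \<in> GL (l - r1)" "G44 \<in> GL r2" "e \<noteq> 0"
    and rel: "G11 * transpose_mat Q = e \<cdot>\<^sub>m 1\<^sub>m r1"
    unfolding G by (rule G_set_GL[OF dim(1) g])+
  note c = GL(1-4)[THEN GL_carrier]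
  have c': "G23 \<in> carrier_mat r1 (l - r1)" "G24 \<in> carrier_mat r1 r2" "G25 \<in> carrier_mat r1 1" "G35 \<in> carrier_mat (l - r1) 1" "G45 \<in> carrier_mat r2 1"
    unfolding G G_blocks by simp_all
  define S' b1 b2 \<beta>2 \<beta> where y: "S' = mat_inv r1 Q * S * G11" "b1 = a1 * cmat Q" "b2 = a1 * cmat G23 + a2 * cmat G33"
    "\<beta>2 = a1 * cmat G24 + \<alpha>2 * cmat G44"
    "\<beta> = (a1 * cmat G25 + a2 * cmat G35 + \<alpha>2 * cmat G45) $$ (0,0) + smult e \<alpha> - Delta r1 a1 Q (strict_upper S')"
  have star: "star l r1 r2 x g = (S', b1, b2, \<beta>2, \<beta>)"
    by (simp only: x_eq star_def Let_def prod.case y G)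
  have Qi: "mat_inv r1 Q \<in> carrier_mat r1 r1" "mat_inv r1 Q \<in> GL r1" using GL(2) by (simp_all add: mat_inv_carrier mat_inv_GL)
  have S'c: "S' \<in> carrier_mat r1 r1" using Qi c X(9) by (simp add: y)
  \<comment> \<open>The relation between g11 and g22 turns S' = Q^(-1) S g11 into a congruence:
    multiplication by Q on the left and by its transpose on the right gives e S.\<close>
  have QS'Q: "Q * S' * transpose_mat Q = e \<cdot>\<^sub>m S"
  proof -
    have "Q * S' * transpose_mat Q = (Q * mat_inv r1 Q) * S * (G11 * transpose_mat Q)"
      unfolding y using c X(9) Qi by (simp add: assoc_mult_mat[of _ r1 r1 _ r1 _ r1])
    also have "\<dots> = e \<cdot>\<^sub>m S"
      unfolding rel mat_inv_right[OF GL(2)] using X(9) mult_smult_distrib[OF X(9) one_carrier_mat] by simp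
    finally show ?thesis .
  qed
  have S': "S' \<in> GLss r1"
  proof -
    note QT = GL_transpose[OF GL(2)]
    have Qi': "mat_inv r1 (transpose_mat Q) = transpose_mat (mat_inv r1 Q)"
    proof -
      have "transpose_mat Q * transpose_mat (mat_inv r1 Q) = 1\<^sub>m r1"
        using transpose_mult[OF Qi(1) c(2)] mat_inv_left[OF GL(2)] by simp
      then have "mat_inv r1 (transpose_mat Q) * (transpose_mat Q * transpose_mat (mat_inv r1 Q)) = mat_inv r1 (transpose_mat Q)"
        using mat_inv_carrier[OF QT] by simp
      moreover have "mat_inv r1 (transpose_mat Q) * (transpose_mat Q * transpose_mat (mat_inv r1 Q)) = transpose_mat (mat_inv r1 Q)"
        using assoc_mult_mat[OF mat_inv_carrier[OF QT] GL_carrier[OF QT] transpose_carrier_mat[THEN iffD2, OF Qi(1)]]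
          mat_inv_left[OF QT] Qi(1) by simp
      ultimately show ?thesis by simp
    qed
    have "S' = mat_inv r1 Q * (e \<cdot>\<^sub>m S) * mat_inv r1 (transpose_mat Q)"
      using congruence_cancel[OF GL(2) S'c] by (simp add: QS'Q)
    also have "\<dots> = e \<cdot>\<^sub>m (mat_inv r1 Q * S * transpose_mat (mat_inv r1 Q))"
      unfolding Qi' mult_smult_distrib[OF Qi(1) X(9)]
      by (rule mult_smult_assoc_mat[of _ r1 r1]) (use Qi(1) X(9) in auto)
    finally show ?thesis using congruence_GLss[OF Qi(2) X(1) GL(5)] by simp
  qed
  have U: "Q * strict_upper S' * transpose_mat Q \<in> carrier_mat r1 r1"
    using c strict_upper_carrier[OF S'c] by simp
  have cy: "b1 \<in> carrier_mat 1 r1" "b2 \<in> carrier_mat 1 (l - r1)" "\<beta>2 \<in> carrier_mat 1 r2" "b1 * cmat S' \<in> carrier_mat 1 r1"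
    using a c c' S'c by (simp_all add: y)
  have lin: "a1 * cmat G25 + a2 * cmat G35 + \<alpha>2 * cmat G45 \<in> p_poly_rows 1"
    by (intro p_poly_rows_add[OF char] p_poly_rows_mult[OF char]) (use X c' in auto)
  have "\<beta> \<in> p_polys"
  proof -
    have "(a1 * cmat G25 + a2 * cmat G35 + \<alpha>2 * cmat G45) $$ (0,0) + smult e \<alpha> + smult (-1) (Delta r1 a1 Q (strict_upper S')) \<in> p_polys"
      by (intro p_polys_add[OF char] p_polys_smult[OF char] Delta_p_polys[OF char X(2) U] X(5))
        (use lin in \<open>simp add: p_poly_rows_def del: index_add_mat(1) index_mult_mat(1)\<close>)
    then show ?thesis by (simp add: y)
  qed
  then have yX: "(S', b1, b2, \<beta>2, \<beta>) \<in> X_set l r1 r2"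
    unfolding X_set_def using S' X c c' row_lin_indep_transform[OF a(1,2) X(6) GL(2,3) c'(1)]
      row_lin_indep_transform[OF a(1,3) X(7) GL(2,4) c'(2)]
    by (auto simp: y intro!: p_poly_rows_add[OF char] p_poly_rows_mult[OF char])
  note Y = X_setD[OF yX]
  have W: "Q * S' \<in> GL r1" using GL(2) Y(8) by (rule GL_mult)
  define K where "K = G24 * mat_inv r2 G44"
  have Ki: "mat_inv r2 G44 \<in> carrier_mat r2 r2" "mat_inv r2 G44 \<in> GL r2" using GL(4) by (simp_all add: mat_inv_carrier mat_inv_GL)
  have K: "K \<in> carrier_mat r1 r2" using c' Ki by (simp add: K_def)
  \<comment> \<open>In e \<alpha>2 = b1 S' L + \<beta>2 M put b1 S' = a1 (Q S') and \<beta>2 = a1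
    g24 + \<alpha>2 g44. The \<alpha>2 terms match for M = e g44^(-1), and the a1 terms then cancel
    for this L; Q S' is invertible.\<close>
  define L where "L = - e \<cdot>\<^sub>m (mat_inv r1 (Q * S') * K)"
  have L: "L \<in> carrier_mat r1 r2" using K mat_inv_carrier[OF W] by (simp add: L_def)
  let ?M = "e \<cdot>\<^sub>m mat_inv r2 G44"
  have M: "?M \<in> GL r2" using Ki(2) GL(5) by (rule GL_smult)
  have k: "a1 * cmat G24 \<in> carrier_mat 1 r2" "\<alpha>2 * cmat G44 \<in> carrier_mat 1 r2" using a c c' by simp_all
  have b1S': "b1 * cmat S' = a1 * cmat (Q * S')" unfolding y(2) by (rule row_cmat_assoc[OF a(1) c(2) S'c])
  have Wc: "Q * S' \<in> carrier_mat r1 r1" using W by (rule GL_carrier)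
  have "pmat_equiv (m + 2) (h_mat m l r1 r2 a1 a2 (a1 * cmat S) \<alpha>2 (\<alpha> + quad r1 S a1))
      (h_mat m l r1 r2 b1 b2 (b1 * cmat S') \<beta>2 (\<beta> + quad r1 S' b1))"
  proof (rule h_equiv_backward[OF dim a(1,2) X(13) a(3) cy(1,2,4,3) GL(2) c'(1) GL(3) L M GL(5) _ c'(4) zero_carrier_mat _ y(2,3)])
    show "[:e:] \<cdot>\<^sub>m (a1 * cmat S) = b1 * cmat S' * cmat (transpose_mat Q)"
      unfolding b1S' row_cmat_assoc[OF a(1) Wc transpose_carrier_mat[THEN iffD2, OF c(2)]] QS'Q
        row_cmat_smult[OF a(1) X(9)] ..
    show "[:e:] \<cdot>\<^sub>m \<alpha>2 = b1 * cmat S' * cmat L + \<beta>2 * cmat ?M"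
    proof -
      have WL: "Q * S' * L = - e \<cdot>\<^sub>m K"
        unfolding L_def mult_smult_distrib[OF Wc mult_carrier_mat[OF mat_inv_carrier[OF W] K]]
          assoc_mult_mat[OF Wc mat_inv_carrier[OF W] K, symmetric] mat_inv_right[OF W] using K by simp
      have "b1 * cmat S' * cmat L = [:- e:] \<cdot>\<^sub>m (a1 * cmat K)"
        unfolding b1S' row_cmat_assoc[OF a(1) Wc L] WL row_cmat_smult[OF a(1) K] ..
      moreover have "\<beta>2 * cmat ?M = a1 * cmat (G24 * ?M) + \<alpha>2 * cmat (G44 * ?M)"
        unfolding y(4) add_row_cmat[OF k GL_carrier[OF M]] row_cmat_assoc[OF a(1) c'(2) GL_carrier[OF M]]
          row_cmat_assoc[OF a(3) c(4) GL_carrier[OF M]] ..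
      moreover have "G24 * ?M = e \<cdot>\<^sub>m K" unfolding K_def by (rule mult_smult_distrib[OF c'(2) Ki(1)])
      moreover have "G44 * ?M = e \<cdot>\<^sub>m 1\<^sub>m r2"
        unfolding mult_smult_distrib[OF c(4) Ki(1)] mat_inv_right[OF GL(4)] ..
      ultimately have "b1 * cmat S' * cmat L + \<beta>2 * cmat ?M
          = [:- e:] \<cdot>\<^sub>m (a1 * cmat K) + ([:e:] \<cdot>\<^sub>m (a1 * cmat K) + [:e:] \<cdot>\<^sub>m \<alpha>2)"
        using row_cmat_smult[OF a(1) K] row_cmat_smult[OF a(3) one_carrier_mat] row_cmat_one[OF a(3)] by simp
      also have "\<dots> = [:e:] \<cdot>\<^sub>m \<alpha>2"
        by (rule eq_matI) (use a K in \<open>simp_all del: index_mult_mat(1)\<close>)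
      finally show ?thesis by simp
    qed
    \<comment> \<open>With this choice \<alpha>2 g44 w2 cancels \<alpha>2 g45 in the corner
      equation. What \<beta>2 w2 contributes through a1 goes into u = g25 + g24 w2, and w1 is
      0.\<close>
    let ?w2 = "- 1 \<cdot>\<^sub>m (mat_inv r2 G44 * G45)"
    show w2: "?w2 \<in> carrier_mat r2 1" using Ki c' by simp
    show "G25 + G24 * ?w2 \<in> carrier_mat r1 1" using c' Ki by simp
    show "smult e (\<alpha> + quad r1 S a1) + (a1 * cmat (G25 + G24 * ?w2) + a2 * cmat G35) $$ (0, 0)
        = \<beta> + quad r1 S' b1 + (b1 * cmat S' * cmat (0\<^sub>m r1 1) + \<beta>2 * cmat ?w2) $$ (0, 0)"
    proof -
      have 44: "G44 * ?w2 = - 1 \<cdot>\<^sub>m G45"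
        unfolding mult_smult_distrib[OF c(4) mult_carrier_mat[OF Ki(1) c'(5)]]
          assoc_mult_mat[OF c(4) Ki(1) c'(5), symmetric] mat_inv_right[OF GL(4)] using c' by simp
      have "\<beta>2 * cmat ?w2 = a1 * cmat (G24 * ?w2) + \<alpha>2 * cmat (G44 * ?w2)"
        unfolding y(4) add_row_cmat[OF k w2]
          row_cmat_assoc[OF a(1) c'(2) w2] row_cmat_assoc[OF a(3) c(4) w2] ..
      also have "\<alpha>2 * cmat (G44 * ?w2) = [:- 1:] \<cdot>\<^sub>m (\<alpha>2 * cmat G45)"
        unfolding 44 by (rule row_cmat_smult[OF a(3) c'(5)])
      finally have 1: "(\<beta>2 * cmat ?w2) $$ (0, 0) = (a1 * cmat (G24 * ?w2)) $$ (0, 0) - (\<alpha>2 * cmat G45) $$ (0, 0)"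
        using a c' by (simp del: index_mult_mat(1))
      have G24w: "G24 * ?w2 \<in> carrier_mat r1 1" using c' w2 by simp
      have 2: "(a1 * cmat (G25 + G24 * ?w2)) $$ (0, 0) = (a1 * cmat G25) $$ (0, 0) + (a1 * cmat (G24 * ?w2)) $$ (0, 0)"
        unfolding row_cmat_add[OF a(1) c'(3) G24w] using a c' G24w by (simp del: index_mult_mat(1))
      have 3: "b1 * cmat S' * cmat (0\<^sub>m r1 1) = 0\<^sub>m 1 1" unfolding cmat_zero by (rule right_mult_zero_mat[OF cy(4)])
      show ?thesis
        unfolding 3 quad_congruence[OF S' X(9) c(2) a(1) QS'Q, folded y(2)] y(5)
        using a c' cy w2 by (simp add: 1 2 smult_add_right del: index_mult_mat(1))
    qed
  qed
  then show ?thesis using yX unfolding star unfolding x_eq hbar_eq by simp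
qed

text \<open>The equations for a conjugating matrix are now solved for the blocks of g. Writing b1 S'
  = a1 (Q S') and inserting the resulting formula for \<beta>2 into the corner equation leaves
  \<beta>2 and \<beta> expressed through a1, a2, \<alpha>2, \<alpha> and
  \<open>Delta\<close>.\<close>

lemma equiv_imp_star:
  fixes x y :: "'k::field datum"
  assumes char: "CHAR('k) > 0" and om: "(l, r1, r2) \<in> Omega m"
    and x: "x \<in> X_set l r1 r2" and y: "y \<in> X_set l r1 r2"
    and eq: "pmat_equiv (m + 2) (hbar m l r1 r2 x) (hbar m l r1 r2 y)"
  shows "\<exists>g\<in>G_set l r1 r2. star l r1 r2 x g = y"
proof -
  have dim: "1 \<le> r1" "r1 \<le> l" "l + r2 \<le> m" using om by (auto simp: Omega_def)
  obtain S a1 a2 \<alpha>2 \<alpha> where x_eq: "x = (S, a1, a2, \<alpha>2, \<alpha>)" by (cases x)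
  obtain S' b1 b2 \<beta>2 \<beta> where y_eq: "y = (S', b1, b2, \<beta>2, \<beta>)" by (cases y)
  note X = X_setD[OF x[unfolded x_eq]] and Y = X_setD[OF y[unfolded y_eq]]
  note a = X(10,11,12) and b = Y(10,11,12)
  obtain Q Q12 Q22 L M u v w1 w2 d where
    c: "Q \<in> GL r1" "Q12 \<in> carrier_mat r1 (l - r1)" "Q22 \<in> GL (l - r1)" "L \<in> carrier_mat r1 r2" "M \<in> GL r2" "d \<noteq> (0 :: 'k)"
    "u \<in> carrier_mat r1 1" "v \<in> carrier_mat (l - r1) 1" "w1 \<in> carrier_mat r1 1" "w2 \<in> carrier_mat r2 1"
    and e1: "b1 = a1 * cmat Q" and e2: "b2 = a1 * cmat Q12 + a2 * cmat Q22"
    and e3: "[:d:] \<cdot>\<^sub>m (a1 * cmat S) = b1 * cmat S' * cmat (transpose_mat Q)"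
    and e4: "[:d:] \<cdot>\<^sub>m \<alpha>2 = b1 * cmat S' * cmat L + \<beta>2 * cmat M"
    and e5: "smult d (\<alpha> + quad r1 S a1) + (a1 * cmat u + a2 * cmat v) $$ (0, 0)
      = \<beta> + quad r1 S' b1 + (b1 * cmat S' * cmat w1 + \<beta>2 * cmat w2) $$ (0, 0)"
    by (rule h_equiv_forward[OF dim a(1,2) X(13) a(3) b(1,2) Y(13) b(3) X(6,14) Y(6,14) eq[unfolded x_eq y_eq hbar_eq]])
  note QT = GL_transpose[OF c(1)]
  have cc: "Q \<in> carrier_mat r1 r1" "M \<in> carrier_mat r2 r2" "transpose_mat Q \<in> carrier_mat r1 r1"
    "mat_inv r1 (transpose_mat Q) \<in> carrier_mat r1 r1" "mat_inv r2 M \<in> carrier_mat r2 r2" "mat_inv r1 Q \<in> carrier_mat r1 r1"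
    using c QT by (simp_all add: GL_carrier mat_inv_carrier)
  have Wc: "Q * S' \<in> carrier_mat r1 r1" using cc Y(9) by simp
  have b1S': "b1 * cmat S' = a1 * cmat (Q * S')" unfolding e1 by (rule row_cmat_assoc[OF a(1) cc(1) Y(9)])
  have QS'Q: "Q * S' * transpose_mat Q = d \<cdot>\<^sub>m S"
  proof (rule row_lin_indep_cancel[OF a(1) row_lin_indep_append_left[OF a(1,2) X(6)] mult_carrier_mat[OF Wc cc(3)] smult_carrier_mat[OF X(9)]])
    show "a1 * cmat (Q * S' * transpose_mat Q) = a1 * cmat (d \<cdot>\<^sub>m S)"
      using e3 unfolding b1S' row_cmat_assoc[OF a(1) Wc cc(3)] row_cmat_smult[OF a(1) X(9)] by simp
  qed
  \<comment> \<open>Solving d \<alpha>2 = a1 (Q S') L + \<beta>2 M for \<beta>2 gives g24 and g44;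
    g11 is dictated by g11 g22^T = d I.\<close>
  let ?G11 = "d \<cdot>\<^sub>m mat_inv r1 (transpose_mat Q)" and ?G44 = "d \<cdot>\<^sub>m mat_inv r2 M"
    and ?G24 = "- 1 \<cdot>\<^sub>m (Q * S' * (L * mat_inv r2 M))"
  have LM: "L * mat_inv r2 M \<in> carrier_mat r1 r2" using c cc by simp
  have G24: "?G24 \<in> carrier_mat r1 r2" using Wc LM by simp
  have G44: "?G44 \<in> carrier_mat r2 r2" using cc by simp
  \<comment> \<open>Solving the corner equation for \<beta>, with \<beta>2 w2 expanded as a1 g24 w2
    + \<alpha>2 g44 w2, gives these two blocks of the last column of g.\<close>
  let ?G25 = "u + - 1 \<cdot>\<^sub>m (Q * S' * w1 + ?G24 * w2)" and ?G45 = "- 1 \<cdot>\<^sub>m (?G44 * w2)"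
  have G25: "?G25 \<in> carrier_mat r1 1" and G45: "?G45 \<in> carrier_mat r2 1" using Wc G24 G44 c by simp_all
  have "?G11 \<in> GL r1" "?G44 \<in> GL r2" using c QT by (simp_all add: GL_smult mat_inv_GL)
  moreover have "?G11 * transpose_mat Q = d \<cdot>\<^sub>m 1\<^sub>m r1"
    unfolding mult_smult_assoc_mat[OF cc(4,3)] mat_inv_left[OF QT] ..
  ultimately obtain g where g: "g \<in> G_set l r1 r2" and
    blk: "block (G_sizes l r1 r2) g 1 1 = ?G11" "block (G_sizes l r1 r2) g 2 2 = Q"
    "block (G_sizes l r1 r2) g 2 3 = Q12" "block (G_sizes l r1 r2) g 2 4 = ?G24" "block (G_sizes l r1 r2) g 2 5 = ?G25"
    "block (G_sizes l r1 r2) g 3 3 = Q22" "block (G_sizes l r1 r2) g 3 5 = v" "block (G_sizes l r1 r2) g 4 4 = ?G44"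
    "block (G_sizes l r1 r2) g 4 5 = ?G45" "block (G_sizes l r1 r2) g 5 5 $$ (0, 0) = d"
    by (rule G_set_exists[OF dim(2) _ c(1,3) _ c(6,2) G24 G25 c(8) G45])
  have 1: "mat_inv r1 Q * S * ?G11 = S'"
  proof -
    have "mat_inv r1 Q * S * ?G11 = mat_inv r1 Q * (d \<cdot>\<^sub>m S) * mat_inv r1 (transpose_mat Q)"
      unfolding mult_smult_distrib[OF mult_carrier_mat[OF cc(6) X(9)] cc(4)] mult_smult_distrib[OF cc(6) X(9)]
        mult_smult_assoc_mat[OF mult_carrier_mat[OF cc(6) X(9)] cc(4)] ..
    then show ?thesis using congruence_cancel[OF c(1) Y(9)] by (simp add: QS'Q)
  qed
  have 2: "a1 * cmat ?G24 + \<alpha>2 * cmat ?G44 = \<beta>2"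
  proof -
    have "([:d:] \<cdot>\<^sub>m \<alpha>2) * cmat (mat_inv r2 M) = b1 * cmat S' * cmat (L * mat_inv r2 M) + \<beta>2"
    proof -
      have k: "b1 * cmat S' * cmat L \<in> carrier_mat 1 r2" "\<beta>2 * cmat M \<in> carrier_mat 1 r2"
        using Y(13) b cc c by simp_all
      show ?thesis
        unfolding e4 add_row_cmat[OF k cc(5)] row_cmat_assoc[OF Y(13) c(4) cc(5)] row_cmat_assoc[OF b(3) cc(2,5)]
          mat_inv_right[OF c(5)] row_cmat_one[OF b(3)] ..
    qed
    then have e: "\<alpha>2 * cmat ?G44 = a1 * cmat (Q * S' * (L * mat_inv r2 M)) + \<beta>2"
      unfolding b1S' row_cmat_assoc[OF a(1) Wc LM] row_cmat_smult[OF a(3) cc(5)]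
      using mult_smult_assoc_mat[OF a(3), of "cmat (mat_inv r2 M)" r2 "[:d:]"] cc by simp
    have "a1 * cmat ?G24 = [:- 1:] \<cdot>\<^sub>m (a1 * cmat (Q * S' * (L * mat_inv r2 M)))"
      by (rule row_cmat_smult[OF a(1) mult_carrier_mat[OF Wc LM]])
    moreover have "[:- 1:] \<cdot>\<^sub>m Z + (Z + B) = B" if "Z \<in> carrier_mat 1 r2" "B \<in> carrier_mat 1 r2" for Z B :: "'k poly mat"
      by (rule eq_matI) (use that in auto)
    ultimately show ?thesis unfolding e using a b Wc LM by simp
  qed
  have 3: "(a1 * cmat ?G25 + a2 * cmat v + \<alpha>2 * cmat ?G45) $$ (0, 0) + smult d \<alpha> - Delta r1 a1 Q (strict_upper S') = \<beta>"
  proof -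
    have i1: "(a1 * cmat ?G25) $$ (0, 0) = (a1 * cmat u) $$ (0, 0) - ((b1 * cmat S' * cmat w1) $$ (0, 0) + (a1 * cmat (?G24 * w2)) $$ (0, 0))"
    proof -
      have k: "Q * S' * w1 \<in> carrier_mat r1 1" "?G24 * w2 \<in> carrier_mat r1 1" using Wc c G24 by simp_all
      have "a1 * cmat ?G25 = a1 * cmat u + [:- 1:] \<cdot>\<^sub>m (a1 * cmat (Q * S' * w1) + a1 * cmat (?G24 * w2))"
        unfolding row_cmat_add[OF a(1) c(7) smult_carrier_mat[OF add_carrier_mat[OF k(2)]]] 
          row_cmat_smult[OF a(1) add_carrier_mat[OF k(2)]] row_cmat_add[OF a(1) k] ..
      moreover have "(A + [:- 1:] \<cdot>\<^sub>m (B + C)) $$ (0, 0) = A $$ (0, 0) - (B $$ (0, 0) + C $$ (0, 0))"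
        if "A \<in> carrier_mat 1 1" "B \<in> carrier_mat 1 1" "C \<in> carrier_mat 1 1" for A B C :: "'k poly mat"
        using that by simp
      moreover have "a1 * cmat u \<in> carrier_mat 1 1" "a1 * cmat (Q * S' * w1) \<in> carrier_mat 1 1" "a1 * cmat (?G24 * w2) \<in> carrier_mat 1 1"
        using a(1) c(7) k by simp_all
      ultimately show ?thesis
        unfolding b1S' row_cmat_assoc[OF a(1) Wc c(9)] by metis
    qed
    have i2: "(\<alpha>2 * cmat ?G45) $$ (0, 0) = - (\<alpha>2 * cmat (?G44 * w2)) $$ (0, 0)"
      unfolding row_cmat_smult[OF a(3) mult_carrier_mat[OF G44 c(10)]] using a c by (simp del: index_mult_mat(1))
    have i3: "(\<beta>2 * cmat w2) $$ (0, 0) = (a1 * cmat (?G24 * w2)) $$ (0, 0) + (\<alpha>2 * cmat (?G44 * w2)) $$ (0, 0)"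
    proof -
      have k: "a1 * cmat ?G24 \<in> carrier_mat 1 r2" "\<alpha>2 * cmat ?G44 \<in> carrier_mat 1 r2" using a G24 G44 by simp_all
      show ?thesis
        unfolding 2[symmetric] add_row_cmat[OF k c(10)] row_cmat_assoc[OF a(1) G24 c(10)] row_cmat_assoc[OF a(3) G44 c(10)]
        using a c G24 G44 by (simp del: index_mult_mat(1))
    qed
    have e5': "smult d \<alpha> + smult d (quad r1 S a1) + ((a1 * cmat u) $$ (0, 0) + (a2 * cmat v) $$ (0, 0))
      = \<beta> + (smult d (quad r1 S a1) + Delta r1 a1 Q (strict_upper S')) + ((b1 * cmat S' * cmat w1) $$ (0, 0) + (\<beta>2 * cmat w2) $$ (0, 0))"
      using e5 unfolding quad_congruence[OF Y(1) X(9) cc(1) a(1) QS'Q, folded e1] smult_add_right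
      using a b c Y(13) by (simp del: index_mult_mat(1))
    have "(a1 * cmat ?G25 + a2 * cmat v + \<alpha>2 * cmat ?G45) $$ (0, 0)
        = (a1 * cmat ?G25) $$ (0, 0) + (a2 * cmat v) $$ (0, 0) + (\<alpha>2 * cmat ?G45) $$ (0, 0)"
      using a c G25 G45 by (simp del: index_mult_mat(1))
    also have "\<dots> + smult d \<alpha> - Delta r1 a1 Q (strict_upper S') = \<beta>"
      unfolding i1 i2 using e5' unfolding i3 by (simp add: algebra_simps del: index_mult_mat(1))
    finally show ?thesis .
  qed
  have "star l r1 r2 x g = y"
    unfolding x_eq y_eq star_def Let_def prod.case blk 1 2 3 e1[symmetric] e2[symmetric] ..
  then show ?thesis using g by blast
qed

section \<open>Passage to the quotients\<close>

lemma quotient_bij: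
  assumes E: "equiv H E" and h: "h ` X = H"
    and O: "\<And>x y. (x, y) \<in> O' \<longleftrightarrow> x \<in> X \<and> y \<in> X \<and> (h x, h y) \<in> E"
  shows "\<exists>F. (\<forall>x\<in>X. F (O' `` {x}) = E `` {h x}) \<and> bij_betw F (X // O') (H // E)"
proof -
  \<comment> \<open>Saturating the image of a class involves no choice of representative, so F is
    well defined at once. All elements of one class have the same E-class as image, and reflexivity
    of E puts x into its own class, so the value at the class of x is the class of h x.\<close>
  define F where "F C = E `` (h ` C)" for C
  have F: "F (O' `` {x}) = E `` {h x}" if x: "x \<in> X" for x
  proof -
    have "h x \<in> H" using x h by blast
    then have "(h x, h x) \<in> E" using E by (meson equiv_class_self Image_singleton_iff)
    then have "x \<in> O' `` {x}" using x O by blast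
    moreover have "E `` {h z} = E `` {h x}" if "z \<in> O' `` {x}" for z
      using equiv_class_eq[OF E] that O by blast
    ultimately show ?thesis unfolding F_def by blast
  qed
  have "inj_on F (X // O')"
  proof (rule inj_onI)
    fix C D assume "C \<in> X // O'" "D \<in> X // O'" and FCD: "F C = F D"
    then obtain x y where xy: "x \<in> X" "C = O' `` {x}" "y \<in> X" "D = O' `` {y}" by (auto elim!: quotientE)
    then have "E `` {h x} = E `` {h y}" using FCD F by simp
    then have "(h x, z) \<in> E \<longleftrightarrow> (h y, z) \<in> E" for z by blast
    then show "C = D" using xy O by auto
  qed
  moreover have "F ` (X // O') = H // E"
    using F unfolding quotient_def h[symmetric] by auto
  ultimately show ?thesis using F unfolding bij_betw_def by blast
qed

lemma equiv_pmat_equiv_rel: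
  fixes H :: "'k::field poly mat set"
  assumes c: "H \<subseteq> carrier_mat n n"
  shows "equiv H (pmat_equiv_rel n H)"
proof (rule equivI)
  have iff: "pmat_equiv n A B \<longleftrightarrow> (\<exists>P\<in>GL n. A * cmat P = cmat P * B)" if "A \<in> H" "B \<in> H" for A B
    using pmat_equiv_iff[of A n B] that c by blast
  show "pmat_equiv_rel n H \<subseteq> H \<times> H" by (auto simp: pmat_equiv_rel_def)
  show "refl_on H (pmat_equiv_rel n H)"
  proof (rule refl_onI)
    fix A assume A: "A \<in> H"
    then have "A * cmat (1\<^sub>m n) = cmat (1\<^sub>m n) * A" using c by (auto simp: cmat_one)
    then show "(A, A) \<in> pmat_equiv_rel n H" using A iff[OF A A] GL_one by (auto simp: pmat_equiv_rel_def)
  qed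
  show "sym (pmat_equiv_rel n H)"
  proof (rule symI)
    fix A B assume "(A, B) \<in> pmat_equiv_rel n H"
    then obtain P where AB: "A \<in> H" "B \<in> H" and P: "P \<in> GL n" "cmat (mat_inv n P) * A * cmat P = B"
      by (auto simp: pmat_equiv_rel_def pmat_equiv_def)
    let ?R = "mat_inv n P"
    have cs: "A \<in> carrier_mat n n" "cmat P \<in> carrier_mat n n" "cmat ?R \<in> carrier_mat n n"
      using AB c GL_carrier[OF P(1)] mat_inv_carrier[OF P(1)] by auto
    have "cmat P * cmat ?R = 1\<^sub>m n"
      using cmat_mult[OF GL_carrier[OF P(1)] mat_inv_carrier[OF P(1)]] by (simp add: mat_inv_right[OF P(1)] cmat_one)
    then have "B * cmat ?R = cmat ?R * A"
      unfolding P(2)[symmetric] using assoc_mult_mat[OF mult_carrier_mat[OF cs(3,1)] cs(2,3)] cs by simp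
    then show "(B, A) \<in> pmat_equiv_rel n H"
      using AB iff[OF AB(2,1)] mat_inv_GL[OF P(1)] by (auto simp: pmat_equiv_rel_def)
  qed
  show "trans (pmat_equiv_rel n H)"
  proof (rule transI)
    fix A B C assume *: "(A, B) \<in> pmat_equiv_rel n H" "(B, C) \<in> pmat_equiv_rel n H"
    then have H: "A \<in> H" "B \<in> H" "C \<in> H" by (auto simp: pmat_equiv_rel_def)
    obtain P R where P: "P \<in> GL n" "A * cmat P = cmat P * B" and R: "R \<in> GL n" "B * cmat R = cmat R * C"
      using * iff[OF H(1,2)] iff[OF H(2,3)] by (auto simp: pmat_equiv_rel_def)
    have cs: "A \<in> carrier_mat n n" "B \<in> carrier_mat n n" "C \<in> carrier_mat n n" "cmat P \<in> carrier_mat n n" "cmat R \<in> carrier_mat n n"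
      using H c GL_carrier[OF P(1)] GL_carrier[OF R(1)] by auto
    have "A * (cmat P * cmat R) = cmat P * (B * cmat R)"
      using assoc_mult_mat[OF cs(1,4,5)] assoc_mult_mat[OF cs(4,2,5)] P(2) by simp
    also have "\<dots> = (cmat P * cmat R) * C" using assoc_mult_mat[OF cs(4,5,3)] R(2) by simp
    finally have "A * cmat (P * R) = cmat (P * R) * C"
      unfolding cmat_mult[OF GL_carrier[OF P(1)] GL_carrier[OF R(1)]] .
    then show "(A, C) \<in> pmat_equiv_rel n H"
      using H iff[OF H(1,3)] GL_mult[OF P(1) R(1)] by (auto simp: pmat_equiv_rel_def)
  qed
qed

theorem theorem3p23:
  fixes m l r1 r2 :: nat
    and HE :: "'k::field poly mat set"
    and X :: "'k datum set"
  assumes "CHAR('k) > 0"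
    and "m \<ge> 1"
    and "(l, r1, r2) \<in> Omega m"
  defines "HE \<equiv> exp_part (m + 2) (H_set m l r1 r2)"
    and "X \<equiv> X_set l r1 r2"
  shows "hbar m l r1 r2 \<in> X \<rightarrow> HE \<and>
    (\<exists>F. (\<forall>x\<in>X. F (orbit_rel l r1 r2 `` {x}) = pmat_equiv_rel (m + 2) HE `` {hbar m l r1 r2 x})
       \<and> bij_betw F (X // orbit_rel l r1 r2) (HE // pmat_equiv_rel (m + 2) HE))"
proof
  have HE: "hbar m l r1 r2 ` X = HE"
    unfolding HE_def X_def using exp_part_H_set_eq[OF assms(3,1)] by simp
  then show hX: "hbar m l r1 r2 \<in> X \<rightarrow> HE" by blast
  have "HE \<subseteq> carrier_mat (m + 2) (m + 2)" by (auto simp: HE_def exp_part_def exponential_def)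
  then have E: "equiv HE (pmat_equiv_rel (m + 2) HE)" by (rule equiv_pmat_equiv_rel)
  have "(x, y) \<in> orbit_rel l r1 r2 \<longleftrightarrow> x \<in> X \<and> y \<in> X \<and> (hbar m l r1 r2 x, hbar m l r1 r2 y) \<in> pmat_equiv_rel (m + 2) HE" for x y
  proof
    assume "(x, y) \<in> orbit_rel l r1 r2"
    then obtain g where "x \<in> X" "g \<in> G_set l r1 r2" "y = star l r1 r2 x g"
      by (auto simp: orbit_rel_def X_def)
    then show "x \<in> X \<and> y \<in> X \<and> (hbar m l r1 r2 x, hbar m l r1 r2 y) \<in> pmat_equiv_rel (m + 2) HE"
      using star_in_X_set[OF assms(1,3), of x g] HE by (auto simp: X_def pmat_equiv_rel_def)
  next
    assume "x \<in> X \<and> y \<in> X \<and> (hbar m l r1 r2 x, hbar m l r1 r2 y) \<in> pmat_equiv_rel (m + 2) HE"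
    then obtain g where "x \<in> X_set l r1 r2" "g \<in> G_set l r1 r2" "star l r1 r2 x g = y"
      using equiv_imp_star[OF assms(1,3), of x y] unfolding X_def pmat_equiv_rel_def by blast
    then show "(x, y) \<in> orbit_rel l r1 r2" unfolding orbit_rel_def by blast
  qed
  then show "\<exists>F. (\<forall>x\<in>X. F (orbit_rel l r1 r2 `` {x}) = pmat_equiv_rel (m + 2) HE `` {hbar m l r1 r2 x})
       \<and> bij_betw F (X // orbit_rel l r1 r2) (HE // pmat_equiv_rel (m + 2) HE)"
    by (rule quotient_bij[OF E HE])
qed

end
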